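(* Let $K_0\in\mathcal S_{\mathrm{ML}}$ be an initial stabilizing controller. Suppose that the step-sizes $\eta_l,\eta>0$ satisfy $$\eta_l\le\min\left\{\frac{n_u}{\sqrt2\,\bar h_H},\ \frac{1}{\sqrt2\,\bar h_{\mathrm{grad}}},\ \frac{1}{\sqrt{12\left(12\bar h_{\mathrm{grad}}^2n_u^2+\bar h_H^2\right)}}\right\},\qquad \eta\le\frac{1}{4\bar h_{\mathrm{grad}}},$$ and that the heterogeneity satisfies $$\bar f_z(\bar\epsilon)\le\sqrt{\min_{i\in[M]}\frac{\lambda_i\Delta_0^{(i)}}{288\,n_u^3}}.$$ Then, for every iteration $n$ of the model-based MAML-LQR algorithm (defined in the context) started at $K_0$ and every $i\in[M]$, one has $\bar K^{(i)}_n\in\mathcal S_{\mathrm{ML}}$ and $K_n\in\mathcal S_{\mathrm{ML}}$.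
   Context: **Tasks.** Let $M\ge1$, $n_x\ge n_u\ge 1$, $[M]=\{1,\dots,M\}$. For $i\in[M]$, an LQR task is a tuple $\mathcal T^{(i)}=(A^{(i)},B^{(i)},Q^{(i)},R^{(i)})$ with $A^{(i)}\in\mathbb R^{n_x\times n_x}$, $B^{(i)}\in\mathbb R^{n_x\times n_u}$, and $Q^{(i)}\in\mathbb R^{n_x\times n_x}$, $R^{(i)}\in\mathbb R^{n_u\times n_u}$ symmetric positive definite. Dynamics: $x^{(i)}_{t+1}=A^{(i)}x^{(i)}_t+B^{(i)}u^{(i)}_t$, $x_0^{(i)}\sim\mathcal X_0$, with $\mathbb E[x_0^{(i)}]=0$ and $\Sigma_0:=\mathbb E[x^{(i)}_0x_0^{(i)\top}]\succ\mu I_{n_x}$ for some $\mu>0$. For $K\in\mathbb R^{n_u\times n_x}$, using $u_t^{(i)}=-Kx_t^{(i)}$, put $J^{(i)}(K)=\mathbb E\big[\sum_{t\ge0}x_t^{(i)\top}(Q^{(i)}+K^\top R^{(i)}K)x_t^{(i)}\big]$ and $\Sigma_K^{(i)}=\mathbb E\sum_{t\ge0}x_t^{(i)}x_t^{(i)\top}$. Let $\mathcal K^{(i)}=\{K:\rho(A^{(i)}-B^{(i)}K)<1\}$ ($\rho$ = spectral radius), $K_i^\star=\arg\min_{K\in\mathcal K^{(i)}}J^{(i)}(K)$, and for $K\in\mathcal K^{(i)}$ let $P_K^{(i)}$ be the solution of $P=Q^{(i)}+K^\top R^{(i)}K+(A^{(i)}-B^{(i)}K)^\top P(A^{(i)}-B^{(i)}K)$.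 **Stabilizing sub-level set.** Given $K_0$ and constants $\gamma_i>0$, put $\Delta_0^{(i)}=J^{(i)}(K_0)-J^{(i)}(K_i^\star)$, $\mathcal S^{(i)}=\{K\in\mathcal K^{(i)}: J^{(i)}(K)-J^{(i)}(K_i^\star)\le\gamma_i\Delta_0^{(i)}\}$, and $\mathcal S_{\mathrm{ML}}=\bigcap_{i\in[M]}\mathcal S^{(i)}$. Put $\lambda_i=4\mu^2\sigma_{\min}(R^{(i)})/\|\Sigma^{(i)}_{K_i^\star}\|$. **Model-based MAML-LQR algorithm.** $\nabla J^{(i)}$ is the gradient and $\nabla^2J^{(i)}(K)$ the Hessian operator on $\mathbb R^{n_u\times n_x}$ (Frobenius inner product). For $n=0,\dots,N-1$: for each $i\in[M]$ compute $\bar K^{(i)}_n=K_n-\eta_l\nabla J^{(i)}(K_n)$ and $H^{(i)}(K_n)=I-\eta_l\nabla^2J^{(i)}(K_n)$ (a linear operator); then set $K_{n+1}=K_n-\frac{\eta}{M}\sum_{i=1}^MH^{(i)}(K_n)\nabla J^{(i)}(\bar K_n^{(i)})$. The output is $K_N$. **Notation.** $\|\cdot\|$ is the spectral norm. For a family indexed by $i$, $\|X\|_{\max}=\max_i\|X^{(i)}\|$ and $\|X\|_{\min}=\min_i\|X^{(i)}\|$; e.g. $\|A-BK\|_{\max}=\max_i\|A^{(i)}-B^{(i)}K\|$, $\|P_K\|_{\max}=\max_i\|P_K^{(i)}\|$. Put $J_{\max}(K)=\max_iJ^{(i)}(K)$, $J_{\min}=\min_iJ^{(i)}(K_i^\star)$,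 $\sigma_Q=\min_i\sigma_{\min}(Q^{(i)})$, $\nu(K)=\frac{J_{\max}(K)}{\sigma_Q\mu}$. For a function $h(K)$, $\bar h=\sup_{K\in\mathcal S_{\mathrm{ML}}}h(K)$. **Heterogeneity.** $\epsilon_1,\dots,\epsilon_4\ge0$ are such that $\max_{i\ne j}\|A^{(i)}-A^{(j)}\|\le\epsilon_1$, $\max_{i\ne j}\|B^{(i)}-B^{(j)}\|\le\epsilon_2$, $\max_{i\ne j}\|Q^{(i)}-Q^{(j)}\|\le\epsilon_3$, $\max_{i\ne j}\|R^{(i)}-R^{(j)}\|\le\epsilon_4$; $\bar\epsilon=(\epsilon_1,\dots,\epsilon_4)$. The index $z\in\{1,2,3\}$ only names the case: $z=1$ system heterogeneity ($\epsilon_3=\epsilon_4=0$), $z=2$ cost heterogeneity ($\epsilon_1=\epsilon_2=0$), $z=3$ both. $f_z(\bar\epsilon)=\sum_{k=1}^4\epsilon_kh^k_{\mathrm{het}}(K)$ and $\bar f_z(\bar\epsilon)=\sup_{K\in\mathcal S_{\mathrm{ML}}}f_z(\bar\epsilon)$, where, with $e(K)=\|R\|_{\max}\|K\|+\frac{J_{\max}(K)(\|B\|_{\max}^2\|K\|+\|B\|_{\max}\|A\|_{\max})}{\mu}$ and $q(K)=\|Q\|_{\max}+\|K\|^2\|R\|_{\max}$, $$h^1_{\mathrm{het}}=2\Big[\tfrac{J_{\max}(K)}{\sigma_Q}\|B\|_{\max}\big(\|P_K\|_{\max}+4\|A-BK\|_{\max}^2q(K)\nu^2(K)\big)+4e(K)\nu^2(K)\|A-BK\|_{\max}\|\Sigma_0\|\Big],$$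 $$h^2_{\mathrm{het}}=2\Big[\tfrac{J_{\max}(K)}{\sigma_Q}\big(\|A-BK\|_{\max}\|P_K\|_{\max}+\|B\|_{\max}\|P_K\|_{\max}\|K\|+4\|B\|_{\max}\|K\|\|A-BK\|_{\max}^2q(K)\nu^2(K)\big)+4e(K)\nu^2(K)\|K\|\|A-BK\|_{\max}\|\Sigma_0\|\Big],$$ $$h^3_{\mathrm{het}}=2\tfrac{J_{\max}(K)}{\sigma_Q}\|B\|_{\max}\|A-BK\|_{\max}\nu(K),\qquad h^4_{\mathrm{het}}=2\tfrac{J_{\max}(K)}{\sigma_Q}\big(\|K\|+\|K\|^2\|B\|_{\max}\|A-BK\|_{\max}\nu(K)\big).$$ **Constants.** ($h_H$ is the paper's uniform bound for $\|\nabla^2J^{(i)}(K)\|_F$, and $h_{\mathrm{grad}}$ its local Lipschitz constant of $\nabla J^{(i)}$ in Frobenius norm.) $$h_0(K)=\sqrt{\tfrac{\max_i\|R^{(i)}+B^{(i)\top}P_K^{(i)}B^{(i)}\|\,(J_{\max}(K)-J_{\min})}{\mu}},\qquad \tilde\xi_{\max}=\tfrac1{\|Q\|_{\min}}\Big(\tfrac{(1+\|B\|_{\max}^2)J_{\max}(K)}{\mu}+\|R\|_{\max}-1\Big),$$ $$h_H(K)=\Big(2\|R\|_{\max}+\tfrac{2\|B\|_{\max}J_{\max}(K)}{\mu}+\tfrac{4\sqrt2\,\tilde\xi_{\max}\|B\|_{\max}J_{\max}(K)}{\mu}\Big)\tfrac{J_{\max}(K)n_u}{\|Q\|_{\min}},$$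 $$h_\Delta(K)=\frac{\max_i\sigma_{\min}(Q^{(i)})\,\mu}{4\|B\|_{\max}J_{\max}(K)(\|A-BK\|_{\max}+1)},$$ $$h_{\mathrm{cost}}(K)=\tfrac{4\operatorname{Tr}(\Sigma_0)J_{\max}(K)\|R\|_{\max}}{\mu\sigma_Q}\Big(\|K\|+\tfrac{h_\Delta(K)}2+\|B\|_{\max}\|K\|^2(\|A-BK\|_{\max}+1)\nu(K)\Big),$$ $$h_{\mathrm{grad}}(K)=\tfrac{4J_{\max}(K)}{\sigma_Q}\Big[\|R\|_{\max}+\|B\|_{\max}\big(\|A\|_{\max}+\|B\|_{\max}(\|K\|+h_\Delta(K))\big)\tfrac{h_{\mathrm{cost}}(K)J_{\max}(K)}{\operatorname{Tr}(\Sigma_0)}+\|B\|_{\max}^2\tfrac{J_{\max}(K)}{\mu}\Big]+8\Big(\tfrac{J_{\max}(K)}{\sigma_Q}\Big)^2\tfrac{\|B\|_{\max}(\|A-BK\|_{\max}+1)}{\mu}h_0(K).$$ *)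

theory Defs
  imports "HOL-Probability.Probability"
begin

text \<open>An \<open>m \<times> n\<close> real matrix has type \<open>real^'n^'m\<close>. On this type the library's \<open>norm\<close> and
  \<open>inner\<close> are the Frobenius norm and inner product; the spectral norm is separate.\<close>

definition spec_norm :: "real^'n^'m \<Rightarrow> real" where
  "spec_norm X = onorm (\<lambda>v. X *v v)"

definition eigenvalues :: "real^'n^'n \<Rightarrow> complex set" where
  "eigenvalues X = {z. \<exists>v::complex^'n. v \<noteq> 0 \<and> map_matrix complex_of_real X *v v = z *s v}"

definition spec_radius :: "real^'n^'n \<Rightarrow> real" where
  "spec_radius X = Max (cmod ` eigenvalues X)"

text \<open>Square roots of the eigenvalues of \<open>X\<^sup>T X\<close>; used for square matrices only.\<close>

definition singular_values :: "real^'n^'n \<Rightarrow> real set" where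
  "singular_values X =
    {s. 0 \<le> s \<and> (\<exists>v. v \<noteq> 0 \<and> (transpose X ** X) *v v = s\<^sup>2 *\<^sub>R v)}"

definition sigma_min :: "real^'n^'n \<Rightarrow> real" where
  "sigma_min X = Min (singular_values X)"

definition posdef :: "real^'n^'n \<Rightarrow> bool" where
  "posdef X \<longleftrightarrow> transpose X = X \<and> (\<forall>v. v \<noteq> 0 \<longrightarrow> 0 < v \<bullet> (X *v v))"

definition outer :: "real^'n \<Rightarrow> real^'n \<Rightarrow> real^'n^'n" where
  "outer x y = (\<chi> i j. x $ i * y $ j)"

definition gradient :: "('a::real_inner \<Rightarrow> real) \<Rightarrow> 'a \<Rightarrow> 'a" where
  "gradient f x = (THE g. GDERIV f x :> g)"

definition hessian :: "('a::real_inner \<Rightarrow> real) \<Rightarrow> 'a \<Rightarrow> 'a \<Rightarrow> 'a" where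
  "hessian f x = frechet_derivative (gradient f) (at x)"

record ('x::finite, 'u::finite) lqr_task =
  Amat :: "real^'x^'x"
  Bmat :: "real^'u^'x"
  Qmat :: "real^'x^'x"
  Rmat :: "real^'u^'u"

definition closed_loop :: "('x::finite, 'u::finite) lqr_task \<Rightarrow> real^'x^'u \<Rightarrow> real^'x^'x" where
  "closed_loop S K = Amat S - Bmat S ** K"

definition stabilizing :: "('x::finite, 'u::finite) lqr_task \<Rightarrow> (real^'x^'u) set" where
  "stabilizing S = {K. spec_radius (closed_loop S K) < 1}"

primrec state ::
  "('x::finite, 'u::finite) lqr_task \<Rightarrow> real^'x^'u \<Rightarrow> real^'x \<Rightarrow> nat \<Rightarrow> real^'x" where
  "state S K x0 0 = x0"
| "state S K x0 (Suc t) = Amat S *v state S K x0 t + Bmat S *v (- (K *v state S K x0 t))"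

definition stage_weight :: "('x::finite, 'u::finite) lqr_task \<Rightarrow> real^'x^'u \<Rightarrow> real^'x^'x" where
  "stage_weight S K = Qmat S + transpose K ** Rmat S ** K"

text \<open>\<open>D\<close> is the law of the initial state.\<close>

definition init_cov :: "(real^'x) measure \<Rightarrow> real^'x^'x" where
  "init_cov D = (\<integral>x. outer x x \<partial>D)"

text \<open>The summands are nonnegative whenever \<open>Qmat S\<close> and \<open>Rmat S\<close> are positive definite, so
  \<open>ennreal\<close> truncates nothing. For a non-stabilizing \<open>K\<close> the expected cost may be infinite, in which case \<open>cost\<close> is \<open>0\<close>.
  The cost is therefore only ever compared on \<open>stabilizing S\<close>, where it is finite.\<close>

definition ext_cost ::
  "(real^'x) measure \<Rightarrow> ('x::finite, 'u::finite) lqr_task \<Rightarrow> real^'x^'u \<Rightarrow> ennreal" where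
  "ext_cost D S K =
    (\<integral>\<^sup>+x. (\<Sum>t. ennreal (state S K x t \<bullet> (stage_weight S K *v state S K x t))) \<partial>D)"

definition cost ::
  "(real^'x) measure \<Rightarrow> ('x::finite, 'u::finite) lqr_task \<Rightarrow> real^'x^'u \<Rightarrow> real" where
  "cost D S K = enn2real (ext_cost D S K)"

definition state_cov ::
  "(real^'x) measure \<Rightarrow> ('x::finite, 'u::finite) lqr_task \<Rightarrow> real^'x^'u \<Rightarrow> real^'x^'x" where
  "state_cov D S K = (\<integral>x. (\<Sum>t. outer (state S K x t) (state S K x t)) \<partial>D)"

definition opt_gain ::
  "(real^'x) measure \<Rightarrow> ('x::finite, 'u::finite) lqr_task \<Rightarrow> real^'x^'u" where
  "opt_gain D S = arg_min_on (cost D S) (stabilizing S)"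

definition lyap :: "('x::finite, 'u::finite) lqr_task \<Rightarrow> real^'x^'u \<Rightarrow> real^'x^'x" where
  "lyap S K =
    (THE P. P = stage_weight S K + transpose (closed_loop S K) ** P ** closed_loop S K)"

definition cost_gap ::
  "(real^'x) measure \<Rightarrow> ('x::finite, 'u::finite) lqr_task \<Rightarrow> real^'x^'u \<Rightarrow> real" where
  "cost_gap D S K = cost D S K - cost D S (opt_gain D S)"

definition sublevel ::
  "(real^'x) measure \<Rightarrow> ('x::finite, 'u::finite) lqr_task \<Rightarrow> real \<Rightarrow> real^'x^'u \<Rightarrow> (real^'x^'u) set"
  where
  "sublevel D S c K0 = {K \<in> stabilizing S. cost_gap D S K \<le> c * cost_gap D S K0}"

definition lambda_task ::
  "(real^'x) measure \<Rightarrow> real \<Rightarrow> ('x::finite, 'u::finite) lqr_task \<Rightarrow> real" where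
  "lambda_task D \<mu> S =
    4 * \<mu>\<^sup>2 * sigma_min (Rmat S) / spec_norm (state_cov D S (opt_gain D S))"

definition max_norm :: "nat \<Rightarrow> (nat \<Rightarrow> real^'n^'m) \<Rightarrow> real" where
  "max_norm M X = (MAX i\<in>{1..M}. spec_norm (X i))"

definition min_norm :: "nat \<Rightarrow> (nat \<Rightarrow> real^'n^'m) \<Rightarrow> real" where
  "min_norm M X = (MIN i\<in>{1..M}. spec_norm (X i))"

context
  fixes D :: "(real^'x::finite) measure"
    and M :: nat
    and T :: "nat \<Rightarrow> ('x, 'u::finite) lqr_task"
    and \<mu> :: real
begin

definition S_ML :: "(nat \<Rightarrow> real) \<Rightarrow> real^'x^'u \<Rightarrow> (real^'x^'u) set" where
  "S_ML \<gamma> K0 = (\<Inter>i\<in>{1..M}. sublevel D (T i) (\<gamma> i) K0)"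

definition J_max :: "real^'x^'u \<Rightarrow> real" where
  "J_max K = (MAX i\<in>{1..M}. cost D (T i) K)"

definition J_min :: real where
  "J_min = (MIN i\<in>{1..M}. cost D (T i) (opt_gain D (T i)))"

definition sigma_Q :: real where
  "sigma_Q = (MIN i\<in>{1..M}. sigma_min (Qmat (T i)))"

definition nu :: "real^'x^'u \<Rightarrow> real" where
  "nu K = J_max K / (sigma_Q * \<mu>)"

abbreviation "nA \<equiv> max_norm M (\<lambda>i. Amat (T i))"
abbreviation "nB \<equiv> max_norm M (\<lambda>i. Bmat (T i))"
abbreviation "nQ \<equiv> max_norm M (\<lambda>i. Qmat (T i))"
abbreviation "nR \<equiv> max_norm M (\<lambda>i. Rmat (T i))"
abbreviation "nQmin \<equiv> min_norm M (\<lambda>i. Qmat (T i))"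
abbreviation "nAcl K \<equiv> max_norm M (\<lambda>i. closed_loop (T i) K)"
abbreviation "nP K \<equiv> max_norm M (\<lambda>i. lyap (T i) K)"

definition e_het :: "real^'x^'u \<Rightarrow> real" where
  "e_het K = nR * spec_norm K + J_max K * (nB\<^sup>2 * spec_norm K + nB * nA) / \<mu>"

definition q_het :: "real^'x^'u \<Rightarrow> real" where
  "q_het K = nQ + (spec_norm K)\<^sup>2 * nR"

definition h_het1 :: "real^'x^'u \<Rightarrow> real" where
  "h_het1 K = 2 *
    (J_max K / sigma_Q * nB * (nP K + 4 * (nAcl K)\<^sup>2 * q_het K * (nu K)\<^sup>2)
     + 4 * e_het K * (nu K)\<^sup>2 * nAcl K * spec_norm (init_cov D))"

definition h_het2 :: "real^'x^'u \<Rightarrow> real" where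
  "h_het2 K = 2 *
    (J_max K / sigma_Q *
       (nAcl K * nP K + nB * nP K * spec_norm K
        + 4 * nB * spec_norm K * (nAcl K)\<^sup>2 * q_het K * (nu K)\<^sup>2)
     + 4 * e_het K * (nu K)\<^sup>2 * spec_norm K * nAcl K * spec_norm (init_cov D))"

definition h_het3 :: "real^'x^'u \<Rightarrow> real" where
  "h_het3 K = 2 * (J_max K / sigma_Q) * nB * nAcl K * nu K"

definition h_het4 :: "real^'x^'u \<Rightarrow> real" where
  "h_het4 K = 2 * (J_max K / sigma_Q) *
    (spec_norm K + (spec_norm K)\<^sup>2 * nB * nAcl K * nu K)"

definition f_het :: "(nat \<Rightarrow> real) \<Rightarrow> real^'x^'u \<Rightarrow> real" where
  "f_het \<epsilon> K = \<epsilon> 1 * h_het1 K + \<epsilon> 2 * h_het2 K + \<epsilon> 3 * h_het3 K + \<epsilon> 4 * h_het4 K"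

definition h_0 :: "real^'x^'u \<Rightarrow> real" where
  "h_0 K = sqrt
    (max_norm M (\<lambda>i. Rmat (T i) + transpose (Bmat (T i)) ** lyap (T i) K ** Bmat (T i))
     * (J_max K - J_min) / \<mu>)"

definition xi_max :: "real^'x^'u \<Rightarrow> real" where
  "xi_max K = 1 / nQmin * ((1 + nB\<^sup>2) * J_max K / \<mu> + nR - 1)"

definition h_H :: "real^'x^'u \<Rightarrow> real" where
  "h_H K =
    (2 * nR + 2 * nB * J_max K / \<mu> + 4 * sqrt 2 * xi_max K * nB * J_max K / \<mu>)
    * (J_max K * real CARD('u) / nQmin)"

text \<open>The formula presupposes that some \<open>Bmat (T i)\<close> is nonzero. If all of them vanish, division
  by zero yields \<open>h_Delta K = 0\<close>.\<close>

definition h_Delta :: "real^'x^'u \<Rightarrow> real" where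
  "h_Delta K = (MAX i\<in>{1..M}. sigma_min (Qmat (T i))) * \<mu> / (4 * nB * J_max K * (nAcl K + 1))"

definition h_cost :: "real^'x^'u \<Rightarrow> real" where
  "h_cost K = 4 * trace (init_cov D) * J_max K * nR / (\<mu> * sigma_Q)
    * (spec_norm K + h_Delta K / 2 + nB * (spec_norm K)\<^sup>2 * (nAcl K + 1) * nu K)"

definition h_grad :: "real^'x^'u \<Rightarrow> real" where
  "h_grad K = 4 * J_max K / sigma_Q *
      (nR + nB * (nA + nB * (spec_norm K + h_Delta K)) * (h_cost K * J_max K / trace (init_cov D))
       + nB\<^sup>2 * (J_max K / \<mu>))
    + 8 * (J_max K / sigma_Q)\<^sup>2 * (nB * (nAcl K + 1) / \<mu>) * h_0 K"

definition inner_step :: "real \<Rightarrow> nat \<Rightarrow> real^'x^'u \<Rightarrow> real^'x^'u" where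
  "inner_step \<eta>l i K = K - \<eta>l *\<^sub>R gradient (cost D (T i)) K"

definition H_op :: "real \<Rightarrow> nat \<Rightarrow> real^'x^'u \<Rightarrow> real^'x^'u \<Rightarrow> real^'x^'u" where
  "H_op \<eta>l i K V = V - \<eta>l *\<^sub>R hessian (cost D (T i)) K V"

primrec maml :: "real \<Rightarrow> real \<Rightarrow> real^'x^'u \<Rightarrow> nat \<Rightarrow> real^'x^'u" where
  "maml \<eta>l \<eta> K0 0 = K0"
| "maml \<eta>l \<eta> K0 (Suc n) = maml \<eta>l \<eta> K0 n - (\<eta> / real M) *\<^sub>R
    (\<Sum>i\<in>{1..M}. H_op \<eta>l i (maml \<eta>l \<eta> K0 n)
       (gradient (cost D (T i)) (inner_step \<eta>l i (maml \<eta>l \<eta> K0 n))))"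

end

text \<open>The real supremum is only meaningful for \<open>h\<close> bounded above on a non-empty \<open>S\<close>. It is
  applied to the continuous functions above on the compact set \<open>S_ML\<close>, which contains \<open>K0\<close>.\<close>

definition sup_on :: "'a set \<Rightarrow> ('a \<Rightarrow> real) \<Rightarrow> real" where
  "sup_on S h = (SUP K\<in>S. h K)"

end

theory Submission
  imports Defs "HOL-Computational_Algebra.Fundamental_Theorem_Algebra"
begin

text \<open>Each gradient \<open>\<nabla>J\<^sub>i(K) = 2 E \<Sigma>\<close> is differentiable on the open set of stabilizing gains, with
  derivative bounded by \<open>h_grad\<close>, so it is Lipschitz with constant \<open>L = sup h_grad\<close> along
  segments inside the common sublevel set. The gradients of two tasks differ by at most
  \<open>\<delta> = \<surd>n\<^sub>u sup f\<close> there. Follow a segment \<open>K - s V\<close>, where \<open>V\<close> is the inner or the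
  averaged outer direction, as long as it stays in the sublevel set. When the gap of task \<open>j\<close> is
  extremal, it is at least \<open>\<Delta>\<^sub>0\<close>, so gradient dominance and the heterogeneity hypothesis
  make \<open>\<parallel>\<nabla>J\<^sub>j\<parallel>\<close> at least \<open>16 \<delta>\<close>; since \<open>V\<close> is close to \<open>\<nabla>J\<^sub>j(K)\<close>, the cost \<open>J\<^sub>j\<close> strictly
  decreases there, and the segment cannot leave. If some \<open>\<Delta>\<^sub>0\<close> vanishes, then all gradients
  vanish on the sublevel set and the iteration is constant.\<close>

subsection \<open>Matrix norms\<close>

text \<open>The cost and all Lipschitz bounds are controlled only inside the sublevel set, and
  nothing makes that set convex. A descent inequality between the two ends of a step would need the
  segment to lie inside already, which is what has to be shown; hence membership is propagated along
  the segment. The spectral radius is traded for square summability of the matrix powers, so that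
  Lyapunov solutions become series. One identity then recurs: a trial matrix misses the Lyapunov
  solution by the solution for its own residual. It yields the derivatives, the comparison of two
  gains and the comparison of two tasks. An extremal gap is at least the initial one because
  \<open>K0\<close> lies in its own sublevel set. The factor sqrt(n_u) in delta passes from the
  spectral to the Frobenius norm, and 16 is admissible because 16^2 = 256 is below 288.\<close>

lemma matrix_sub_ldistrib: "A ** (B - C) = A ** B - A ** (C::real^'p^'n)" for A :: "real^'n^'m"
  by (simp add: vec_eq_iff matrix_matrix_mult_def right_diff_distrib sum_subtractf)

lemma matrix_sub_rdistrib: "(A - B) ** C = A ** C - B ** (C::real^'p^'n)" for A :: "real^'n^'m"
  by (simp add: vec_eq_iff matrix_matrix_mult_def left_diff_distrib sum_subtractf)

lemma matrix_add_rdistrib: "(A + B) ** C = A ** C + B ** (C::real^'p^'n)" for A :: "real^'n^'m"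
  by (simp add: vec_eq_iff matrix_matrix_mult_def distrib_right sum.distrib)

lemma matrix_scaleR_left: "(c *\<^sub>R A) ** B = c *\<^sub>R (A ** (B::real^'p^'n))" for A :: "real^'n^'m"
  by (simp add: vec_eq_iff matrix_matrix_mult_def sum_distrib_left ac_simps)

lemma matrix_scaleR_right: "A ** (c *\<^sub>R B) = c *\<^sub>R (A ** (B::real^'p^'n))" for A :: "real^'n^'m"
  by (simp add: vec_eq_iff matrix_matrix_mult_def sum_distrib_left ac_simps)

lemma transpose_add: "transpose (A + B) = transpose A + transpose (B::real^'n^'m)"
  and transpose_diff: "transpose (A - B) = transpose A - transpose (B::real^'n^'m)"
  and transpose_scaleR: "transpose (c *\<^sub>R B) = c *\<^sub>R transpose (B::real^'n^'m)"
  and transpose_uminus: "transpose (- B) = - transpose (B::real^'n^'m)"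
  by (simp_all add: vec_eq_iff transpose_def)

lemmas mat_distribs = matrix_add_ldistrib matrix_add_rdistrib matrix_sub_ldistrib
  matrix_sub_rdistrib matrix_scaleR_left matrix_scaleR_right transpose_add transpose_diff
  transpose_scaleR matrix_transpose_mul matrix_mul_assoc transpose_uminus

lemma spec_norm_le: "norm (X *v v) \<le> spec_norm X * norm v" for X :: "real^'n^'m"
  unfolding spec_norm_def by (rule onorm) (rule matrix_vector_mul_bounded_linear)

lemma spec_norm_nonneg [simp]: "0 \<le> spec_norm X" for X :: "real^'n^'m"
  unfolding spec_norm_def by (rule onorm_pos_le) (rule matrix_vector_mul_bounded_linear)

lemma spec_norm_leI: "(\<And>v. norm (X *v v) \<le> c * norm v) \<Longrightarrow> spec_norm X \<le> c" for X :: "real^'n^'m"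
  unfolding spec_norm_def by (rule onorm_le)

lemma spec_norm_mult: "spec_norm (X ** Y) \<le> spec_norm X * spec_norm Y"
  for X :: "real^'n^'m" and Y :: "real^'p^'n"
proof (rule spec_norm_leI)
  fix v :: "real^'p"
  have "norm (X ** Y *v v) = norm (X *v (Y *v v))" by (simp add: matrix_vector_mul_assoc)
  also have "\<dots> \<le> spec_norm X * (spec_norm Y * norm v)"
    by (intro order_trans[OF spec_norm_le] mult_left_mono spec_norm_le) auto
  finally show "norm (X ** Y *v v) \<le> spec_norm X * spec_norm Y * norm v" by (simp add: mult.assoc)
qed

lemma spec_norm_add: "spec_norm (X + Y) \<le> spec_norm X + spec_norm Y" for X :: "real^'n^'m"
proof (rule spec_norm_leI)
  fix v :: "real^'n"
  have "norm ((X + Y) *v v) \<le> norm (X *v v) + norm (Y *v v)"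
    by (simp add: matrix_vector_mult_add_rdistrib norm_triangle_ineq)
  also have "\<dots> \<le> (spec_norm X + spec_norm Y) * norm v"
    using spec_norm_le[of X v] spec_norm_le[of Y v] by (simp add: distrib_right)
  finally show "norm ((X + Y) *v v) \<le> (spec_norm X + spec_norm Y) * norm v" .
qed

lemma spec_norm_minus: "spec_norm (- X) = spec_norm X" for X :: "real^'n^'m"
proof -
  have "(\<lambda>v. (- X) *v v) = (\<lambda>v. - (X *v v))"
    by (simp add: fun_eq_iff vec_eq_iff matrix_vector_mult_def sum_negf)
  then show ?thesis unfolding spec_norm_def by (simp add: onorm_neg)
qed

lemma spec_norm_diff: "spec_norm (X - Y) \<le> spec_norm X + spec_norm Y" for X :: "real^'n^'m"
  using spec_norm_add[of X "- Y"] by (simp add: spec_norm_minus)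

lemma spec_norm_scaleR: "spec_norm (c *\<^sub>R X) = \<bar>c\<bar> * spec_norm X" for X :: "real^'n^'m"
proof -
  have "(\<lambda>v. (c *\<^sub>R X) *v v) = (\<lambda>v. c *\<^sub>R (X *v v))"
    by (simp add: scaleR_matrix_vector_assoc)
  then show ?thesis
    unfolding spec_norm_def by (simp add: onorm_scaleR[OF matrix_vector_mul_bounded_linear])
qed

lemma spec_norm_transpose_le: "spec_norm (transpose X) \<le> spec_norm X" for X :: "real^'n^'m"
proof (rule spec_norm_leI)
  fix v :: "real^'m"
  let ?w = "transpose X *v v"
  have "norm ?w * norm ?w = ?w \<bullet> ?w" by (simp add: dot_square_norm power2_eq_square)
  also have "\<dots> = v \<bullet> (X *v ?w)"
    by (simp add: dot_lmul_matrix inner_commute transpose_matrix_vector)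
  also have "\<dots> \<le> norm v * (spec_norm X * norm ?w)"
    by (intro order_trans[OF norm_cauchy_schwarz] mult_left_mono spec_norm_le) auto
  finally have "norm ?w * norm ?w \<le> (spec_norm X * norm v) * norm ?w" by (simp add: ac_simps)
  then show "norm ?w \<le> spec_norm X * norm v"
    by (cases "norm ?w = 0") (auto simp: mult_le_cancel_right)
qed

lemma spec_norm_transpose [simp]: "spec_norm (transpose X) = spec_norm X" for X :: "real^'n^'m"
  using spec_norm_transpose_le[of X] spec_norm_transpose_le[of "transpose X"] by simp

lemma inner_transpose: "transpose X \<bullet> transpose Y = X \<bullet> Y" for X Y :: "real^'n^'m"
  unfolding inner_vec_def transpose_def by simp (rule sum.swap)

lemma norm_transpose [simp]: "norm (transpose X) = norm X" for X :: "real^'n^'m"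
  by (simp add: norm_eq_sqrt_inner inner_transpose)

lemma inner_mult_right: "(X ** Y) \<bullet> Z = X \<bullet> (Z ** transpose Y)"
  for X :: "real^'n^'m" and Y :: "real^'p^'n"
proof -
  have "(\<Sum>i\<in>UNIV. \<Sum>k\<in>UNIV. (\<Sum>j\<in>UNIV. X$i$j * Y$j$k) * Z$i$k)
      = (\<Sum>i\<in>UNIV. \<Sum>j\<in>UNIV. X$i$j * (\<Sum>k\<in>UNIV. Z$i$k * Y$j$k))"
    unfolding sum_distrib_right sum_distrib_left
    by (intro sum.cong refl) (subst sum.swap, simp add: ac_simps)
  then show ?thesis by (simp add: inner_vec_def matrix_matrix_mult_def transpose_def)
qed

lemma inner_mult_left: "(X ** Y) \<bullet> Z = Y \<bullet> (transpose X ** Z)"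
  for X :: "real^'n^'m" and Y :: "real^'p^'n"
proof -
  have "(X ** Y) \<bullet> Z = (transpose Y ** transpose X) \<bullet> transpose Z"
    by (simp only: matrix_transpose_mul[symmetric] inner_transpose)
  also have "\<dots> = transpose Y \<bullet> (transpose Z ** X)" by (simp add: inner_mult_right)
  also have "\<dots> = transpose Y \<bullet> transpose (transpose X ** Z)"
    by (simp add: matrix_transpose_mul)
  finally show ?thesis by (simp only: inner_transpose)
qed

lemma norm_sq_rows: "(norm X)\<^sup>2 = (\<Sum>i\<in>UNIV. (norm (X $ i))\<^sup>2)" for X :: "real^'n^'m"
  by (simp add: norm_vec_def L2_set_def sum_nonneg)

lemma matrix_mult_row: "(X ** Y) $ i = transpose Y *v (X $ i)"
  for X :: "real^'n^'m" and Y :: "real^'p^'n"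
  by (simp add: vec_eq_iff matrix_matrix_mult_def matrix_vector_mult_def transpose_def ac_simps
      del: transpose_matrix_vector)

text \<open>Each row of the product is the transposed right factor applied to a row of the left one.
  Only one factor is measured in the Frobenius norm, so the Hessian estimate can be matched with
  \<open>h_grad\<close>, whose matrix norms are spectral.\<close>

lemma norm_mult_spec_right: "norm (X ** Y) \<le> norm X * spec_norm Y"
  for X :: "real^'n^'m" and Y :: "real^'p^'n"
proof -
  have "(norm (X ** Y))\<^sup>2 \<le> (\<Sum>i\<in>UNIV. (spec_norm Y * norm (X $ i))\<^sup>2)"
    unfolding norm_sq_rows matrix_mult_row
    by (intro sum_mono power_mono order_trans[OF spec_norm_le]) auto
  also have "\<dots> = (norm X * spec_norm Y)\<^sup>2"
    by (simp add: power_mult_distrib norm_sq_rows sum_distrib_left mult.commute)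
  finally show ?thesis by (rule power2_le_imp_le) simp
qed

lemma norm_mult_spec_left: "norm (X ** Y) \<le> spec_norm X * norm Y"
  for X :: "real^'n^'m" and Y :: "real^'p^'n"
  using norm_mult_spec_right[of "transpose Y" "transpose X"]
  by (metis matrix_transpose_mul norm_transpose spec_norm_transpose mult.commute)

lemma spec_norm_le_norm: "spec_norm X \<le> norm X" for X :: "real^'n^'m"
proof (rule spec_norm_leI)
  fix v :: "real^'n"
  have "(norm (X *v v))\<^sup>2 = (\<Sum>i\<in>UNIV. (X $ i \<bullet> v)\<^sup>2)"
    by (simp add: norm_vec_def L2_set_def sum_nonneg matrix_mult_dot)
  also have "\<dots> \<le> (\<Sum>i\<in>UNIV. (norm (X $ i))\<^sup>2 * (norm v)\<^sup>2)"
    by (intro sum_mono) (metis Cauchy_Schwarz_ineq dot_square_norm)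
  also have "\<dots> = (norm X * norm v)\<^sup>2"
    by (simp add: norm_sq_rows sum_distrib_right power_mult_distrib)
  finally show "norm (X *v v) \<le> norm X * norm v" by (rule power2_le_imp_le) simp
qed

lemma norm_mult_le: "norm (X ** Y) \<le> norm X * norm Y"
  for X :: "real^'n^'m" and Y :: "real^'p^'n"
  by (meson norm_mult_spec_right mult_left_mono norm_ge_zero order_trans spec_norm_le_norm)

text \<open>Every row is the transpose applied to a unit vector. Counting rows matters: a gradient
  has n_u of them, the source of the square root in the heterogeneity bound.\<close>

lemma norm_le_sqrt_card_spec: "norm X \<le> sqrt (CARD('m)) * spec_norm X" for X :: "real^'n^'m"
proof -
  have "norm (X $ i) \<le> spec_norm X" for i
  proof -
    have "X $ i = transpose X *v axis i 1"
      by (simp add: matrix_vector_mult_basis column_def transpose_def vec_eq_iff)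
    then show ?thesis using spec_norm_le[of "transpose X" "axis i 1"] by simp
  qed
  then have "(norm X)\<^sup>2 \<le> (\<Sum>i\<in>(UNIV::'m set). (spec_norm X)\<^sup>2)"
    unfolding norm_sq_rows by (intro sum_mono power_mono) auto
  also have "\<dots> = (sqrt (CARD('m)) * spec_norm X)\<^sup>2" by (simp add: power_mult_distrib)
  finally show ?thesis by (rule power2_le_imp_le) simp
qed

lemma matrix_vector_axis: "(X *v axis j 1) $ i = X $ i $ j" for X :: "'a::semiring_1^'n^'m"
  by (simp add: matrix_vector_mult_def axis_def if_distrib cong: if_cong)

section \<open>Product and transposition as bounded bilinear and linear maps\<close>

lemma bounded_bilinear_matrix_mult:
  "bounded_bilinear ((**) :: real^'n^'m \<Rightarrow> real^'p^'n \<Rightarrow> real^'p^'m)"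
  by (rule bounded_bilinear.intro)
    (auto simp: mat_distribs intro!: exI[of _ 1] norm_mult_le)

lemma bounded_linear_transpose: "bounded_linear (transpose :: real^'n^'m \<Rightarrow> _)"
  by (rule bounded_linear_intro[where K = 1]) (auto simp: transpose_add transpose_scaleR)

lemmas has_derivative_matrix_mult [derivative_intros] =
  bounded_bilinear.FDERIV[OF bounded_bilinear_matrix_mult]
lemmas has_derivative_transpose [derivative_intros] =
  bounded_linear.has_derivative[OF bounded_linear_transpose]
lemmas tendsto_matrix_mult [tendsto_intros] =
  bounded_bilinear.tendsto[OF bounded_bilinear_matrix_mult]
lemmas tendsto_transpose [tendsto_intros] =
  bounded_linear.tendsto[OF bounded_linear_transpose]

subsection \<open>Matrix powers and the spectral radius\<close>

primrec mpow :: "('a::comm_semiring_1)^'n^'n \<Rightarrow> nat \<Rightarrow> 'a^'n^'n" where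
  "mpow A 0 = mat 1"
| "mpow A (Suc t) = A ** mpow A t"

lemma mpow_Suc_right: "mpow A (Suc t) = mpow A t ** A"
  by (induction t) (simp_all add: matrix_mul_assoc)

lemma mpow_transpose: "mpow (transpose A) t = transpose (mpow A t)"
proof (induction t)
  case (Suc t)
  then show ?case by (simp only: mpow.simps(2)[of "transpose A"] mpow_Suc_right[of A] matrix_transpose_mul)
qed simp

text \<open>One power more than the dimension of the matrix space forces a linear dependence.
  Dependence is a notion for sets, so coinciding powers are treated apart, by the relation A^i - A^j
  = 0.\<close>

lemma ex_annihilating_coeffs:
  fixes A :: "real^'n^'n"
  obtains c N where "\<exists>i\<le>N. c i \<noteq> 0" "(\<Sum>i\<le>N::nat. c i *\<^sub>R mpow A i) = 0"
proof -
  define N where "N = DIM(real^'n^'n)"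
  show ?thesis
  proof (cases "inj_on (mpow A) {..N}")
    case True
    have "dependent (mpow A ` {..N})"
      by (rule dependent_biggerset) (simp only: card_image[OF True] card_atMost, simp add: N_def)
    then obtain u where u: "\<exists>v\<in>mpow A ` {..N}. u v \<noteq> 0" "(\<Sum>v\<in>mpow A ` {..N}. u v *\<^sub>R v) = 0"
      using dependent_finite[of "mpow A ` {..N}"] by auto
    show ?thesis
      by (rule that[of N "\<lambda>i. u (mpow A i)"]) (use u True in \<open>auto simp: sum.reindex\<close>)
  next
    case False
    then obtain i j where ij: "i \<le> N" "j \<le> N" "i \<noteq> j" "mpow A i = mpow A j"
      by (auto simp: inj_on_def)
    let ?c = "\<lambda>k. if k = i then 1 else if k = j then -1 else (0::real)"
    have "(\<Sum>k\<le>N. ?c k *\<^sub>R mpow A k) = (\<Sum>k\<in>{i,j}. ?c k *\<^sub>R mpow A k)"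
      by (rule sum.mono_neutral_right) (use ij in auto)
    also have "\<dots> = 0" using ij by simp
    finally show ?thesis using ij by (intro that[of N ?c]) auto
  qed
qed

text \<open>The vector p(C) v. The vector is kept as an argument because the induction on orbits
  passes to factors of p that annihilate a single vector only.\<close>

definition peval :: "complex^'n^'n \<Rightarrow> complex poly \<Rightarrow> complex^'n \<Rightarrow> complex^'n" where
  "peval C p v = (\<Sum>i\<le>degree p. coeff p i *s (mpow C i *v v))"

lemma peval_eq: "degree p \<le> n \<Longrightarrow> peval C p v = (\<Sum>i\<le>n. coeff p i *s (mpow C i *v v))"
  unfolding peval_def by (rule sum.mono_neutral_left) (auto simp: coeff_eq_0)

lemma peval_add: "peval C (p + q) v = peval C p v + peval C q v"
proof -
  define n where "n = max (degree p) (degree q)"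
  have "degree (p + q) \<le> n" "degree p \<le> n" "degree q \<le> n"
    by (auto simp: n_def degree_add_le_max)
  then show ?thesis by (simp add: peval_eq vector_sadd_rdistrib sum.distrib)
qed

lemma peval_smult: "peval C (smult a p) v = a *s peval C p v"
  by (simp add: peval_eq[of "smult a p" "degree p"] degree_smult_le peval_def
      vec_eq_iff sum_distrib_left mult.assoc)

lemma mat_vec_smult: "C *v (a *s v) = a *s (C *v v)" for C :: "complex^'n^'m"
  by (simp add: vec_eq_iff matrix_vector_mult_def sum_distrib_left ac_simps)

lemma mat_vec_sum: "C *v (\<Sum>i\<in>I. f i) = (\<Sum>i\<in>I. C *v f i)" for C :: "complex^'n^'m"
  by (induction I rule: infinite_finite_induct) (simp_all add: matrix_vector_right_distrib)

lemma peval_pCons_0: "peval C (pCons 0 p) v = C *v peval C p v"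
proof -
  have "peval C (pCons 0 p) v = (\<Sum>i\<le>Suc (degree p). coeff (pCons 0 p) i *s (mpow C i *v v))"
    by (rule peval_eq) (rule degree_pCons_le)
  also have "\<dots> = (\<Sum>i\<le>degree p. coeff p i *s (mpow C (Suc i) *v v))"
    by (subst sum.atMost_Suc_shift) simp
  also have "\<dots> = C *v peval C p v"
    by (simp add: peval_def mat_vec_sum mat_vec_smult matrix_vector_mul_assoc)
  finally show ?thesis .
qed

lemma peval_linear_factor: "peval C ([:- z, 1:] * p) v = C *v peval C p v - z *s peval C p v"
proof -
  have "[:- z, 1:] * p = smult (- z) p + pCons 0 p" by (simp add: mult_pCons_left)
  then show ?thesis by (simp only: peval_add peval_smult peval_pCons_0) (simp add: vec_eq_iff)
qed

lemma peval_diff_arg: "peval C p (v - w) = peval C p v - peval C p w"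
  by (simp add: peval_def matrix_vector_mult_diff_distrib vector_ssub_ldistrib sum_subtractf)

lemma peval_smult_arg: "peval C p (a *s v) = a *s peval C p v"
  by (simp add: peval_def mat_vec_smult vec_eq_iff sum_distrib_left ac_simps)

lemma peval_mat_arg: "peval C p (C *v v) = C *v peval C p v"
  by (simp add: peval_def mat_vec_sum mat_vec_smult matrix_vector_mul_assoc
      mpow.simps(2)[symmetric] mpow_Suc_right[symmetric] del: mpow.simps)

lemma peval_eigenvector:
  assumes "C *v w = z *s w"
  shows "peval C p w = poly p z *s w"
proof -
  have "mpow C i *v w = z ^ i *s w" for i
    by (induction i) (simp_all add: matrix_vector_mul_assoc[symmetric] mat_vec_smult assms mult.commute)
  then show ?thesis by (simp add: peval_def poly_altdef vec_eq_iff sum_distrib_right mult.assoc)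
qed

lemma norm_smult_complex: "norm (a *s v) = cmod a * norm v" for v :: "complex^'n"
  by (simp add: norm_vec_def norm_mult L2_set_right_distrib)

text \<open>Induction on the degree: a linear factor \<open>x - z\<close> of the annihilating polynomial can be
  dropped unless \<open>z\<close> is an eigenvalue, and then \<open>y t = C\<^sup>t v\<close> solves
  \<open>y (t + 1) = z y t + u t\<close> with \<open>u\<close> summable and \<open>|z| < 1\<close>.\<close>

lemma summable_orbit:
  fixes C :: "complex^'n^'n"
  assumes eig: "\<And>z w. w \<noteq> 0 \<Longrightarrow> C *v w = z *s w \<Longrightarrow> cmod z < 1"
  shows "p \<noteq> 0 \<Longrightarrow> peval C p v = 0 \<Longrightarrow> summable (\<lambda>t. norm (mpow C t *v v))"
proof (induction "degree p" arbitrary: p v)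
  case 0
  then obtain a where "p = [:a:]" by (metis degree_eq_zeroE)
  with 0 have "v = 0" by (simp add: peval_def vec_eq_iff)
  then show ?case by simp
next
  case (Suc d)
  then obtain z where "poly p z = 0"
    using fundamental_theorem_of_algebra[of p] by (auto simp: constant_degree)
  then obtain q where p: "p = [:- z, 1:] * q" by (auto simp: poly_eq_0_iff_dvd dvd_def)
  then have "q \<noteq> 0" using Suc.prems(1) by auto
  then have q: "q \<noteq> 0" "d = degree q"
    using Suc.hyps(2) degree_mult_eq[of "[:- z, 1:]" q] p by simp_all
  show ?case
  proof (cases "peval C q v = 0")
    case True
    then show ?thesis using Suc.hyps(1) q by blast
  next
    case False
    have Cw: "C *v peval C q v = z *s peval C q v"
      using Suc.prems(2) by (simp only: p peval_linear_factor) simp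
    then have z: "cmod z < 1" using eig False by blast
    \<comment> \<open>Since q(C) v is an eigenvector for z, the factor q annihilates u, and the
      induction hypothesis makes the orbit of u summable.\<close>
    define u where "u = C *v v - z *s v"
    have "peval C q u = 0"
      by (simp add: u_def peval_diff_arg peval_mat_arg peval_smult_arg Cw)
    then have su: "summable (\<lambda>t. norm (mpow C t *v u))"
      using Suc.hyps(1) q by blast
    define y where "y t = norm (mpow C t *v v)" for t
    define B where "B = (\<Sum>t. norm (mpow C t *v u))"
    have step: "y (Suc t) \<le> cmod z * y t + norm (mpow C t *v u)" for t
    proof -
      have "mpow C (Suc t) *v v = mpow C t *v (C *v v)"
        by (simp only: mpow_Suc_right matrix_vector_mul_assoc)
      also have "C *v v = z *s v + u" by (simp add: u_def)
      finally have "mpow C (Suc t) *v v = z *s (mpow C t *v v) + mpow C t *v u"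
        by (simp add: matrix_vector_right_distrib mat_vec_smult)
      then show ?thesis
        unfolding y_def by (simp only:) (metis norm_smult_complex norm_triangle_ineq)
    qed
    \<comment> \<open>Summing the recursion bounds the partial sum s by y 0 + |z| s + B, which can
      be solved for s because |z| < 1.\<close>
    have "sum y {..<n} \<le> (y 0 + B) / (1 - cmod z)" for n
    proof -
      have ypos: "0 \<le> y t" for t by (simp add: y_def)
      have "sum y {..<n} \<le> sum y {..<Suc n}" using ypos by simp
      also have "\<dots> = y 0 + (\<Sum>t<n. y (Suc t))" by (simp only: sum.lessThan_Suc_shift)
      also have "(\<Sum>t<n. y (Suc t)) \<le> (\<Sum>t<n. cmod z * y t + norm (mpow C t *v u))"
        by (intro sum_mono step)
      also have "\<dots> = cmod z * sum y {..<n} + (\<Sum>t<n. norm (mpow C t *v u))"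
        by (simp add: sum.distrib sum_distrib_left)
      also have "(\<Sum>t<n. norm (mpow C t *v u)) \<le> B"
        unfolding B_def by (rule sum_le_suminf[OF su]) auto
      finally have "sum y {..<n} * (1 - cmod z) \<le> y 0 + B" by (simp add: algebra_simps)
      then show ?thesis using z by (simp add: field_simps)
    qed
    then have "summable y" by (intro summableI_nonneg_bounded) (auto simp: y_def)
    then show ?thesis by (simp add: y_def[abs_def])
  qed
qed

section \<open>Eigenvalues of a real matrix through its complexification\<close>

abbreviation cmat :: "real^'n^'m \<Rightarrow> complex^'n^'m" where
  "cmat \<equiv> map_matrix complex_of_real"

lemma mpow_cmat: "mpow (cmat A) t = cmat (mpow A t)"
  by (induction t) (simp_all add: vec_eq_iff map_matrix_def matrix_matrix_mult_def mat_def)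

text \<open>Eigenvalues are roots of any annihilating polynomial, which makes the spectrum finite.
  The last clause states this for real eigenvectors and serves the singular values.\<close>

lemma ex_annihilating_poly:
  fixes A :: "real^'n^'n"
  obtains p :: "complex poly" where "p \<noteq> 0" "\<And>v. peval (cmat A) p v = 0"
    "\<And>v r. A *v v = r *\<^sub>R v \<Longrightarrow> v \<noteq> 0 \<Longrightarrow> poly p (of_real r) = 0"
proof -
  obtain c N where c: "\<exists>i\<le>N::nat. c i \<noteq> 0" "(\<Sum>i\<le>N. c i *\<^sub>R mpow A i) = 0"
    by (rule ex_annihilating_coeffs[of A])
  define p where "p = (\<Sum>i\<le>N. monom (complex_of_real (c i)) i)"
  have coeff: "coeff p i = (if i \<le> N then of_real (c i) else 0)" for i
    by (simp add: p_def coeff_sum)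
  have deg: "degree p \<le> N" by (rule degree_le) (simp add: coeff)
  have ann: "peval (cmat A) p v = 0" for v
  proof -
    have "peval (cmat A) p v = (\<Sum>i\<le>N. of_real (c i) *s (cmat (mpow A i) *v v))"
      using deg by (simp add: peval_eq coeff mpow_cmat)
    also have "\<dots> = cmat (\<Sum>i\<le>N. c i *\<^sub>R mpow A i) *v v"
      by (simp add: vec_eq_iff matrix_vector_mult_def map_matrix_def sum_distrib_left
          sum_distrib_right mult.assoc) (subst sum.swap, simp)
    also have "\<dots> = 0" by (simp add: c(2) vec_eq_iff map_matrix_def matrix_vector_mult_def)
    finally show ?thesis .
  qed
  have "p \<noteq> 0" using c(1) coeff by (metis coeff_0 of_real_eq_0_iff)
  moreover have "poly p (of_real r) = 0" if "A *v v = r *\<^sub>R v" "v \<noteq> 0" for v r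
  proof -
    let ?w = "\<chi> i. complex_of_real (v $ i)"
    have "cmat A *v ?w = complex_of_real r *s ?w"
      using that(1) unfolding vec_eq_iff matrix_vector_mult_def map_matrix_def
      by (simp add: of_real_mult[symmetric] of_real_sum[symmetric] del: of_real_mult of_real_sum)
    from peval_eigenvector[OF this, of p] ann[of ?w] have "poly p (of_real r) *s ?w = 0" by simp
    with that(2) show ?thesis by (auto simp: vec_eq_iff)
  qed
  ultimately show ?thesis using ann that by blast
qed

lemma finite_eigenvalues: "finite (eigenvalues A)" for A :: "real^'n^'n"
proof -
  obtain p :: "complex poly" where p: "p \<noteq> 0" "\<And>v. peval (cmat A) p v = 0"
    by (rule ex_annihilating_poly[of A]) blast
  have "eigenvalues A \<subseteq> {z. poly p z = 0}"
  proof
    fix z assume "z \<in> eigenvalues A"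
    then obtain w where "w \<noteq> 0" "cmat A *v w = z *s w" by (auto simp: eigenvalues_def)
    with peval_eigenvector[of "cmat A" w z p] p(2)[of w] show "z \<in> {z. poly p z = 0}"
      by (auto simp: vec_eq_iff)
  qed
  then show ?thesis using poly_roots_finite[OF p(1)] finite_subset by blast
qed

text \<open>Without eigenvalues every linear factor of an annihilating polynomial could be
  cancelled, until a nonzero constant annihilates all vectors. Together with finiteness this gives
  the \<open>Max\<close> in \<open>spec_radius\<close> its meaning.\<close>

lemma eigenvalues_nonempty: "eigenvalues A \<noteq> {}" for A :: "real^'n^'n"
proof
  assume none: "eigenvalues A = {}"
  obtain p :: "complex poly" where p: "p \<noteq> 0" "\<And>v. peval (cmat A) p v = 0"
    by (rule ex_annihilating_poly[of A]) blast
  have "q \<noteq> 0 \<Longrightarrow> (\<And>v. peval (cmat A) q v = 0) \<Longrightarrow> False" for q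
  proof (induction "degree q" arbitrary: q)
    case 0
    then obtain a where "q = [:a:]" by (metis degree_eq_zeroE)
    with 0(2,3)[of] show ?case by (simp add: peval_def vec_eq_iff) (metis vec_component)
  next
    case (Suc d)
    then obtain z where "poly q z = 0"
      using fundamental_theorem_of_algebra[of q] by (auto simp: constant_degree)
    then obtain r where q: "q = [:- z, 1:] * r" by (auto simp: poly_eq_0_iff_dvd dvd_def)
    then have "r \<noteq> 0" using Suc.prems(1) by auto
    then have r: "r \<noteq> 0" "d = degree r"
      using Suc.hyps(2) degree_mult_eq[of "[:- z, 1:]" r] q by simp_all
    have "peval (cmat A) r v = 0" for v
    proof (rule ccontr)
      assume "peval (cmat A) r v \<noteq> 0"
      moreover have "cmat A *v peval (cmat A) r v = z *s peval (cmat A) r v"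
        using Suc.prems(2)[of v] by (simp only: q peval_linear_factor) simp
      ultimately show False using none by (auto simp: eigenvalues_def)
    qed
    then show ?case using Suc.hyps(1) r by blast
  qed
  then show False using p by blast
qed

lemma summable_power2:
  fixes f :: "nat \<Rightarrow> real"
  assumes "summable f" "\<And>n. 0 \<le> f n"
  shows "summable (\<lambda>n. (f n)\<^sup>2)"
proof (rule summable_comparison_test_ev[OF _ assms(1)])
  have "f \<longlonglongrightarrow> 0" by (rule summable_LIMSEQ_zero[OF assms(1)])
  then have "eventually (\<lambda>n. f n < 1) sequentially" by (rule order_tendstoD) simp
  then show "eventually (\<lambda>n. norm ((f n)\<^sup>2) \<le> f n) sequentially"
    by eventually_elim (use assms(2) in \<open>simp add: power2_eq_square mult_left_le\<close>)
qed

text \<open>Replaces the condition on the spectral radius: it is what convergence of the Lyapunov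
  series needs, and it survives limits of matrices as soon as the partial sums are uniformly
  bounded.\<close>

definition stable :: "real^'n^'n \<Rightarrow> bool" where
  "stable A \<longleftrightarrow> summable (\<lambda>t. (norm (mpow A t))\<^sup>2)"

lemma norm_sq_cols: "(norm X)\<^sup>2 = (\<Sum>j\<in>UNIV. (norm (X *v axis j 1))\<^sup>2)" for X :: "real^'n^'m"
proof -
  have "transpose X $ j = X *v axis j 1" for j
    by (simp add: vec_eq_iff transpose_def matrix_vector_axis)
  then show ?thesis using norm_sq_rows[of "transpose X"] by simp
qed

text \<open>If all eigenvalues lie in the open unit disc, the orbits of the basis vectors are
  summable, and the Frobenius norm is assembled from these columns. Conversely the powers tend to
  zero entrywise, so z^t w tends to zero for an eigenvector w, which excludes |z| >= 1.\<close>

lemma spec_radius_less_1_iff: "spec_radius A < 1 \<longleftrightarrow> stable A" for A :: "real^'n^'n"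
proof
  assume "spec_radius A < 1"
  then have eig: "cmod z < 1" if "w \<noteq> 0" "cmat A *v w = z *s w" for z w
    using that unfolding spec_radius_def
    by (subst (asm) Max_less_iff) (auto simp: finite_eigenvalues eigenvalues_nonempty, auto simp: eigenvalues_def)
  obtain p :: "complex poly" where p: "p \<noteq> 0" "\<And>v. peval (cmat A) p v = 0"
    by (rule ex_annihilating_poly[of A]) blast
  have "summable (\<lambda>t. (norm (mpow A t *v axis j 1))\<^sup>2)" for j
  proof -
    let ?e = "axis j 1 :: complex^'n"
    have "norm (mpow A t *v axis j 1) = norm (mpow (cmat A) t *v ?e)" for t
      unfolding mpow_cmat norm_vec_def matrix_vector_axis by (simp add: map_matrix_def)
    then have "summable (\<lambda>t. norm (mpow A t *v axis j 1))"
      using summable_orbit[of "cmat A" p ?e] eig p by auto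
    then show ?thesis
      by (rule summable_power2) simp
  qed
  then show "stable A" unfolding stable_def norm_sq_cols by (intro summable_sum) auto
next
  assume st: "stable A"
  have "cmod z < 1" if zA: "z \<in> eigenvalues A" for z
  proof (rule ccontr)
    assume z: "\<not> cmod z < 1"
    obtain w where w: "w \<noteq> 0" "cmat A *v w = z *s w" using zA by (auto simp: eigenvalues_def)
    have pw: "mpow (cmat A) t *v w = z ^ t *s w" for t
      by (induction t) (simp_all add: matrix_vector_mul_assoc[symmetric] mat_vec_smult w mult.commute)
    have "(\<lambda>t. (norm (mpow A t))\<^sup>2) \<longlonglongrightarrow> 0" by (rule summable_LIMSEQ_zero[OF st[unfolded stable_def]])
    then have "(\<lambda>t. sqrt ((norm (mpow A t))\<^sup>2)) \<longlonglongrightarrow> sqrt 0" by (intro tendsto_intros)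
    then have "(\<lambda>t. mpow A t) \<longlonglongrightarrow> 0" by (simp add: tendsto_norm_zero_iff)
    then have "(\<lambda>t. mpow A t $ i $ j) \<longlonglongrightarrow> 0 $ i $ j" for i j by (intro tendsto_intros)
    then have entry: "(\<lambda>t. mpow A t $ i $ j) \<longlonglongrightarrow> 0" for i j by simp
    have "(\<lambda>t. \<Sum>j\<in>UNIV. complex_of_real (mpow A t $ i $ j) * w $ j)
        \<longlonglongrightarrow> (\<Sum>j\<in>UNIV. complex_of_real 0 * w $ j)" for i
      by (intro tendsto_intros entry)
    then have "(\<lambda>t. (mpow (cmat A) t *v w) $ i) \<longlonglongrightarrow> 0" for i
      unfolding mpow_cmat by (simp add: matrix_vector_mult_def map_matrix_def)
    then have lim: "(\<lambda>t. (z ^ t *s w) $ i) \<longlonglongrightarrow> 0" for i by (simp add: pw)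
    obtain i where i: "w $ i \<noteq> 0" using w(1) by (auto simp: vec_eq_iff)
    have "(\<lambda>t. cmod (z ^ t * w $ i)) \<longlonglongrightarrow> 0" using tendsto_norm[OF lim[of i]] by simp
    moreover have "cmod (w $ i) \<le> cmod (z ^ t * w $ i)" for t
      using z by (simp add: norm_mult norm_power mult_le_cancel_right1)
    ultimately have "cmod (w $ i) \<le> 0" by (intro LIMSEQ_le_const) auto
    with i show False by simp
  qed
  then show "spec_radius A < 1"
    unfolding spec_radius_def
    by (subst Max_less_iff) (auto simp: finite_eigenvalues eigenvalues_nonempty)
qed

subsection \<open>Positive semidefinite matrices\<close>

definition psd :: "real^'n^'n \<Rightarrow> bool" where
  "psd X \<longleftrightarrow> transpose X = X \<and> (\<forall>v. 0 \<le> v \<bullet> (X *v v))"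

lemma psd_ge_0: "psd X \<Longrightarrow> 0 \<le> v \<bullet> (X *v v)"
  by (simp add: psd_def)

lemma sym_inner: "transpose X = X \<Longrightarrow> v \<bullet> (X *v w) = (X *v v) \<bullet> w" for X :: "real^'n^'n"
  by (metis dot_lmul_matrix transpose_matrix_vector)

lemma posdef_psd: "posdef X \<Longrightarrow> psd X"
  unfolding posdef_def psd_def by (metis inner_zero_left less_eq_real_def)

lemma psd_cauchy_schwarz:
  assumes "psd X"
  shows "(w \<bullet> (X *v v))\<^sup>2 \<le> (w \<bullet> (X *v w)) * (v \<bullet> (X *v v))"
proof -
  define a b c where "a = w \<bullet> (X *v w)" and "b = w \<bullet> (X *v v)" and "c = v \<bullet> (X *v v)"
  have b': "v \<bullet> (X *v w) = b"
    using assms sym_inner[of X v w] by (simp add: psd_def b_def inner_commute)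
  have pos: "0 \<le> a" "0 \<le> c" using assms by (simp_all add: a_def c_def psd_ge_0)
  have form: "0 \<le> s\<^sup>2 * a + 2 * s * t * b + t\<^sup>2 * c" for s t
  proof -
    have "0 \<le> (s *\<^sub>R w + t *\<^sub>R v) \<bullet> (X *v (s *\<^sub>R w + t *\<^sub>R v))" by (rule psd_ge_0[OF assms])
    also have "\<dots> = s\<^sup>2 * a + 2 * s * t * b + t\<^sup>2 * c"
      by (simp add: matrix_vector_right_distrib matrix_vector_mult_scaleR inner_add_left
          inner_add_right a_def b_def[symmetric] b' c_def power2_eq_square algebra_simps)
    finally show ?thesis .
  qed
  have "b\<^sup>2 \<le> a * c"
  proof (cases "a = 0")
    case True
    have "b = 0"
    proof (rule ccontr)
      assume b: "b \<noteq> 0"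
      \<comment> \<open>With a = 0 the form is linear in s; this s makes its value -c - 2, which is
        negative.\<close>
      have "0 \<le> - 2 * (c + 1) + c" using form[of "-(c + 1) / b" 1] True b by simp
      with pos show False by simp
    qed
    then show ?thesis using True by simp
  next
    case False
    with pos have "0 < a" by simp
    \<comment> \<open>The minimizing ratio of s and t, scaled to avoid a division.\<close>
    have "0 \<le> a * (a * c - b\<^sup>2)" using form[of "-b" a] by (simp add: power2_eq_square algebra_simps)
    with \<open>0 < a\<close> show ?thesis by (simp add: zero_le_mult_iff)
  qed
  then show ?thesis by (simp add: a_def b_def c_def)
qed

lemma psd_kernel: "psd X \<Longrightarrow> v \<bullet> (X *v v) = 0 \<Longrightarrow> X *v v = 0"
  using psd_cauchy_schwarz[of X "X *v v" v] by simp

text \<open>Cauchy-Schwarz on basis vectors bounds the square of each entry by the product of two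
  diagonal entries, and these products sum to the squared trace.\<close>

lemma psd_norm_le_trace:
  assumes "psd X" shows "norm X \<le> trace X"
proof -
  have entry: "axis i 1 \<bullet> (X *v axis j 1) = X $ i $ j" for i j
    by (simp add: matrix_vector_mult_basis column_def inner_axis')
  have d: "0 \<le> X $ i $ i" for i using psd_ge_0[OF assms, of "axis i 1"] by (simp add: entry)
  have "(norm X)\<^sup>2 = (\<Sum>i\<in>UNIV. \<Sum>j\<in>UNIV. (X $ i $ j)\<^sup>2)"
    unfolding norm_sq_rows by (simp add: norm_vec_def L2_set_def sum_nonneg)
  also have "\<dots> \<le> (\<Sum>i\<in>UNIV. \<Sum>j\<in>UNIV. X $ i $ i * X $ j $ j)"
    using psd_cauchy_schwarz[OF assms, of "axis _ 1" "axis _ 1"] unfolding entry by (intro sum_mono)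
  also have "\<dots> = (trace X)\<^sup>2" by (simp add: trace_def power2_eq_square sum_product)
  finally show ?thesis by (rule power2_le_imp_le) (simp add: trace_def sum_nonneg d)
qed

lemma mat_1_inner: "mat 1 \<bullet> X = trace X" for X :: "real^'n^'n"
  by (simp add: inner_vec_def mat_def trace_def if_distrib if_distribR sum.delta cong: if_cong)

text \<open>The minimizer v of the quadratic form on the unit sphere is an eigenvector without
  Lagrange multipliers: X - m I is positive semidefinite and its form vanishes at v, so v lies in
  its kernel.\<close>

lemma ex_min_rayleigh:
  fixes X :: "real^'n^'n"
  assumes "transpose X = X"
  obtains v m where "v \<noteq> 0" "X *v v = m *\<^sub>R v" "\<And>w. m * (norm w)\<^sup>2 \<le> w \<bullet> (X *v w)"
proof -
  have "compact (sphere (0::real^'n) 1)" "sphere (0::real^'n) 1 \<noteq> {}" by auto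
  moreover have "continuous_on (sphere 0 1) (\<lambda>v. v \<bullet> (X *v v))"
    by (intro continuous_intros matrix_vector_mult_linear_continuous_on)
  ultimately obtain v where v: "v \<in> sphere 0 1" and min: "\<And>w. w \<in> sphere 0 1 \<Longrightarrow> v \<bullet> (X *v v) \<le> w \<bullet> (X *v w)"
    using continuous_attains_inf[of "sphere 0 1" "\<lambda>v. v \<bullet> (X *v v)"] by blast
  define m where "m = v \<bullet> (X *v v)"
  have ray: "m * (norm w)\<^sup>2 \<le> w \<bullet> (X *v w)" for w
  proof (cases "w = 0")
    case False
    have "m \<le> (w /\<^sub>R norm w) \<bullet> (X *v (w /\<^sub>R norm w))"
      unfolding m_def using False by (intro min) simp
    also have "\<dots> = (w \<bullet> (X *v w)) / (norm w)\<^sup>2"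
      by (simp add: matrix_vector_mult_scaleR power2_eq_square divide_inverse)
    finally show ?thesis using False by (simp add: field_simps)
  qed simp
  let ?Y = "X - m *\<^sub>R mat 1"
  have Y: "?Y *v w = X *v w - m *\<^sub>R w" for w
    by (simp add: matrix_vector_mult_diff_rdistrib scaleR_matrix_vector_assoc[symmetric])
  have "psd ?Y"
    unfolding psd_def Y using ray
    by (auto simp: transpose_diff transpose_scaleR assms inner_diff_right power2_norm_eq_inner)
  moreover have "v \<bullet> (?Y *v v) = 0"
    unfolding Y using v by (simp add: inner_diff_right m_def dot_square_norm)
  ultimately have "X *v v = m *\<^sub>R v" using psd_kernel[of ?Y v] Y by simp
  moreover have "v \<noteq> 0" using v by auto
  ultimately show ?thesis using that ray by blast
qed

lemma finite_singular_values: "finite (singular_values X)" for X :: "real^'n^'n"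
proof -
  obtain p :: "complex poly" where p: "p \<noteq> 0"
    "\<And>v r. (transpose X ** X) *v v = r *\<^sub>R v \<Longrightarrow> v \<noteq> 0 \<Longrightarrow> poly p (of_real r) = 0"
    by (rule ex_annihilating_poly[of "transpose X ** X"]) blast
  have "(\<lambda>s. complex_of_real (s\<^sup>2)) ` singular_values X \<subseteq> {z. poly p z = 0}"
  proof clarify
    fix s assume "s \<in> singular_values X"
    then obtain v where "v \<noteq> 0" "(transpose X ** X) *v v = s\<^sup>2 *\<^sub>R v"
      by (auto simp: singular_values_def)
    then show "poly p (complex_of_real (s\<^sup>2)) = 0" by (intro p(2))
  qed
  then have "finite ((\<lambda>s. complex_of_real (s\<^sup>2)) ` singular_values X)"
    using poly_roots_finite[OF p(1)] finite_subset by blast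
  moreover have "inj_on (\<lambda>s. complex_of_real (s\<^sup>2)) (singular_values X)"
    by (auto simp: inj_on_def singular_values_def of_real_eq_iff simp del: of_real_power)
  ultimately show ?thesis by (rule finite_imageD)
qed

text \<open>The least Rayleigh quotient is a positive eigenvalue, hence a singular value, so the
  smallest singular value cannot exceed it. A singular value zero would produce a nonzero kernel
  vector.\<close>

lemma
  fixes X :: "real^'n^'n"
  assumes "posdef X"
  shows sigma_min_pos: "0 < sigma_min X"
    and sigma_min_le: "sigma_min X * (norm w)\<^sup>2 \<le> w \<bullet> (X *v w)"
proof -
  have sym: "transpose X = X" using assms by (simp add: posdef_def)
  obtain v m where vm: "v \<noteq> 0" "X *v v = m *\<^sub>R v" "\<And>w. m * (norm w)\<^sup>2 \<le> w \<bullet> (X *v w)"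
    by (rule ex_min_rayleigh[OF sym]) blast
  have "0 < v \<bullet> (X *v v)" using assms vm(1) by (simp add: posdef_def)
  then have "0 < m" using vm(1,2) by (simp add: zero_less_mult_iff) (meson inner_ge_zero not_less)
  have "(transpose X ** X) *v v = m\<^sup>2 *\<^sub>R v"
    by (simp add: sym matrix_vector_mul_assoc[symmetric] vm(2) matrix_vector_mult_scaleR power2_eq_square)
  then have m: "m \<in> singular_values X" using \<open>0 < m\<close> vm(1) by (auto simp: singular_values_def)
  then have "sigma_min X \<le> m" unfolding sigma_min_def by (simp add: finite_singular_values)
  then show "sigma_min X * (norm w)\<^sup>2 \<le> w \<bullet> (X *v w)"
    by (meson vm(3) mult_right_mono order_trans zero_le_power2)
  have "sigma_min X \<in> singular_values X"
    unfolding sigma_min_def using m by (intro Min_in finite_singular_values) auto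
  then obtain u where u: "0 \<le> sigma_min X" "u \<noteq> 0"
    "(transpose X ** X) *v u = (sigma_min X)\<^sup>2 *\<^sub>R u"
    by (auto simp: singular_values_def)
  have "sigma_min X \<noteq> 0"
  proof
    assume "sigma_min X = 0"
    with u(3) have "u \<bullet> (X *v (X *v u)) = 0" by (simp add: sym matrix_vector_mul_assoc)
    then have "X *v u = 0" using sym_inner[OF sym, of u "X *v u"] by simp
    then show False using assms u(2) by (auto simp: posdef_def)
  qed
  with u(1) show "0 < sigma_min X" by simp
qed

subsection \<open>The discrete Lyapunov operator\<close>

text \<open>Bounds the Lyapunov solution operator of A in both the Frobenius and the spectral norm;
  for a closed loop it is at most J / (q \<mu>).\<close>

definition kap :: "real^'n^'n \<Rightarrow> real" where
  "kap A = (\<Sum>t. (norm (mpow A t))\<^sup>2)"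

text \<open>For stable A, the solution Y of the discrete Lyapunov equation Y = X + A^T Y A as an
  explicit series.\<close>

definition dlyap :: "real^'n^'n \<Rightarrow> real^'n^'n \<Rightarrow> real^'n^'n" where
  "dlyap A X = (\<Sum>t. transpose (mpow A t) ** X ** mpow A t)"

lemma stable_transpose [simp]: "stable (transpose A) = stable A"
  by (simp add: stable_def mpow_transpose)

lemma kap_transpose [simp]: "kap (transpose A) = kap A"
  by (simp add: kap_def mpow_transpose)

lemma kap_nonneg: "stable A \<Longrightarrow> 0 \<le> kap A"
  unfolding kap_def stable_def by (rule suminf_nonneg) auto

lemma dlyap_term_norm: "norm (transpose (mpow A t) ** X ** mpow A t) \<le> (norm (mpow A t))\<^sup>2 * norm X"
  for A :: "real^'n^'n"
proof -
  have "norm (transpose (mpow A t) ** X ** mpow A t) \<le> norm (transpose (mpow A t) ** X) * norm (mpow A t)"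
    by (rule norm_mult_le)
  also have "\<dots> \<le> (norm (transpose (mpow A t)) * norm X) * norm (mpow A t)"
    by (intro mult_right_mono norm_mult_le) auto
  finally show ?thesis by (simp add: power2_eq_square ac_simps)
qed

lemma dlyap_summable_norm:
  assumes "stable A" shows "summable (\<lambda>t. norm (transpose (mpow A t) ** X ** mpow A t))"
proof (rule summable_comparison_test')
  show "summable (\<lambda>t. (norm (mpow A t))\<^sup>2 * norm X)"
    using assms by (simp add: stable_def summable_mult2)
  show "norm (norm (transpose (mpow A t) ** X ** mpow A t)) \<le> (norm (mpow A t))\<^sup>2 * norm X" for t
    using dlyap_term_norm by simp
qed

lemma dlyap_summable: "stable A \<Longrightarrow> summable (\<lambda>t. transpose (mpow A t) ** X ** mpow A t)"
  by (rule summable_norm_cancel) (rule dlyap_summable_norm)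

lemma dlyap_norm:
  assumes "stable A" shows "norm (dlyap A X) \<le> kap A * norm X"
proof -
  have "norm (dlyap A X) \<le> (\<Sum>t. norm (transpose (mpow A t) ** X ** mpow A t))"
    unfolding dlyap_def by (rule summable_norm[OF dlyap_summable_norm[OF assms]])
  also have "\<dots> \<le> (\<Sum>t. (norm (mpow A t))\<^sup>2 * norm X)"
    by (intro suminf_le dlyap_term_norm dlyap_summable_norm assms)
       (use assms in \<open>simp add: stable_def summable_mult2\<close>)
  also have "\<dots> = kap A * norm X"
    using assms by (simp add: kap_def stable_def suminf_mult2[symmetric])
  finally show ?thesis .
qed

lemma dlyap_bounded_linear_comp:
  assumes "stable A" "bounded_linear f"
  shows "f (dlyap A X) = (\<Sum>t. f (transpose (mpow A t) ** X ** mpow A t))"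
    and "summable (\<lambda>t. f (transpose (mpow A t) ** X ** mpow A t))"
  unfolding dlyap_def
  using bounded_linear.suminf[OF assms(2) dlyap_summable[OF assms(1)]]
    bounded_linear.summable[OF assms(2) dlyap_summable[OF assms(1)]] by auto

lemma bounded_linear_mat_vec: "bounded_linear (\<lambda>X::real^'n^'m. X *v v)"
proof (rule bounded_linear_intro[where K = "norm v"])
  fix X Y :: "real^'n^'m" and r :: real
  show "(X + Y) *v v = X *v v + Y *v v" by (simp add: matrix_vector_mult_add_rdistrib)
  show "(r *\<^sub>R X) *v v = r *\<^sub>R (X *v v)" by (simp add: scaleR_matrix_vector_assoc)
  show "norm (X *v v) \<le> norm X * norm v"
    by (rule order_trans[OF spec_norm_le mult_right_mono[OF spec_norm_le_norm]]) simp
qed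

lemma dlyap_spec_norm:
  assumes "stable A" shows "spec_norm (dlyap A X) \<le> kap A * spec_norm X"
proof (rule spec_norm_leI)
  fix v :: "real^'a"
  let ?t = "\<lambda>t. (transpose (mpow A t) ** X ** mpow A t) *v v"
  have le: "norm (?t t) \<le> (norm (mpow A t))\<^sup>2 * (spec_norm X * norm v)" for t
  proof -
    have "spec_norm (transpose (mpow A t) ** X ** mpow A t)
        \<le> (spec_norm (mpow A t) * spec_norm X) * spec_norm (mpow A t)"
      using spec_norm_mult[of "transpose (mpow A t)" X]
      by (intro order_trans[OF spec_norm_mult] mult_right_mono) simp_all
    also have "\<dots> = (spec_norm (mpow A t))\<^sup>2 * spec_norm X" by (simp add: power2_eq_square)
    also have "\<dots> \<le> (norm (mpow A t))\<^sup>2 * spec_norm X"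
      by (intro mult_right_mono power_mono spec_norm_le_norm) auto
    finally have "norm (?t t) \<le> (norm (mpow A t))\<^sup>2 * spec_norm X * norm v"
      by (meson mult_right_mono norm_ge_zero order_trans spec_norm_le)
    then show ?thesis by (simp add: mult.assoc)
  qed
  have sum: "summable (\<lambda>t. (norm (mpow A t))\<^sup>2 * (spec_norm X * norm v))"
    using assms by (simp add: stable_def summable_mult2)
  have sn: "summable (\<lambda>t. norm (?t t))"
    by (rule summable_comparison_test'[OF sum]) (use le in simp)
  have "norm (dlyap A X *v v) = norm (\<Sum>t. ?t t)"
    by (simp add: dlyap_bounded_linear_comp[OF assms bounded_linear_mat_vec])
  also have "\<dots> \<le> (\<Sum>t. norm (?t t))" by (rule summable_norm[OF sn])
  also have "\<dots> \<le> (\<Sum>t. (norm (mpow A t))\<^sup>2 * (spec_norm X * norm v))"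
    by (intro suminf_le le sn sum)
  also have "\<dots> = kap A * spec_norm X * norm v"
    unfolding mult.assoc using assms by (simp add: kap_def stable_def suminf_mult2[symmetric])
  finally show "norm (dlyap A X *v v) \<le> kap A * spec_norm X * norm v" .
qed

lemma bounded_linear_sandwich: "bounded_linear (\<lambda>X. U ** X ** V)"
  for U :: "real^'n^'m" and V :: "real^'q^'p"
  using bounded_linear_compose[OF bounded_bilinear.bounded_linear_left[OF bounded_bilinear_matrix_mult, of V]
      bounded_bilinear.bounded_linear_right[OF bounded_bilinear_matrix_mult, of U]] .

lemma dlyap_fixpoint:
  assumes "stable A" shows "dlyap A X = X + transpose A ** dlyap A X ** A"
proof -
  let ?f = "\<lambda>t. transpose (mpow A t) ** X ** mpow A t"
  have "dlyap A X = ?f 0 + (\<Sum>t. ?f (Suc t))"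
    unfolding dlyap_def using suminf_split_head[OF dlyap_summable[OF assms, of X]] by simp
  also have "(\<Sum>t. ?f (Suc t)) = (\<Sum>t. transpose A ** ?f t ** A)"
    by (simp only: mpow_Suc_right matrix_transpose_mul matrix_mul_assoc)
  also have "\<dots> = transpose A ** dlyap A X ** A"
    by (rule dlyap_bounded_linear_comp(1)[OF assms bounded_linear_sandwich, symmetric])
  finally show ?thesis by simp
qed

text \<open>The difference of two solutions is fixed by the map sending D to A^T D A. Iterating
  bounds its norm by a multiple of the squared norm of A^t, which tends to zero.\<close>

lemma dlyap_unique:
  assumes "stable A" "Y = X + transpose A ** Y ** A"
  shows "Y = dlyap A X"
proof -
  define D where "D = Y - dlyap A X"
  have "D = transpose A ** D ** A"
    unfolding D_def by (subst assms(2), subst dlyap_fixpoint[OF assms(1)]) (simp add: mat_distribs)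
  have D: "D = transpose (mpow A t) ** D ** mpow A t" for t
  proof (induction t)
    case (Suc t)
    have "transpose (mpow A (Suc t)) ** D ** mpow A (Suc t)
        = transpose (mpow A t) ** (transpose A ** D ** A) ** mpow A t"
      by (simp add: matrix_transpose_mul matrix_mul_assoc)
    with Suc \<open>D = transpose A ** D ** A\<close> show ?case by simp
  qed simp
  have "(\<lambda>t. (norm (mpow A t))\<^sup>2 * norm D) \<longlonglongrightarrow> 0 * norm D"
    using assms(1) by (intro tendsto_mult tendsto_const summable_LIMSEQ_zero) (simp add: stable_def)
  moreover have "norm D \<le> (norm (mpow A t))\<^sup>2 * norm D" for t
    using dlyap_term_norm[of A t D] D[of t] by simp
  ultimately have "norm D \<le> 0" by (intro LIMSEQ_le_const[of _ _ "norm D"]) auto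
  then show ?thesis by (simp add: D_def)
qed

lemma dlyap_add: "stable A \<Longrightarrow> dlyap A (X + Y) = dlyap A X + dlyap A Y"
  unfolding dlyap_def by (simp add: suminf_add[OF dlyap_summable dlyap_summable] mat_distribs)

lemma dlyap_scaleR: "stable A \<Longrightarrow> dlyap A (c *\<^sub>R X) = c *\<^sub>R dlyap A X"
  unfolding dlyap_def by (simp add: suminf_scaleR_right[OF dlyap_summable] mat_distribs)

lemma bounded_linear_dlyap: "stable A \<Longrightarrow> bounded_linear (dlyap A)"
  by (rule bounded_linear_intro[where K = "kap A"])
    (simp_all add: dlyap_add dlyap_scaleR dlyap_norm mult.commute[of _ "kap A"])

lemma dlyap_diff: "stable A \<Longrightarrow> dlyap A (X - Y) = dlyap A X - dlyap A Y"
  using bounded_linear_dlyap by (rule linear_diff[OF bounded_linear.linear])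

text \<open>Moves the Lyapunov operator from the weight to the initial covariance, so the cost can
  be written as the pairing of \<open>lyap\<close> with \<open>init_cov D\<close> or of the stage
  weight with the state covariance.\<close>

lemma dlyap_adjoint:
  assumes "stable A" shows "dlyap A X \<bullet> Y = X \<bullet> dlyap (transpose A) Y"
proof -
  have tm: "(transpose B ** X ** B) \<bullet> Y = X \<bullet> (B ** Y ** transpose B)" for B :: "real^'a^'a"
    by (simp only: inner_mult_right[of "transpose B ** X"] inner_mult_left[of "transpose B"])
      (simp add: matrix_mul_assoc)
  have "dlyap A X \<bullet> Y = (\<Sum>t. (transpose (mpow A t) ** X ** mpow A t) \<bullet> Y)"
    by (rule dlyap_bounded_linear_comp(1)[OF assms bounded_linear_inner_left])
  also have "\<dots> = (\<Sum>t. X \<bullet> (transpose (mpow (transpose A) t) ** Y ** mpow (transpose A) t))"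
    by (simp add: mpow_transpose tm)
  also have "\<dots> = X \<bullet> dlyap (transpose A) Y"
    using assms by (intro dlyap_bounded_linear_comp(1)[symmetric] bounded_linear_inner_right) simp
  finally show ?thesis .
qed

lemma dlyap_transpose: "stable A \<Longrightarrow> transpose (dlyap A X) = dlyap A (transpose X)"
  by (subst dlyap_bounded_linear_comp[OF _ bounded_linear_transpose])
    (simp_all add: dlyap_def matrix_transpose_mul matrix_mul_assoc)

lemma inner_mat_vec: "(v::real^'n) \<bullet> ((transpose B ** X ** B) *v v) = (B *v v) \<bullet> (X *v (B *v v))"
  for B :: "real^'n^'m"
proof -
  have "v \<bullet> ((transpose B ** X ** B) *v v) = v \<bullet> (transpose B *v (X *v (B *v v)))"
    by (simp only: matrix_vector_mul_assoc matrix_mul_assoc)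
  also have "\<dots> = (B *v v) \<bullet> (X *v (B *v v))"
    using dot_lmul_matrix[of "X *v (B *v v)" B v] by (simp add: inner_commute)
  finally show ?thesis .
qed

lemma bounded_linear_quad: "bounded_linear (\<lambda>X::real^'n^'m. w \<bullet> (X *v v))"
  by (rule bounded_linear_compose[OF bounded_linear_inner_right bounded_linear_mat_vec])

lemma psd_dlyap:
  assumes "stable A" "psd X" shows "psd (dlyap A X)"
proof -
  have "0 \<le> v \<bullet> (dlyap A X *v v)" for v
    unfolding dlyap_bounded_linear_comp(1)[OF assms(1) bounded_linear_quad]
    by (rule suminf_nonneg[OF dlyap_bounded_linear_comp(2)[OF assms(1) bounded_linear_quad]])
      (simp add: inner_mat_vec psd_ge_0[OF assms(2)])
  then show ?thesis using assms by (simp add: psd_def dlyap_transpose)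
qed

lemma psd_sandwich: "psd X \<Longrightarrow> psd (transpose B ** X ** B)" for B :: "real^'n^'m"
  by (simp add: psd_def inner_mat_vec matrix_transpose_mul matrix_mul_assoc)

lemma psd_add: "psd X \<Longrightarrow> psd Y \<Longrightarrow> psd (X + Y)"
  by (simp add: psd_def transpose_add matrix_vector_mult_add_rdistrib inner_add_right)

lemma psd_mat_1: "psd (mat 1)"
  by (simp add: psd_def)

text \<open>P is a strict Lyapunov function: its decrease along an orbit telescopes and bounds the
  sum of squared norms by v^T P v / c. Summing over the basis vectors v turns this into the
  trace.\<close>

lemma stable_test:
  fixes A P :: "real^'n^'n"
  assumes P: "psd P" and "c > 0"
    and dec: "\<And>v. c * (norm v)\<^sup>2 \<le> v \<bullet> ((P - transpose A ** P ** A) *v v)"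
  shows "stable A" "kap A \<le> trace P / c"
proof -
  have step: "c * (\<Sum>t<n. (norm (mpow A t *v v))\<^sup>2)
      \<le> v \<bullet> (P *v v) - (mpow A n *v v) \<bullet> (P *v (mpow A n *v v))" for n and v :: "real^'n"
  proof (induction n)
    case (Suc n)
    have "c * (norm (mpow A n *v v))\<^sup>2
        \<le> (mpow A n *v v) \<bullet> (P *v (mpow A n *v v)) - (mpow A (Suc n) *v v) \<bullet> (P *v (mpow A (Suc n) *v v))"
      using dec[of "mpow A n *v v"]
      by (simp only: matrix_vector_mult_diff_rdistrib inner_diff_right inner_mat_vec mpow.simps
          matrix_vector_mul_assoc[of A])
    with Suc show ?case by (simp add: distrib_left)
  qed simp
  have col: "(\<Sum>t<n. (norm (mpow A t *v v))\<^sup>2) \<le> v \<bullet> (P *v v) / c" for n and v :: "real^'n"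
    using step[where n = n and v = v] psd_ge_0[OF P, of "mpow A n *v v"] \<open>c > 0\<close> by (simp add: field_simps)
  have bound: "(\<Sum>t<n. (norm (mpow A t))\<^sup>2) \<le> trace P / c" for n
  proof -
    have "(\<Sum>t<n. (norm (mpow A t))\<^sup>2) = (\<Sum>j\<in>UNIV. \<Sum>t<n. (norm (mpow A t *v axis j 1))\<^sup>2)"
      unfolding norm_sq_cols by (rule sum.swap)
    also have "\<dots> \<le> (\<Sum>j\<in>UNIV. axis j 1 \<bullet> (P *v axis j 1) / c)" by (intro sum_mono col)
    also have "\<dots> = trace P / c"
      by (simp add: trace_def sum_divide_distrib inner_axis' matrix_vector_axis)
    finally show ?thesis .
  qed
  show "stable A" unfolding stable_def by (rule summableI_nonneg_bounded[OF _ bound]) simp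
  then show "kap A \<le> trace P / c"
    unfolding kap_def stable_def by (rule suminf_le_const[OF _ bound])
qed

lemma quad_le: "\<bar>v \<bullet> (X *v v)\<bar> \<le> spec_norm X * (norm v)\<^sup>2" for X :: "real^'n^'n"
proof -
  have "\<bar>v \<bullet> (X *v v)\<bar> \<le> norm v * (spec_norm X * norm v)"
    by (intro order_trans[OF Cauchy_Schwarz_ineq2] mult_left_mono spec_norm_le) auto
  then show ?thesis by (simp add: power2_eq_square ac_simps)
qed

text \<open>The Lyapunov matrix of A decreases with margin 1 along A, and by continuity with margin
  1/2 along every nearby matrix. The bound C on \<open>kap\<close> is uniform in the neighbourhood,
  as the derivative of \<open>dlyap\<close> in its first argument requires.\<close>

lemma stable_nearby:
  fixes A :: "real^'n^'n"
  assumes "stable A"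
  obtains C where "eventually (\<lambda>A'. stable A' \<and> kap A' \<le> C) (nhds A)"
proof -
  define P where "P = dlyap A (mat 1)"
  have P: "psd P" unfolding P_def by (rule psd_dlyap[OF assms psd_mat_1])
  have fix_P: "P = mat 1 + transpose A ** P ** A"
    unfolding P_def by (rule dlyap_fixpoint[OF assms])
  have "((\<lambda>A'. norm (transpose A' ** P ** A' - transpose A ** P ** A))
      \<longlongrightarrow> norm (transpose A ** P ** A - transpose A ** P ** A)) (nhds A)"
    by (intro tendsto_intros) (simp_all add: filterlim_ident)
  then have "eventually (\<lambda>A'. norm (transpose A' ** P ** A' - transpose A ** P ** A) < 1/2) (nhds A)"
    by (rule order_tendstoD) simp
  then have "eventually (\<lambda>A'. stable A' \<and> kap A' \<le> trace P / (1/2)) (nhds A)"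
  proof eventually_elim
    case (elim A')
    let ?Z = "transpose A' ** P ** A' - transpose A ** P ** A"
    have "1/2 * (norm v)\<^sup>2 \<le> v \<bullet> ((P - transpose A' ** P ** A') *v v)" for v
    proof -
      have "P - transpose A' ** P ** A' = mat 1 - ?Z" by (subst (1) fix_P) simp
      then have "v \<bullet> ((P - transpose A' ** P ** A') *v v) = (norm v)\<^sup>2 - v \<bullet> (?Z *v v)"
        by (simp only: matrix_vector_mult_diff_rdistrib inner_diff_right)
          (simp add: power2_norm_eq_inner)
      moreover have "v \<bullet> (?Z *v v) \<le> 1/2 * (norm v)\<^sup>2"
        using quad_le[of v ?Z] spec_norm_le_norm[of ?Z] elim
          mult_right_mono[of "spec_norm ?Z" "1/2" "(norm v)\<^sup>2"] by simp
      ultimately show ?thesis by simp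
    qed
    from stable_test[OF P _ this] show ?case by simp
  qed
  then show ?thesis by (rule that)
qed

text \<open>The trial matrix Y solves the equation with its own right-hand side Y - A^T Y A exactly;
  by linearity its error is the Lyapunov solution for its residual.\<close>

lemma dlyap_shift:
  assumes "stable A"
  shows "dlyap A X - Y = dlyap A (X + transpose A ** Y ** A - Y)"
proof -
  have "Y = dlyap A (Y - transpose A ** Y ** A)"
    by (rule dlyap_unique[OF assms]) simp
  then have "dlyap A X - Y = dlyap A X - dlyap A (Y - transpose A ** Y ** A)" by simp
  also have "\<dots> = dlyap A (X + transpose A ** Y ** A - Y)"
    by (simp add: dlyap_diff[OF assms, symmetric] algebra_simps)
  finally show ?thesis .
qed

text \<open>Implicit differentiation with Y frozen as trial matrix: the increment is the moved
  operator applied to the residual \<open>g w\<close>, which vanishes at z. Only the elementary map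
  \<open>g\<close> has to be differentiated; since the residual is of first order, mere continuity
  of the operator suffices.\<close>

lemma dlyap_has_derivative:
  fixes a :: "'z::real_normed_vector \<Rightarrow> real^'n^'n" and x :: "'z \<Rightarrow> real^'n^'n"
  assumes a: "(a has_derivative a') (at z)" and x: "(x has_derivative x') (at z)"
    and st: "stable (a z)"
  defines "Y \<equiv> dlyap (a z) (x z)"
  shows "((\<lambda>w. dlyap (a w) (x w)) has_derivative
    (\<lambda>h. dlyap (a z) (x' h + transpose (a' h) ** Y ** a z + transpose (a z) ** Y ** a' h))) (at z)"
proof -
  define g where "g w = x w + transpose (a w) ** Y ** a w - Y" for w
  define g' where "g' h = x' h + transpose (a' h) ** Y ** a z + transpose (a z) ** Y ** a' h" for h
  have g: "(g has_derivative g') (at z)"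
    unfolding g_def g'_def by (auto intro!: derivative_eq_intros a x simp: mat_distribs)
  have g0: "g z = 0"
    using dlyap_fixpoint[OF st, of "x z"] by (simp add: g_def Y_def)
  have blg: "bounded_linear g'" using g by (rule has_derivative_bounded_linear)
  obtain B where B: "\<And>h. norm (g' h) \<le> norm h * B" "B > 0"
    using bounded_linear.pos_bounded[OF blg] by auto
  obtain C where near: "eventually (\<lambda>A'. stable A' \<and> kap A' \<le> C) (nhds (a z))"
    by (rule stable_nearby[OF st])
  have acont: "(a \<longlongrightarrow> a z) (at z)"
    using has_derivative_continuous[OF a] by (simp add: continuous_at)
  then have "filterlim a (nhds (a z)) (at z)" .
  from eventually_compose_filterlim[OF near this]
  have ev: "eventually (\<lambda>w. stable (a w) \<and> kap (a w) \<le> C) (at z)" .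
  define k where "k = kap (a z)"
  \<comment> \<open>Bounds the operator norm of the difference between \<open>dlyap (a w)\<close>
    and \<open>dlyap (a z)\<close>; it tends to zero because C dominates \<open>kap (a w)\<close>
    near z.\<close>
  define r where "r w = C * (2 * norm (a z) + norm (a w - a z)) * norm (a w - a z) * k" for w
  have diffbound: "norm (dlyap (a w) W - dlyap (a z) W) \<le> r w * norm W"
    if w: "stable (a w)" "kap (a w) \<le> C" for w W
  proof -
    let ?d = "a w - a z" and ?U = "dlyap (a z) W"
    have eq: "W + transpose (a w) ** ?U ** a w - ?U
        = transpose ?d ** ?U ** a z + transpose (a z) ** ?U ** ?d + transpose ?d ** ?U ** ?d"
      by (subst (2) dlyap_fixpoint[OF st]) (simp add: mat_distribs)
    have U: "norm ?U \<le> k * norm W" unfolding k_def by (rule dlyap_norm[OF st])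
    have n3: "norm (transpose p ** ?U ** q) \<le> norm p * norm ?U * norm q" for p q :: "real^'n^'n"
      using norm_mult_le[of "transpose p" ?U]
      by (intro order_trans[OF norm_mult_le] mult_right_mono) simp_all
    have "norm (dlyap (a w) W - ?U) \<le> kap (a w) * norm (transpose ?d ** ?U ** a z + transpose (a z) ** ?U ** ?d + transpose ?d ** ?U ** ?d)"
      unfolding dlyap_shift[OF w(1), of W ?U] eq by (rule dlyap_norm[OF w(1)])
    also have "\<dots> \<le> kap (a w) * (norm ?d * norm ?U * norm (a z) + norm (a z) * norm ?U * norm ?d + norm ?d * norm ?U * norm ?d)"
      by (intro mult_left_mono order_trans[OF norm_triangle_ineq] add_mono n3 kap_nonneg w(1))
    also have "\<dots> = kap (a w) * ((2 * norm (a z) + norm ?d) * norm ?d * norm ?U)"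
      by (simp add: algebra_simps)
    also have "\<dots> \<le> C * ((2 * norm (a z) + norm ?d) * norm ?d * (k * norm W))"
      using w kap_nonneg[OF w(1)] by (intro mult_mono mult_left_mono U) (auto intro!: mult_nonneg_nonneg)
    finally show ?thesis by (simp add: r_def mult.assoc)
  qed
  have rlim: "(r \<longlongrightarrow> 0) (at z)"
  proof -
    have "(r \<longlongrightarrow> C * (2 * norm (a z) + norm (a z - a z)) * norm (a z - a z) * k) (at z)"
      unfolding r_def by (intro tendsto_intros acont)
    then show ?thesis by simp
  qed
  have main: "((\<lambda>w. norm (dlyap (a w) (x w) - Y - dlyap (a z) (g' (w - z))) / norm (w - z)) \<longlongrightarrow> 0) (at z)"
  proof (rule tendsto_sandwich[of "\<lambda>_. 0"])
    have gq: "((\<lambda>w. norm (g w - g' (w - z)) / norm (w - z)) \<longlongrightarrow> 0) (at z)"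
    proof -
      have "((\<lambda>w. (g w - g z - g' (w - z)) /\<^sub>R norm (w - z)) \<longlongrightarrow> 0) (at z)"
        using g by (simp add: has_derivative_at_within)
      from tendsto_norm_zero[OF this] show ?thesis by (simp add: g0 divide_inverse_commute)
    qed
    show "((\<lambda>w. C * (norm (g w - g' (w - z)) / norm (w - z)) + r w * B) \<longlongrightarrow> 0) (at z)"
      using tendsto_add[OF tendsto_mult[OF tendsto_const[of C] gq] tendsto_mult[OF rlim tendsto_const[of B]]]
      by simp
    show "eventually (\<lambda>w. norm (dlyap (a w) (x w) - Y - dlyap (a z) (g' (w - z))) / norm (w - z)
      \<le> C * (norm (g w - g' (w - z)) / norm (w - z)) + r w * B) (at z)"
      using ev eventually_neq_at_within[of z z UNIV]
    proof eventually_elim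
      case (elim w)
      then have w: "stable (a w)" "kap (a w) \<le> C" "w \<noteq> z" by auto
      let ?h = "w - z"
      have "dlyap (a w) (x w) - Y - dlyap (a z) (g' ?h)
          = dlyap (a w) (g w - g' ?h) + (dlyap (a w) (g' ?h) - dlyap (a z) (g' ?h))"
        unfolding dlyap_shift[OF w(1), of "x w" Y] g_def[symmetric] by (simp add: dlyap_diff[OF w(1)])
      then have "norm (dlyap (a w) (x w) - Y - dlyap (a z) (g' ?h))
          \<le> norm (dlyap (a w) (g w - g' ?h)) + norm (dlyap (a w) (g' ?h) - dlyap (a z) (g' ?h))"
        by (metis norm_triangle_ineq)
      also have "\<dots> \<le> C * norm (g w - g' ?h) + r w * (norm ?h * B)"
      proof (rule add_mono)
        show "norm (dlyap (a w) (g w - g' ?h)) \<le> C * norm (g w - g' ?h)"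
          using dlyap_norm[OF w(1)] w(2) by (meson mult_right_mono norm_ge_zero order_trans)
        have "0 \<le> r w"
          unfolding r_def k_def using w kap_nonneg[OF w(1)] kap_nonneg[OF st] by (intro mult_nonneg_nonneg) auto
        then show "norm (dlyap (a w) (g' ?h) - dlyap (a z) (g' ?h)) \<le> r w * (norm ?h * B)"
          using diffbound[OF w(1,2)] B(1) by (meson mult_left_mono order_trans)
      qed
      finally show ?case using w(3) by (simp add: field_simps)
    qed
  qed auto
  have "((\<lambda>w. dlyap (a w) (x w)) has_derivative (\<lambda>h. dlyap (a z) (g' h))) (at z)"
    unfolding has_derivative_at_within
  proof
    show "bounded_linear (\<lambda>h. dlyap (a z) (g' h))"
      by (rule bounded_linear_compose[OF bounded_linear_dlyap[OF st] blg])
    have "((\<lambda>w. norm ((dlyap (a w) (x w) - dlyap (a z) (x z) - dlyap (a z) (g' (w - z))) /\<^sub>R norm (w - z))) \<longlongrightarrow> 0) (at z)"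
      using main by (simp add: Y_def divide_inverse_commute)
    then show "((\<lambda>w. (dlyap (a w) (x w) - dlyap (a z) (x z) - dlyap (a z) (g' (w - z))) /\<^sub>R norm (w - z)) \<longlongrightarrow> 0) (at z)"
      by (rule tendsto_norm_zero_cancel)
  qed
  then show ?thesis by (simp add: g'_def)
qed

subsection \<open>Cost, gradient and Hessian of a single task\<close>

lemma outer_component: "outer x y $ i $ j = x $ i * y $ j"
  by (simp add: outer_def)

lemma inner_outer: "X \<bullet> outer v v = v \<bullet> (X *v v)" for X :: "real^'n^'n"
  by (simp add: inner_vec_def outer_component matrix_vector_mult_def sum_distrib_left ac_simps)

lemma outer_vec: "outer v v *v x = (v \<bullet> x) *\<^sub>R v" for v x :: "real^'n"
  by (simp add: vec_eq_iff matrix_vector_mult_def outer_component inner_vec_def sum_distrib_right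
      sum_distrib_left ac_simps)

lemma outer_mult: "outer (B *v x) (B *v x) = B ** outer x x ** transpose B" for B :: "real^'n^'m"
proof -
  have "(\<Sum>k\<in>UNIV. B$i$k * x$k) * (\<Sum>l\<in>UNIV. B$j$l * x$l)
      = (\<Sum>l\<in>UNIV. (\<Sum>k\<in>UNIV. B$i$k * (x$k * x$l)) * B$j$l)" for i j
    unfolding sum_product by (subst sum.swap) (simp only: sum_distrib_left sum_distrib_right ac_simps)
  then show ?thesis
    by (simp add: vec_eq_iff outer_component matrix_vector_mult_def matrix_matrix_mult_def transpose_def)
qed

lemma norm_outer: "norm (outer x x) = (norm x)\<^sup>2" for x :: "real^'n"
proof -
  have row: "outer x x $ i = (x $ i) *\<^sub>R x" for i by (simp add: vec_eq_iff outer_component)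
  have "(norm (outer x x))\<^sup>2 = ((norm x)\<^sup>2)\<^sup>2"
    unfolding norm_sq_rows[of "outer x x"] row norm_scaleR power_mult_distrib sum_distrib_right[symmetric]
    by (simp add: norm_vec_def L2_set_def sum_nonneg power2_eq_square)
  then show ?thesis by (rule power2_eq_imp_eq) auto
qed

lemma inner_gram: "transpose Y = Y \<Longrightarrow> (transpose B ** B) \<bullet> Y = (\<Sum>i\<in>UNIV. B $ i \<bullet> (Y *v (B $ i)))"
  for B :: "real^'n^'m"
proof -
  assume Y: "transpose Y = Y"
  have "(transpose B ** B) \<bullet> Y = B \<bullet> (B ** Y)" by (simp add: inner_mult_left)
  then show ?thesis unfolding inner_vec_def[of B] matrix_mult_row Y .
qed

lemma inner_gram_ge:
  fixes B :: "real^'n^'m"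
  assumes "transpose Y = Y" "\<And>v. c * (norm v)\<^sup>2 \<le> v \<bullet> (Y *v v)"
  shows "c * (norm B)\<^sup>2 \<le> (transpose B ** B) \<bullet> Y"
  unfolding inner_gram[OF assms(1)] norm_sq_rows sum_distrib_left by (intro sum_mono assms(2))

lemma inner_gram_le:
  fixes B :: "real^'n^'m"
  assumes "transpose Y = Y"
  shows "(transpose B ** B) \<bullet> Y \<le> spec_norm Y * (norm B)\<^sup>2"
  unfolding inner_gram[OF assms(1)] norm_sq_rows sum_distrib_left
  by (intro sum_mono) (meson abs_le_iff quad_le)

lemma norm_mult_ge:
  fixes E :: "real^'n^'m"
  assumes "transpose Y = Y" "\<And>v. c * (norm v)\<^sup>2 \<le> v \<bullet> (Y *v v)" "0 \<le> c"
  shows "c * norm E \<le> norm (E ** Y)"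
proof -
  have row: "(E ** Y) $ i = Y *v (E $ i)" for i
  using matrix_mult_row[of E Y i] by (simp only: assms(1))
  have vec: "c * norm v \<le> norm (Y *v v)" for v
  proof (cases "v = 0")
    case False
    have "c * (norm v)\<^sup>2 \<le> norm v * norm (Y *v v)"
      using assms(2)[of v] norm_cauchy_schwarz[of v "Y *v v"] by linarith
    then have "norm v * (c * norm v) \<le> norm v * norm (Y *v v)"
      by (simp add: power2_eq_square ac_simps)
    with False show ?thesis by simp
  qed simp
  have "(c * norm E)\<^sup>2 \<le> (norm (E ** Y))\<^sup>2"
    unfolding power_mult_distrib norm_sq_rows sum_distrib_left row
    using vec assms(3) by (intro sum_mono) (metis mult_nonneg_nonneg norm_ge_zero power_mono power_mult_distrib)
  then show ?thesis by (rule power2_le_imp_le) simp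
qed

lemma state_eq: "state S K x t = mpow (closed_loop S K) t *v x"
proof (induction t)
  case (Suc t)
  show ?case
    by (simp add: Suc.IH closed_loop_def matrix_vector_mul_assoc[symmetric] matrix_vector_mult_diff_rdistrib)
      (simp add: matrix_vector_mul_assoc vec_eq_iff matrix_vector_mult_def sum_negf)
qed simp

lemma stabilizing_iff: "K \<in> stabilizing S \<longleftrightarrow> stable (closed_loop S K)"
  by (simp add: stabilizing_def spec_radius_less_1_iff)

lemma lyap_eq: "K \<in> stabilizing S \<Longrightarrow> lyap S K = dlyap (closed_loop S K) (stage_weight S K)"
  unfolding lyap_def
  by (rule the_equality) (simp_all add: stabilizing_iff dlyap_fixpoint[symmetric] dlyap_unique)

locale lqr =
  fixes D :: "(real^'x::finite) measure" and S :: "('x, 'u::finite) lqr_task" and \<mu> :: real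
  assumes sets_D: "sets D = sets borel" and sq_int: "integrable D (\<lambda>x. (norm x)\<^sup>2)"
    and mu_pos: "0 < \<mu>" and cov_posdef: "posdef (init_cov D - \<mu> *\<^sub>R mat 1)"
    and Q_posdef: "posdef (Qmat S)" and R_posdef: "posdef (Rmat S)"
begin

abbreviation "S0 \<equiv> init_cov D"
abbreviation "Acl \<equiv> closed_loop S"
abbreviation "W \<equiv> stage_weight S"
abbreviation "B \<equiv> Bmat S"
abbreviation "R \<equiv> Rmat S"
abbreviation "J \<equiv> cost D S"
abbreviation "P \<equiv> lyap S"
abbreviation "q \<equiv> sigma_min (Qmat S)"
abbreviation "r \<equiv> sigma_min (Rmat S)"

text \<open>The state covariance written as a Lyapunov solution for the transposed closed loop;
  \<open>state_cov_eq\<close> justifies it on stabilizing gains.\<close>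

definition Sg :: "real^'x^'u \<Rightarrow> real^'x^'x" where
  "Sg K = dlyap (transpose (Acl K)) S0"

text \<open>Half the natural policy gradient: the gradient of the cost without its factors 2 and
  \<open>Sg K\<close>.\<close>

definition E :: "real^'x^'u \<Rightarrow> real^'x^'u" where
  "E K = R ** K - transpose B ** P K ** Acl K"

definition G :: "real^'x^'u \<Rightarrow> real^'u^'u" where
  "G K = R + transpose B ** P K ** B"

section \<open>Second moments of the initial state and bounds in terms of the cost\<close>

lemma outer_integrable: "integrable D (\<lambda>x. outer x x)"
proof (rule Bochner_Integration.integrable_bound[OF sq_int])
  have "continuous_on UNIV (\<lambda>x::real^'x. outer x x)"
    unfolding outer_def by (intro continuous_intros)
  then show "(\<lambda>x. outer x x) \<in> borel_measurable D"
    using borel_measurable_continuous_onI measurable_cong_sets[OF sets_D refl] by blast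
qed (simp add: norm_outer)

lemma
  shows inner_S0: "X \<bullet> S0 = (\<integral>x. x \<bullet> (X *v x) \<partial>D)"
    and quad_integrable: "integrable D (\<lambda>x. x \<bullet> (X *v x))"
  unfolding init_cov_def
  using integral_bounded_linear[OF bounded_linear_inner_right outer_integrable, of X]
    integrable_bounded_linear[OF bounded_linear_inner_right outer_integrable, of X]
  by (simp_all add: inner_outer)

lemma inner_S0_nonneg: "psd X \<Longrightarrow> 0 \<le> X \<bullet> S0"
  unfolding inner_S0 by (intro Bochner_Integration.integral_nonneg) (simp add: psd_ge_0)

lemma q_pos: "0 < q" and r_pos: "0 < r"
  by (simp_all add: sigma_min_pos Q_posdef R_posdef)

lemma Q_sym: "transpose (Qmat S) = Qmat S" and R_sym: "transpose R = R"
  using Q_posdef R_posdef by (simp_all add: posdef_def)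

lemma S0_sym: "transpose S0 = S0"
  using cov_posdef by (simp add: posdef_def transpose_diff transpose_scaleR)

lemma S0_ge: "\<mu> * (norm v)\<^sup>2 \<le> v \<bullet> (S0 *v v)"
  using psd_ge_0[OF posdef_psd[OF cov_posdef], of v]
  by (simp add: matrix_vector_mult_diff_rdistrib scaleR_matrix_vector_assoc[symmetric]
      inner_diff_right power2_norm_eq_inner)

lemma S0_psd: "psd S0"
  unfolding psd_def using S0_sym S0_ge mu_pos by (meson mult_nonneg_nonneg order_trans less_imp_le zero_le_power2)

lemma W_sym: "transpose (W K) = W K"
  by (simp add: stage_weight_def mat_distribs Q_sym R_sym)

lemma W_quad: "v \<bullet> (W K *v v) = v \<bullet> (Qmat S *v v) + (K *v v) \<bullet> (R *v (K *v v))"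
  by (simp add: stage_weight_def matrix_vector_mult_add_rdistrib inner_add_right inner_mat_vec)

lemma W_ge: "q * (norm v)\<^sup>2 \<le> v \<bullet> (W K *v v)"
  unfolding W_quad using sigma_min_le[OF Q_posdef, of v] psd_ge_0[OF posdef_psd[OF R_posdef], of "K *v v"]
  by linarith

lemma W_psd: "psd (W K)"
  unfolding psd_def using W_sym W_ge q_pos by (meson mult_nonneg_nonneg order_trans less_imp_le zero_le_power2)

lemma P_eq: "K \<in> stabilizing S \<Longrightarrow> P K = dlyap (Acl K) (W K)"
  by (rule lyap_eq)

lemma P_fix: "K \<in> stabilizing S \<Longrightarrow> P K = W K + transpose (Acl K) ** P K ** Acl K"
  by (simp add: P_eq dlyap_fixpoint[symmetric] stabilizing_iff)

lemma P_psd: "K \<in> stabilizing S \<Longrightarrow> psd (P K)"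
  by (simp add: P_eq stabilizing_iff psd_dlyap W_psd)

lemma P_sym: "K \<in> stabilizing S \<Longrightarrow> transpose (P K) = P K"
  using P_psd by (simp add: psd_def)

lemma Sg_psd: "K \<in> stabilizing S \<Longrightarrow> psd (Sg K)"
  by (simp add: Sg_def stabilizing_iff psd_dlyap S0_psd)

lemma Sg_sym: "K \<in> stabilizing S \<Longrightarrow> transpose (Sg K) = Sg K"
  using Sg_psd by (simp add: psd_def)

lemma inner_Sg: "K \<in> stabilizing S \<Longrightarrow> X \<bullet> Sg K = dlyap (Acl K) X \<bullet> S0"
  by (simp add: Sg_def stabilizing_iff dlyap_adjoint)

lemma inner_Sg_nonneg: "K \<in> stabilizing S \<Longrightarrow> psd X \<Longrightarrow> 0 \<le> X \<bullet> Sg K"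
  by (simp add: inner_Sg stabilizing_iff psd_dlyap inner_S0_nonneg)

lemma Sg_ge:
  assumes "K \<in> stabilizing S" shows "\<mu> * (norm v)\<^sup>2 \<le> v \<bullet> (Sg K *v v)"
proof -
  have "Sg K = S0 + Acl K ** Sg K ** transpose (Acl K)"
    using dlyap_fixpoint[of "transpose (Acl K)" S0] assms by (simp add: Sg_def stabilizing_iff)
  then have "v \<bullet> (Sg K *v v) = v \<bullet> (S0 *v v) + v \<bullet> ((Acl K ** Sg K ** transpose (Acl K)) *v v)"
    by (metis inner_add_right matrix_vector_mult_add_rdistrib)
  moreover have "0 \<le> v \<bullet> ((Acl K ** Sg K ** transpose (Acl K)) *v v)"
    using psd_ge_0[OF psd_sandwich[OF Sg_psd[OF assms], of "transpose (Acl K)"]] by simp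
  ultimately show ?thesis using S0_ge[of v] by linarith
qed

text \<open>The stage costs are nonnegative, so the extended series equals the real Lyapunov series;
  its integral is a second moment, hence finite, and \<open>enn2real\<close> loses nothing.\<close>

lemma cost_eq:
  assumes "K \<in> stabilizing S" shows "J K = P K \<bullet> S0"
proof -
  have st: "stable (Acl K)" using assms by (simp add: stabilizing_iff)
  have "(\<Sum>t. ennreal (state S K x t \<bullet> (W K *v state S K x t))) = ennreal (x \<bullet> (P K *v x))" for x
  proof -
    have "(\<Sum>t. ennreal (state S K x t \<bullet> (W K *v state S K x t)))
        = (\<Sum>t. ennreal (x \<bullet> ((transpose (mpow (Acl K) t) ** W K ** mpow (Acl K) t) *v x)))"
      by (simp add: state_eq inner_mat_vec)
    also have "\<dots> = ennreal (\<Sum>t. x \<bullet> ((transpose (mpow (Acl K) t) ** W K ** mpow (Acl K) t) *v x))"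
      by (rule suminf_ennreal2[OF _ dlyap_bounded_linear_comp(2)[OF st bounded_linear_quad]])
        (simp add: inner_mat_vec psd_ge_0[OF W_psd])
    also have "\<dots> = ennreal (x \<bullet> (P K *v x))"
      by (simp add: P_eq[OF assms] dlyap_bounded_linear_comp(1)[OF st bounded_linear_quad])
    finally show ?thesis .
  qed
  then have "ext_cost D S K = (\<integral>\<^sup>+x. ennreal (x \<bullet> (P K *v x)) \<partial>D)" by (simp add: ext_cost_def)
  also have "\<dots> = ennreal (P K \<bullet> S0)"
    unfolding inner_S0 by (rule nn_integral_eq_integral[OF quad_integrable]) (simp add: psd_ge_0[OF P_psd[OF assms]])
  finally show ?thesis by (simp add: cost_def inner_S0_nonneg[OF P_psd[OF assms]])
qed

lemma cost_eq': "K \<in> stabilizing S \<Longrightarrow> J K = W K \<bullet> Sg K"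
  by (simp add: cost_eq inner_Sg P_eq)

lemma state_cov_eq:
  assumes "K \<in> stabilizing S" shows "state_cov D S K = Sg K"
proof -
  have st: "stable (transpose (Acl K))" using assms by (simp add: stabilizing_iff)
  have "(\<Sum>t. outer (state S K x t) (state S K x t)) = dlyap (transpose (Acl K)) (outer x x)" for x
    by (simp add: dlyap_def state_eq outer_mult mpow_transpose)
  then show ?thesis
    using integral_bounded_linear[OF bounded_linear_dlyap[OF st] outer_integrable]
    by (simp add: state_cov_def Sg_def init_cov_def)
qed

lemma trace_Sg: assumes "K \<in> stabilizing S" shows "q * trace (Sg K) \<le> J K"
proof -
  have "psd (W K - q *\<^sub>R mat 1)"
    unfolding psd_def using W_ge[of _ K]
    by (simp add: transpose_diff transpose_scaleR W_sym matrix_vector_mult_diff_rdistrib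
      scaleR_matrix_vector_assoc[symmetric] inner_diff_right power2_norm_eq_inner)
  from inner_Sg_nonneg[OF assms this] show ?thesis
    by (simp add: cost_eq'[OF assms] inner_diff_left mat_1_inner)
qed

lemma norm_Sg: assumes "K \<in> stabilizing S" shows "norm (Sg K) \<le> J K / q"
proof -
  have "q * norm (Sg K) \<le> J K"
    using mult_left_mono[OF psd_norm_le_trace[OF Sg_psd[OF assms]], of q] trace_Sg[OF assms] q_pos by linarith
  then show ?thesis using q_pos by (simp add: field_simps)
qed

text \<open>As the initial covariance dominates \<mu> I, \<mu> times the squared norm of a power is
  at most the corresponding term of the trace of the state covariance, and that trace is at most J /
  q.\<close>

lemma kap_le: assumes "K \<in> stabilizing S" shows "kap (Acl K) \<le> J K / (q * \<mu>)"
proof -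
  have st: "stable (Acl K)" using assms by (simp add: stabilizing_iff)
  let ?f = "\<lambda>t. (transpose (mpow (Acl K) t) ** mat 1 ** mpow (Acl K) t) \<bullet> S0"
  have "\<mu> * kap (Acl K) = (\<Sum>t. \<mu> * (norm (mpow (Acl K) t))\<^sup>2)"
    using st by (simp add: kap_def stable_def suminf_mult)
  also have "\<dots> \<le> (\<Sum>t. ?f t)"
    using st inner_gram_ge[OF S0_sym S0_ge]
    by (intro suminf_le dlyap_bounded_linear_comp(2)[OF st bounded_linear_inner_left])
      (auto simp: stable_def summable_mult)
  also have "\<dots> = mat 1 \<bullet> Sg K"
    by (simp add: inner_Sg[OF assms] dlyap_bounded_linear_comp(1)[OF st bounded_linear_inner_left])
  also have "\<dots> \<le> J K / q" using trace_Sg[OF assms] q_pos by (simp add: mat_1_inner field_simps)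
  finally show ?thesis using q_pos mu_pos by (simp add: field_simps)
qed

lemma kap_ge_1: "K \<in> stabilizing S \<Longrightarrow> 1 \<le> kap (Acl K)"
proof -
  assume "K \<in> stabilizing S"
  then have st: "summable (\<lambda>t. (norm (mpow (Acl K) t))\<^sup>2)" by (simp add: stabilizing_iff stable_def)
  obtain i :: 'x where True by simp
  have "1 = \<bar>(mat 1 :: real^'x^'x) $ i $ i\<bar>" by (simp add: mat_def)
  also have "\<dots> \<le> norm ((mat 1 :: real^'x^'x) $ i)" by (rule component_le_norm_cart)
  also have "\<dots> \<le> norm (mat 1 :: real^'x^'x)" by (rule Finite_Cartesian_Product.norm_nth_le)
  finally have "1 \<le> (norm (mpow (Acl K) 0))\<^sup>2" by (simp add: power_mono[of 1 _ 2, simplified])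
  also have "\<dots> \<le> kap (Acl K)"
    unfolding kap_def using sum_le_suminf[OF st, of "{0}"] by simp
  finally show ?thesis .
qed

lemma J_ge: assumes "K \<in> stabilizing S" shows "q * \<mu> \<le> J K"
proof -
  have "1 \<le> J K / (q * \<mu>)" using kap_ge_1[OF assms] kap_le[OF assms] by linarith
  then show ?thesis using q_pos mu_pos by (simp add: field_simps)
qed

lemma J_pos: "K \<in> stabilizing S \<Longrightarrow> 0 < J K"
  using J_ge q_pos mu_pos by (meson less_le_trans mult_pos_pos)

text \<open>For \<open>w = P v\<close> the matrix \<open>(v\<^sup>T P v) P - w w\<^sup>T\<close> is positive semidefinite by
  Cauchy--Schwarz; pairing it with the initial covariance avoids a square root of \<open>P\<close>.\<close>

lemma spec_P: assumes K: "K \<in> stabilizing S" shows "spec_norm (P K) \<le> J K / \<mu>"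
proof (rule spec_norm_leI)
  fix v :: "real^'x"
  define w where "w = P K *v v"
  define a where "a = v \<bullet> w"
  have "psd (a *\<^sub>R P K - outer w w)"
  proof -
    have "x \<bullet> ((a *\<^sub>R P K - outer w w) *v x) = a * (x \<bullet> (P K *v x)) - (x \<bullet> w)\<^sup>2" for x
      by (simp add: matrix_vector_mult_diff_rdistrib scaleR_matrix_vector_assoc[symmetric]
        inner_diff_right outer_vec power2_eq_square inner_commute)
    moreover have "(x \<bullet> w)\<^sup>2 \<le> a * (x \<bullet> (P K *v x))" for x
      using psd_cauchy_schwarz[OF P_psd[OF K], of x v] by (simp add: w_def a_def mult.commute)
    moreover have "transpose (outer w w) = outer w w"
      by (simp add: vec_eq_iff transpose_def outer_component mult.commute)
    ultimately show ?thesis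
      by (simp add: psd_def transpose_diff transpose_scaleR P_sym[OF K])
  qed
  then have "outer w w \<bullet> S0 \<le> a * J K"
    using inner_S0_nonneg[of "a *\<^sub>R P K - outer w w"] by (simp add: inner_diff_left cost_eq[OF K])
  moreover have "\<mu> * (norm w)\<^sup>2 \<le> outer w w \<bullet> S0"
    using S0_ge[of w] by (simp add: inner_commute[of "outer w w"] inner_outer)
  moreover have "a * J K \<le> (norm v * norm w) * J K"
    unfolding a_def using J_pos[OF K] by (intro mult_right_mono norm_cauchy_schwarz) simp
  ultimately have "norm w * (\<mu> * norm w) \<le> norm w * (J K * norm v)"
    by (simp add: power2_eq_square ac_simps)
  then have "\<mu> * norm w \<le> J K * norm v"
    using J_pos[OF K] by (cases "w = 0") auto
  then show "norm (P K *v v) \<le> J K / \<mu> * norm v"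
    using mu_pos by (simp add: w_def field_simps)
qed

text \<open>Coercivity of the cost: \<open>P K\<close> dominates the stage weight, hence r K^T K.
  This keeps sublevel sets bounded.\<close>

lemma norm_K: assumes K: "K \<in> stabilizing S" shows "r * \<mu> * (norm K)\<^sup>2 \<le> J K"
proof -
  have "psd (P K - r *\<^sub>R (transpose K ** K))"
  proof -
    have "P K - r *\<^sub>R (transpose K ** K) = (W K - r *\<^sub>R (transpose K ** K)) + transpose (Acl K) ** P K ** Acl K"
      using P_fix[OF K] by (simp add: algebra_simps)
    moreover have "psd (W K - r *\<^sub>R (transpose K ** K))"
    proof -
      have "0 \<le> v \<bullet> ((W K - r *\<^sub>R (transpose K ** K)) *v v)" for v
      proof -
        have "v \<bullet> ((transpose K ** K) *v v) = (norm (K *v v))\<^sup>2"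
          using inner_mat_vec[of v K "mat 1"] by (simp add: power2_norm_eq_inner)
        then have "v \<bullet> ((W K - r *\<^sub>R (transpose K ** K)) *v v)
            = v \<bullet> (Qmat S *v v) + ((K *v v) \<bullet> (R *v (K *v v)) - r * (norm (K *v v))\<^sup>2)"
          by (simp add: matrix_vector_mult_diff_rdistrib scaleR_matrix_vector_assoc[symmetric]
            inner_diff_right W_quad)
        then show ?thesis
          using sigma_min_le[OF R_posdef, of "K *v v"] psd_ge_0[OF posdef_psd[OF Q_posdef], of v] by linarith
      qed
      then show ?thesis
        by (simp add: psd_def transpose_diff transpose_scaleR W_sym matrix_transpose_mul)
    qed
    ultimately show ?thesis
      using psd_add[OF _ psd_sandwich[OF P_psd[OF K], of "Acl K"]] by metis
  qed
  from inner_S0_nonneg[OF this] have "r * ((transpose K ** K) \<bullet> S0) \<le> J K"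
    by (simp add: inner_diff_left cost_eq[OF K])
  moreover have "r * (\<mu> * (norm K)\<^sup>2) \<le> r * ((transpose K ** K) \<bullet> S0)"
    using r_pos by (intro mult_left_mono inner_gram_ge[OF S0_sym S0_ge]) simp
  ultimately show ?thesis by (simp add: mult.assoc)
qed


subsection \<open>Comparison of two gains\<close>

text \<open>The residual of the old value matrix \<open>P K\<close> in the Lyapunov equation of the
  new gain K + \<Delta>, known as the advantage of the new gain over the old one.\<close>

definition gain_diff :: "real^'x^'u \<Rightarrow> real^'x^'u \<Rightarrow> real^'x^'x" where
  "gain_diff K \<Delta> = transpose \<Delta> ** G K ** \<Delta> + transpose \<Delta> ** E K + transpose (E K) ** \<Delta>"

lemma gain_diff_eq:
  assumes K: "K \<in> stabilizing S"
  shows "W (K + \<Delta>) + transpose (Acl (K + \<Delta>)) ** P K ** Acl (K + \<Delta>) - P K = gain_diff K \<Delta>"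
proof -
  have A: "Acl (K + \<Delta>) = Acl K - B ** \<Delta>"
    by (simp add: closed_loop_def mat_distribs)
  have W': "W (K + \<Delta>) = W K + transpose \<Delta> ** R ** K + transpose K ** R ** \<Delta> + transpose \<Delta> ** R ** \<Delta>"
    by (simp add: stage_weight_def mat_distribs algebra_simps)
  have E': "transpose (E K) = transpose K ** R - transpose (Acl K) ** P K ** B"
    by (simp add: E_def mat_distribs R_sym P_sym[OF K])
  have WK: "W K = P K - transpose (Acl K) ** P K ** Acl K" using P_fix[OF K] by (simp add: algebra_simps)
  show ?thesis
    unfolding gain_diff_def A W' E' unfolding WK
    by (simp add: mat_distribs G_def E_def algebra_simps)
qed

lemma gain_diff_sym: "K \<in> stabilizing S \<Longrightarrow> transpose (gain_diff K \<Delta>) = gain_diff K \<Delta>"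
  by (simp add: gain_diff_def mat_distribs G_def R_sym P_sym algebra_simps)

lemma gain_diff_quad:
  "v \<bullet> (gain_diff K \<Delta> *v v) = (\<Delta> *v v) \<bullet> (G K *v (\<Delta> *v v)) + 2 * ((\<Delta> *v v) \<bullet> (E K *v v))"
proof -
  have *: "v \<bullet> ((transpose X ** Y) *v v) = (X *v v) \<bullet> (Y *v v)" for X Y :: "real^'x^'u"
    using dot_lmul_matrix[of "Y *v v" X v] by (simp add: matrix_vector_mul_assoc[symmetric] inner_commute)
  show ?thesis
    by (simp add: gain_diff_def matrix_vector_mult_add_rdistrib inner_add_right inner_mat_vec * inner_commute)
qed

text \<open>An exact performance difference formula. The weight is the covariance of the new gain,
  so applying it with the optimal gain as the new one produces the covariance that occurs in
  \<open>lambda_task\<close>.\<close>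

lemma cost_diff:
  assumes K: "K \<in> stabilizing S" and K': "K + \<Delta> \<in> stabilizing S"
  shows "J (K + \<Delta>) - J K = gain_diff K \<Delta> \<bullet> Sg (K + \<Delta>)"
proof -
  have st: "stable (Acl (K + \<Delta>))" using K' by (simp add: stabilizing_iff)
  have "P (K + \<Delta>) - P K = dlyap (Acl (K + \<Delta>)) (gain_diff K \<Delta>)"
    unfolding P_eq[OF K'] dlyap_shift[OF st] gain_diff_eq[OF K] ..
  then show ?thesis
    by (simp add: cost_eq[OF K] cost_eq[OF K'] inner_Sg[OF K'] inner_diff_left[symmetric])
qed

lemma G_quad_ge: "K \<in> stabilizing S \<Longrightarrow> r * (norm v)\<^sup>2 \<le> v \<bullet> (G K *v v)"
  using sigma_min_le[OF R_posdef, of v] psd_ge_0[OF psd_sandwich[OF P_psd, of K B], of v]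
  by (simp add: G_def matrix_vector_mult_add_rdistrib inner_add_right)

lemma spec_G_pos: assumes "K \<in> stabilizing S" shows "0 < spec_norm (G K)"
proof -
  obtain v :: "real^'u" where v: "norm v = 1" using vector_choose_size[of 1] by auto
  have "r \<le> v \<bullet> (G K *v v)" using G_quad_ge[OF assms, of v] v by simp
  also have "\<dots> \<le> spec_norm (G K)" using quad_le[of v "G K"] v by simp
  finally show ?thesis using r_pos by simp
qed

lemma quad_gram: "v \<bullet> ((transpose X ** X) *v v) = (norm (X *v v))\<^sup>2" for X :: "real^'n^'m"
  using inner_mat_vec[of v X "mat 1"] by (simp add: power2_norm_eq_inner)

text \<open>The gain \<open>K - E / \<parallel>G\<parallel>\<close> is again stabilizing and its cost is smaller by at least
  \<open>\<mu> \<parallel>E\<parallel>\<^sup>2 / \<parallel>G\<parallel>\<close>.\<close>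

lemma norm_E_sq:
  assumes K: "K \<in> stabilizing S" and min: "\<And>K'. K' \<in> stabilizing S \<Longrightarrow> Jst \<le> J K'"
  shows "(norm (E K))\<^sup>2 \<le> spec_norm (G K) * (J K - Jst) / \<mu>"
proof -
  define g where "g = spec_norm (G K)"
  have g: "0 < g" using spec_G_pos[OF K] by (simp add: g_def)
  \<comment> \<open>The minimizer of c^2 g + 2 c, the coefficient that remains after the quadratic
    term is estimated by g.\<close>
  define c where "c = - (1 / g)"
  have c: "c < 0" "c\<^sup>2 * g = - c" using g by (simp_all add: c_def power2_eq_square)
  define \<Delta> where "\<Delta> = c *\<^sub>R E K"
  have Dv: "\<Delta> *v v = c *\<^sub>R (E K *v v)" for v
    by (simp only: \<Delta>_def scaleR_matrix_vector_assoc)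
  have T: "v \<bullet> (gain_diff K \<Delta> *v v) \<le> c * (norm (E K *v v))\<^sup>2" for v
  proof -
    let ?e = "E K *v v"
    have "v \<bullet> (gain_diff K \<Delta> *v v) = c\<^sup>2 * (?e \<bullet> (G K *v ?e)) + 2 * c * (norm ?e)\<^sup>2"
      unfolding gain_diff_quad Dv
      by (simp add: matrix_vector_mult_scaleR power2_norm_eq_inner power2_eq_square[of c])
    also have "\<dots> \<le> c\<^sup>2 * (g * (norm ?e)\<^sup>2) + 2 * c * (norm ?e)\<^sup>2"
      using quad_le[of ?e "G K"] by (intro add_right_mono mult_left_mono) (auto simp: g_def)
    also have "\<dots> = (c\<^sup>2 * g + 2 * c) * (norm ?e)\<^sup>2" by (simp add: algebra_simps)
    finally show ?thesis by (simp add: c(2))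
  qed
  define A' where "A' = Acl (K + \<Delta>)"
  \<comment> \<open>Along the new closed loop the old matrix \<open>P K\<close> loses at least the
    new stage weight, because \<open>gain_diff\<close> is negative semidefinite; so it certifies
    stability before the cost of the new gain may be used.\<close>
  have st: "stable A'"
  proof (rule stable_test(1)[OF P_psd[OF K] q_pos])
    fix v
    have "P K - transpose A' ** P K ** A' = W (K + \<Delta>) - gain_diff K \<Delta>"
      unfolding A'_def gain_diff_eq[OF K, symmetric] by simp
    then have "v \<bullet> ((P K - transpose A' ** P K ** A') *v v)
        = v \<bullet> (W (K + \<Delta>) *v v) - v \<bullet> (gain_diff K \<Delta> *v v)"
      by (simp only: matrix_vector_mult_diff_rdistrib inner_diff_right)
    moreover have "v \<bullet> (gain_diff K \<Delta> *v v) \<le> 0"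
      using c(1) by (intro order_trans[OF T]) (simp add: mult_le_0_iff)
    ultimately show "q * (norm v)\<^sup>2 \<le> v \<bullet> ((P K - transpose A' ** P K ** A') *v v)"
      using W_ge[of v "K + \<Delta>"] by linarith
  qed
  then have K': "K + \<Delta> \<in> stabilizing S" by (simp add: stabilizing_iff A'_def)
  have "psd (c *\<^sub>R (transpose (E K) ** E K) - gain_diff K \<Delta>)"
    unfolding psd_def using T
    by (simp add: transpose_diff transpose_scaleR matrix_transpose_mul gain_diff_sym[OF K]
        matrix_vector_mult_diff_rdistrib scaleR_matrix_vector_assoc[symmetric] inner_diff_right quad_gram)
  from inner_Sg_nonneg[OF K' this]
  have "J (K + \<Delta>) - J K \<le> c * ((transpose (E K) ** E K) \<bullet> Sg (K + \<Delta>))"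
    unfolding cost_diff[OF K K'] inner_diff_left inner_scaleR_left by linarith
  moreover have "c * ((transpose (E K) ** E K) \<bullet> Sg (K + \<Delta>)) \<le> c * (\<mu> * (norm (E K))\<^sup>2)"
    using c by (intro mult_left_mono_neg inner_gram_ge Sg_sym Sg_ge K') auto
  ultimately have "- c * (\<mu> * (norm (E K))\<^sup>2) \<le> J K - Jst" using min[OF K'] by linarith
  then have "\<mu> * (norm (E K))\<^sup>2 \<le> g * (J K - Jst)" using g by (simp add: c_def field_simps)
  then show ?thesis using mu_pos by (simp add: g_def field_simps)
qed

text \<open>Completing the square with G at least r I bounds the advantage matrix below by -(1/r)
  E^T E, for every \<Delta>. Pairing with the covariance at \<open>Ks\<close> gives the
  claim.\<close>

lemma cost_gap_le:
  assumes K: "K \<in> stabilizing S" and Ks: "Ks \<in> stabilizing S"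
  shows "r * (J K - J Ks) \<le> spec_norm (Sg Ks) * (norm (E K))\<^sup>2"
proof -
  define \<Delta> where "\<Delta> = Ks - K"
  have eq: "Ks = K + \<Delta>" by (simp add: \<Delta>_def)
  have "0 \<le> v \<bullet> (gain_diff K \<Delta> *v v) + (1 / r) * (norm (E K *v v))\<^sup>2" for v
  proof -
    let ?d = "\<Delta> *v v" and ?e = "E K *v v"
    have "0 \<le> r * (norm (?d + (1 / r) *\<^sub>R ?e))\<^sup>2" using r_pos by simp
    also have "\<dots> = r * (norm ?d)\<^sup>2 + 2 * (?d \<bullet> ?e) + (1 / r) * (norm ?e)\<^sup>2"
      using r_pos by (simp add: power2_norm_eq_inner inner_add_left inner_add_right inner_commute field_simps)
    also have "\<dots> \<le> v \<bullet> (gain_diff K \<Delta> *v v) + (1 / r) * (norm ?e)\<^sup>2"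
      unfolding gain_diff_quad using G_quad_ge[OF K, of ?d] by simp
    finally show ?thesis .
  qed
  then have "psd (gain_diff K \<Delta> + (1 / r) *\<^sub>R (transpose (E K) ** E K))"
    unfolding psd_def
    by (simp add: transpose_add transpose_scaleR matrix_transpose_mul gain_diff_sym[OF K]
        matrix_vector_mult_add_rdistrib scaleR_matrix_vector_assoc[symmetric] inner_add_right quad_gram)
  from inner_Sg_nonneg[OF Ks this] have "J K - J Ks \<le> (1 / r) * ((transpose (E K) ** E K) \<bullet> Sg Ks)"
    using cost_diff[of K \<Delta>] K Ks by (simp add: eq[symmetric] inner_add_left)
  then have "r * (J K - J Ks) \<le> (transpose (E K) ** E K) \<bullet> Sg Ks"
    using r_pos by (simp add: field_simps)
  then show ?thesis using inner_gram_le[OF Sg_sym[OF Ks], of "E K"] by linarith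
qed

subsection \<open>Derivatives\<close>

lemma open_stabilizing: "open (stabilizing S)"
  unfolding open_contains_ball Ball_def
proof (intro allI impI)
  fix K assume K: "K \<in> stabilizing S"
  obtain C where ev: "eventually (\<lambda>A'. stable A' \<and> kap A' \<le> C) (nhds (Acl K))"
    using K stable_nearby by (auto simp: stabilizing_iff)
  have "filterlim Acl (nhds (Acl K)) (nhds K)"
    unfolding closed_loop_def[abs_def] by (intro tendsto_intros filterlim_ident)
  from eventually_compose_filterlim[OF ev this]
  have "eventually (\<lambda>K'. K' \<in> stabilizing S) (nhds K)"
    by eventually_elim (simp add: stabilizing_iff)
  then show "\<exists>e>0. ball K e \<subseteq> stabilizing S"
    by (auto simp: eventually_nhds_metric subset_eq dist_commute)
qed

definition dP :: "real^'x^'u \<Rightarrow> real^'x^'u \<Rightarrow> real^'x^'x" where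
  "dP K H = dlyap (Acl K) (transpose H ** E K + transpose (E K) ** H)"

definition dSg :: "real^'x^'u \<Rightarrow> real^'x^'u \<Rightarrow> real^'x^'x" where
  "dSg K H = - dlyap (transpose (Acl K))
     (B ** H ** Sg K ** transpose (Acl K) + Acl K ** Sg K ** transpose (B ** H))"

definition dgrad :: "real^'x^'u \<Rightarrow> real^'x^'u \<Rightarrow> real^'x^'u" where
  "dgrad K H = 2 *\<^sub>R ((G K ** H - transpose B ** dP K H ** Acl K) ** Sg K + E K ** dSg K H)"

lemma Acl_deriv: "(Acl has_derivative (\<lambda>H. - (B ** H))) (at K)"
  unfolding closed_loop_def[abs_def] by (auto intro!: derivative_eq_intros)

text \<open>The derivatives of the stage weight and of the closed loop combine into the single
  source H^T E + E^T H of a Lyapunov equation.\<close>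

lemma P_deriv:
  assumes K: "K \<in> stabilizing S" shows "(P has_derivative dP K) (at K)"
proof -
  have st: "stable (Acl K)" using K by (simp add: stabilizing_iff)
  have W': "(W has_derivative (\<lambda>H. transpose H ** R ** K + transpose K ** R ** H)) (at K)"
    unfolding stage_weight_def[abs_def] by (auto intro!: derivative_eq_intros simp: add.commute)
  have "((\<lambda>K. dlyap (Acl K) (W K)) has_derivative dP K) (at K)"
  proof (rule has_derivative_eq_rhs[OF dlyap_has_derivative[OF Acl_deriv W' st]])
    have "transpose H ** R ** K + transpose K ** R ** H + transpose (- (B ** H)) ** P K ** Acl K
        + transpose (Acl K) ** P K ** - (B ** H) = transpose H ** E K + transpose (E K) ** H" for H
    proof -
      have neg: "X ** (- Y) = - (X ** Y)" "(- X) ** Z = - (X ** Z)"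
        for X :: "real^'x^'x" and Y Z :: "real^'x^'x"
        using matrix_scaleR_right[of X "-1" Y] matrix_scaleR_left[of "-1" X Z] by simp_all
      show ?thesis
        by (simp add: E_def mat_distribs neg R_sym P_sym[OF K] algebra_simps)
    qed
    then show "(\<lambda>H. dlyap (Acl K) (transpose H ** R ** K + transpose K ** R ** H
        + transpose (- (B ** H)) ** dlyap (Acl K) (W K) ** Acl K
        + transpose (Acl K) ** dlyap (Acl K) (W K) ** - (B ** H))) = dP K"
      by (simp add: fun_eq_iff dP_def P_eq[OF K, symmetric])
  qed
  then show ?thesis
    by (rule has_derivative_transform_within_open[OF _ open_stabilizing K]) (simp add: P_eq)
qed

lemma Sg_deriv:
  assumes K: "K \<in> stabilizing S" shows "(Sg has_derivative dSg K) (at K)"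
proof -
  have st: "stable (transpose (Acl K))" using K by (simp add: stabilizing_iff)
  have "(Sg has_derivative (\<lambda>H. dlyap (transpose (Acl K)) (0 + transpose (transpose (- (B ** H))) ** Sg K ** transpose (Acl K)
      + transpose (transpose (Acl K)) ** Sg K ** transpose (- (B ** H))))) (at K)"
    unfolding Sg_def[abs_def]
    by (rule dlyap_has_derivative[OF has_derivative_transpose[OF Acl_deriv] has_derivative_const st])
  moreover have "dlyap (transpose (Acl K)) (0 + transpose (transpose (- (B ** H))) ** Sg K ** transpose (Acl K)
      + transpose (transpose (Acl K)) ** Sg K ** transpose (- (B ** H))) = dSg K H" for H
  proof -
    have neg: "X ** (- Y) = - (X ** Y)" "(- X) ** Z = - (X ** Z)"
      for X :: "real^'x^'x" and Y Z :: "real^'x^'x"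
      using matrix_scaleR_right[of X "-1" Y] matrix_scaleR_left[of "-1" X Z] by simp_all
    have "0 + transpose (transpose (- (B ** H))) ** Sg K ** transpose (Acl K)
      + transpose (transpose (Acl K)) ** Sg K ** transpose (- (B ** H))
      = (-1) *\<^sub>R (B ** H ** Sg K ** transpose (Acl K) + Acl K ** Sg K ** transpose (B ** H))"
      by (simp add: neg transpose_uminus)
    then show ?thesis by (simp only: dlyap_scaleR[OF st] dSg_def) simp
  qed
  ultimately show ?thesis by simp
qed

lemma E_deriv:
  assumes K: "K \<in> stabilizing S"
  shows "(E has_derivative (\<lambda>H. G K ** H - transpose B ** dP K H ** Acl K)) (at K)"
  unfolding E_def[abs_def]
  by (rule has_derivative_eq_rhs, (rule derivative_intros P_deriv[OF K] Acl_deriv)+)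
    (simp add: fun_eq_iff G_def mat_distribs matrix_scaleR_right[of _ "-1", simplified] algebra_simps)

text \<open>The adjoint rule turns the derivative of \<open>P\<close> paired with the initial
  covariance into its source paired with \<open>Sg K\<close>; the two halves of the source agree by
  symmetry, whence the factor 2.\<close>

lemma GDERIV_cost:
  assumes K: "K \<in> stabilizing S"
  shows "GDERIV J K :> 2 *\<^sub>R (E K ** Sg K)"
proof -
  have "((\<lambda>K. P K \<bullet> S0) has_derivative (\<lambda>H. dP K H \<bullet> S0)) (at K)"
    by (rule bounded_linear.has_derivative[OF bounded_linear_inner_left P_deriv[OF K]])
  then have "(J has_derivative (\<lambda>H. dP K H \<bullet> S0)) (at K)"
    by (rule has_derivative_transform_within_open[OF _ open_stabilizing K]) (simp add: cost_eq)
  moreover have "dP K H \<bullet> S0 = H \<bullet> 2 *\<^sub>R (E K ** Sg K)" for H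
  proof -
    have "dP K H \<bullet> S0 = (transpose H ** E K + transpose (E K) ** H) \<bullet> Sg K"
      by (simp add: dP_def inner_Sg[OF K])
    also have "\<dots> = E K \<bullet> (H ** Sg K) + H \<bullet> (E K ** Sg K)"
      by (simp only: inner_add_left inner_mult_left[of "transpose H"] inner_mult_left[of "transpose (E K)"]
          transpose_transpose)
    also have "E K \<bullet> (H ** Sg K) = H \<bullet> (E K ** Sg K)"
      using inner_mult_right[of "E K" "Sg K" H] by (simp add: Sg_sym[OF K] inner_commute)
    finally show ?thesis by simp
  qed
  ultimately show ?thesis by (simp add: gderiv_def)
qed

lemma gradient_cost:
  assumes K: "K \<in> stabilizing S" shows "gradient J K = 2 *\<^sub>R (E K ** Sg K)"
  unfolding gradient_def
proof (rule the_equality[of "\<lambda>g. GDERIV J K :> g", OF GDERIV_cost[OF K]])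
  fix g assume "GDERIV J K :> g"
  then have eq: "(\<lambda>H. H \<bullet> g) = (\<lambda>H. H \<bullet> 2 *\<^sub>R (E K ** Sg K))"
    using has_derivative_unique GDERIV_cost[OF K] unfolding gderiv_def by blast
  let ?d = "g - 2 *\<^sub>R (E K ** Sg K)"
  have "?d \<bullet> ?d = 0" using fun_cong[OF eq, of ?d] by (simp only: inner_diff_right)
  then show "g = 2 *\<^sub>R (E K ** Sg K)" by simp
qed

lemma gradient_deriv:
  assumes K: "K \<in> stabilizing S" shows "(gradient J has_derivative dgrad K) (at K)"
proof -
  have "((\<lambda>K. 2 *\<^sub>R (E K ** Sg K)) has_derivative dgrad K) (at K)"
    unfolding dgrad_def[abs_def]
    by (rule has_derivative_eq_rhs, (rule derivative_intros E_deriv[OF K] Sg_deriv[OF K])+)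
      (simp add: add.commute)
  then show ?thesis
    by (rule has_derivative_transform_within_open[OF _ open_stabilizing K]) (simp add: gradient_cost)
qed

lemma hessian_cost: "K \<in> stabilizing S \<Longrightarrow> hessian J K = dgrad K"
  unfolding hessian_def using frechet_derivative_at[OF gradient_deriv] by simp

lemma J_cont: "K \<in> stabilizing S \<Longrightarrow> isCont J K"
  using GDERIV_cost unfolding gderiv_def by (rule has_derivative_continuous)

text \<open>The changes of \<open>P\<close> and of the covariance contribute equal terms with
  coefficient 4, which add up to 8. With \<open>kap\<close> at most J / (q \<mu>) the bound takes
  the form of \<open>h_grad\<close>.\<close>

lemma norm_dgrad:
  assumes K: "K \<in> stabilizing S"
  shows "norm (dgrad K H) \<le> (2 * spec_norm (G K) * (J K / q)
    + 8 * (J K / q)\<^sup>2 * (spec_norm B * spec_norm (Acl K) / \<mu>) * norm (E K)) * norm H"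
proof -
  define s where "s = J K / q"
  define k where "k = kap (Acl K)"
  define b where "b = spec_norm B"
  define a where "a = spec_norm (Acl K)"
  define e where "e = norm (E K)"
  define h where "h = norm H"
  have st: "stable (Acl K)" using K by (simp add: stabilizing_iff)
  have nn: "0 \<le> b" "0 \<le> a" "0 \<le> e" "0 \<le> h" "0 \<le> k" "0 \<le> s"
    using kap_nonneg[OF st] J_pos[OF K] q_pos by (auto simp: b_def a_def e_def h_def k_def s_def)
  have k: "k \<le> s / \<mu>" using kap_le[OF K] by (simp add: k_def s_def)
  have nS: "norm (Sg K) \<le> s" using norm_Sg[OF K] by (simp add: s_def)
  then have sS: "spec_norm (Sg K) \<le> s" using spec_norm_le_norm order_trans by blast
  have "norm (dP K H) \<le> k * (norm (transpose H ** E K + transpose (E K) ** H))"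
    unfolding dP_def k_def by (rule dlyap_norm[OF st])
  also have "\<dots> \<le> k * (2 * (e * h))"
    using norm_mult_le[of "transpose H" "E K"] norm_mult_le[of "transpose (E K)" H] nn
    by (intro mult_left_mono order_trans[OF norm_triangle_ineq]) (auto simp: e_def h_def mult.commute)
  finally have ndP: "norm (dP K H) \<le> 2 * k * e * h" by (simp add: ac_simps)
  have "norm (transpose B ** dP K H ** Acl K) \<le> norm (transpose B ** dP K H) * a"
    unfolding a_def by (rule norm_mult_spec_right)
  also have "\<dots> \<le> (b * (2 * k * e * h)) * a"
    using ndP nn
    by (intro mult_right_mono order_trans[OF norm_mult_spec_left]) (auto simp: b_def intro: mult_left_mono)
  finally have n1: "norm (transpose B ** dP K H ** Acl K) \<le> b * (2 * k * e * h) * a" .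
  have n2: "norm (G K ** H) \<le> spec_norm (G K) * h" unfolding h_def by (rule norm_mult_spec_left)
  have "norm ((G K ** H - transpose B ** dP K H ** Acl K) ** Sg K)
      \<le> norm (G K ** H - transpose B ** dP K H ** Acl K) * spec_norm (Sg K)"
    by (rule norm_mult_spec_right)
  also have "\<dots> \<le> (spec_norm (G K) * h + b * (2 * k * e * h) * a) * s"
    using n1 n2 nn sS
    by (intro mult_mono order_trans[OF norm_triangle_ineq4] add_mono) auto
  finally have t1: "norm ((G K ** H - transpose B ** dP K H ** Acl K) ** Sg K)
      \<le> (spec_norm (G K) * h + b * (2 * k * e * h) * a) * s" .
  have n3: "norm (B ** H ** Sg K ** transpose (Acl K)) \<le> b * h * s * a"
  proof -
    have "norm (B ** H ** Sg K) \<le> norm (B ** H) * spec_norm (Sg K)" by (rule norm_mult_spec_right)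
    also have "\<dots> \<le> (b * h) * s"
      using norm_mult_spec_left[of B H] sS nn by (intro mult_mono) (auto simp: b_def h_def)
    finally show ?thesis
      using nn by (intro order_trans[OF norm_mult_spec_right]) (simp add: a_def mult_right_mono)
  qed
  have n4: "norm (Acl K ** Sg K ** transpose (B ** H)) = norm (B ** H ** Sg K ** transpose (Acl K))"
    using norm_transpose[of "Acl K ** Sg K ** transpose (B ** H)"]
    by (simp add: matrix_transpose_mul matrix_mul_assoc Sg_sym[OF K])
  have "norm (dSg K H) \<le> k * norm (B ** H ** Sg K ** transpose (Acl K) + Acl K ** Sg K ** transpose (B ** H))"
    unfolding dSg_def k_def norm_minus_cancel
    using dlyap_norm[of "transpose (Acl K)"] st by simp
  also have "\<dots> \<le> k * (2 * (b * h * s * a))"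
    using n3 n4 nn by (intro mult_left_mono order_trans[OF norm_triangle_ineq]) auto
  finally have "norm (dSg K H) \<le> k * (2 * (b * h * s * a))" .
  then have t2: "norm (E K ** dSg K H) \<le> e * (k * (2 * (b * h * s * a)))"
    unfolding e_def by (intro order_trans[OF norm_mult_le] mult_left_mono) auto
  have "norm (dgrad K H) \<le> 2 * ((spec_norm (G K) * h + b * (2 * k * e * h) * a) * s + e * (k * (2 * (b * h * s * a))))"
    unfolding dgrad_def norm_scaleR using norm_triangle_ineq t1 t2
    by (intro mult_mono order_trans[OF norm_triangle_ineq] add_mono) auto
  also have "\<dots> = 2 * spec_norm (G K) * s * h + k * (8 * s * b * a * e * h)" by (simp add: algebra_simps)
  also have "\<dots> \<le> 2 * spec_norm (G K) * s * h + s / \<mu> * (8 * s * b * a * e * h)"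
    using k nn by (intro add_left_mono mult_right_mono) auto
  also have "\<dots> = (2 * spec_norm (G K) * s + 8 * s\<^sup>2 * (b * a / \<mu>) * e) * h"
    by (simp add: power2_eq_square algebra_simps)
  finally show ?thesis by (simp add: s_def b_def a_def e_def h_def)
qed

subsection \<open>The optimal gain\<close>

lemma tendsto_mpow: "(f \<longlongrightarrow> A) F \<Longrightarrow> ((\<lambda>n. mpow (f n) t) \<longlongrightarrow> mpow A t) F" for A :: "real^'n^'n"
  by (induction t) (auto intro!: tendsto_intros)

lemma sublevel_closed: "closed {K \<in> stabilizing S. J K \<le> c}"
  unfolding closed_sequential_limits
proof (intro allI impI)
  fix f K assume "(\<forall>n. f n \<in> {K \<in> stabilizing S. J K \<le> c}) \<and> f \<longlonglongrightarrow> K"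
  then have f: "\<And>n. f n \<in> stabilizing S" "\<And>n. J (f n) \<le> c" and lim: "f \<longlonglongrightarrow> K" by auto
  have A: "(\<lambda>n. Acl (f n)) \<longlonglongrightarrow> Acl K"
    unfolding closed_loop_def by (intro tendsto_intros lim)
  have "(\<Sum>t<m. (norm (mpow (Acl K) t))\<^sup>2) \<le> c / (q * \<mu>)" for m
  proof (rule LIMSEQ_le_const2)
    show "(\<lambda>n. \<Sum>t<m. (norm (mpow (Acl (f n)) t))\<^sup>2) \<longlonglongrightarrow> (\<Sum>t<m. (norm (mpow (Acl K) t))\<^sup>2)"
      by (intro tendsto_intros tendsto_mpow A)
    have "(\<Sum>t<m. (norm (mpow (Acl (f n)) t))\<^sup>2) \<le> c / (q * \<mu>)" for n
    proof -
      have "(\<Sum>t<m. (norm (mpow (Acl (f n)) t))\<^sup>2) \<le> kap (Acl (f n))"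
        unfolding kap_def using f(1)[of n] by (intro sum_le_suminf) (auto simp: stabilizing_iff stable_def)
      also have "\<dots> \<le> J (f n) / (q * \<mu>)" by (rule kap_le[OF f(1)])
      also have "\<dots> \<le> c / (q * \<mu>)" using f(2) q_pos mu_pos by (intro divide_right_mono) auto
      finally show ?thesis .
    qed
    then show "\<exists>N. \<forall>n\<ge>N. (\<Sum>t<m. (norm (mpow (Acl (f n)) t))\<^sup>2) \<le> c / (q * \<mu>)" by blast
  qed
  then have K: "K \<in> stabilizing S"
    unfolding stabilizing_iff stable_def by (intro summableI_nonneg_bounded) auto
  have "(\<lambda>n. J (f n)) \<longlonglongrightarrow> J K" using J_cont[OF K] lim isCont_tendsto_compose by blast
  then have "J K \<le> c" using f(2) by (intro LIMSEQ_le_const2) auto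
  with K show "K \<in> {K \<in> stabilizing S. J K \<le> c}" by simp
qed

lemma sublevel_bounded: "bounded {K \<in> stabilizing S. J K \<le> c}"
proof (rule boundedI)
  fix K assume K: "K \<in> {K \<in> stabilizing S. J K \<le> c}"
  then have "r * \<mu> * (norm K)\<^sup>2 \<le> c" using norm_K[of K] by auto
  then have "(norm K)\<^sup>2 \<le> c / (r * \<mu>)" using r_pos mu_pos by (simp add: field_simps)
  then show "norm K \<le> sqrt (c / (r * \<mu>))" by (rule real_le_rsqrt)
qed

text \<open>Compactness of a sublevel set supplies a minimizer, which is what the choice operator
  behind \<open>arg_min_on\<close> needs in order to return one.\<close>

lemma
  assumes "K0 \<in> stabilizing S"
  shows opt_gain_stabilizing: "opt_gain D S \<in> stabilizing S"
    and opt_gain_le: "K \<in> stabilizing S \<Longrightarrow> J (opt_gain D S) \<le> J K"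
proof -
  let ?L = "{K \<in> stabilizing S. J K \<le> J K0}"
  have "compact ?L" using sublevel_closed sublevel_bounded by (simp add: compact_eq_bounded_closed)
  moreover have "?L \<noteq> {}" using assms by auto
  moreover have "continuous_on ?L J"
    using J_cont by (simp add: continuous_at_imp_continuous_on)
  ultimately have "\<exists>K1\<in>?L. \<forall>K\<in>?L. J K1 \<le> J K" by (rule continuous_attains_inf)
  then obtain K1 where K1: "K1 \<in> ?L" "\<forall>K\<in>?L. J K1 \<le> J K" by (rule bexE)
  have "is_arg_min J (\<lambda>K. K \<in> stabilizing S) K1"
    using K1 unfolding is_arg_min_linorder by (metis (mono_tags, lifting) mem_Collect_eq linear order_trans)
  then have "is_arg_min J (\<lambda>K. K \<in> stabilizing S) (opt_gain D S)"
    unfolding opt_gain_def arg_min_on_def arg_min_def by (rule someI)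
  then show "opt_gain D S \<in> stabilizing S" "K \<in> stabilizing S \<Longrightarrow> J (opt_gain D S) \<le> J K"
    by (auto simp: is_arg_min_linorder)
qed

lemma cost_gap_nonneg: "K \<in> stabilizing S \<Longrightarrow> 0 \<le> cost_gap D S K"
  by (simp add: cost_gap_def opt_gain_le)

lemma spec_Sg_pos: assumes K: "K \<in> stabilizing S" shows "0 < spec_norm (Sg K)"
proof -
  obtain v :: "real^'x" where v: "norm v = 1" using vector_choose_size[of 1] by auto
  have "\<mu> \<le> v \<bullet> (Sg K *v v)" using Sg_ge[OF K, of v] v by simp
  also have "\<dots> \<le> spec_norm (Sg K)" using quad_le[of v "Sg K"] v by simp
  finally show ?thesis using mu_pos by simp
qed

lemma lambda_pos: "K \<in> stabilizing S \<Longrightarrow> 0 < lambda_task D \<mu> S"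
  using spec_Sg_pos[OF opt_gain_stabilizing] r_pos mu_pos
  by (simp add: lambda_task_def state_cov_eq[OF opt_gain_stabilizing])

text \<open>The covariance is at least \<mu> I, so the gradient 2 E \<open>Sg K\<close> has norm at
  least 2 \<mu> times that of E; squared, this is the factor 4 \<mu>^2 of
  \<open>lambda_task\<close>.\<close>

lemma gradient_dominance:
  assumes K: "K \<in> stabilizing S"
  shows "lambda_task D \<mu> S * cost_gap D S K \<le> (norm (gradient J K))\<^sup>2"
proof -
  let ?s = "spec_norm (Sg (opt_gain D S))"
  have s: "0 < ?s" by (rule spec_Sg_pos[OF opt_gain_stabilizing[OF K]])
  have "r * cost_gap D S K \<le> ?s * (norm (E K))\<^sup>2"
    unfolding cost_gap_def by (rule cost_gap_le[OF K opt_gain_stabilizing[OF K]])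
  then have "4 * \<mu>\<^sup>2 * (r * cost_gap D S K) \<le> 4 * \<mu>\<^sup>2 * (?s * (norm (E K))\<^sup>2)"
    by (intro mult_left_mono) auto
  then have "lambda_task D \<mu> S * cost_gap D S K \<le> (2 * (\<mu> * norm (E K)))\<^sup>2"
    using s by (simp add: lambda_task_def state_cov_eq[OF opt_gain_stabilizing[OF K]] field_simps)
  also have "\<dots> \<le> (norm (gradient J K))\<^sup>2"
    using norm_mult_ge[OF Sg_sym[OF K] Sg_ge[OF K], of "E K"] mu_pos
    by (intro power_mono) (auto simp: gradient_cost[OF K])
  finally show ?thesis .
qed

lemma gradient_zero:
  assumes K: "K \<in> stabilizing S" and gap: "cost_gap D S K \<le> 0"
  shows "gradient J K = 0"
proof -
  have "(J has_derivative (\<lambda>H. H \<bullet> gradient J K)) (at K)"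
    using GDERIV_cost[OF K] by (simp add: gderiv_def gradient_cost[OF K])
  moreover obtain e where e: "e > 0" "ball K e \<subseteq> stabilizing S"
    using open_stabilizing K open_contains_ball by blast
  moreover have "J K \<le> J K'" if "K' \<in> stabilizing S" for K'
    using gap opt_gain_le[OF K that] by (simp add: cost_gap_def)
  ultimately have "(\<lambda>H. H \<bullet> gradient J K) = (\<lambda>H. 0)"
    by (intro differential_zero_maxmin[of K "ball K e" J]) auto
  then show ?thesis by (metis inner_eq_zero_iff)
qed

end

subsection \<open>Several tasks\<close>

lemma max_norm_ge: "i \<in> {1..M} \<Longrightarrow> spec_norm (X i) \<le> max_norm M X"
  unfolding max_norm_def by (intro Max_ge) auto

lemma max_norm_leI: "M \<ge> 1 \<Longrightarrow> (\<And>i. i \<in> {1..M} \<Longrightarrow> spec_norm (X i) \<le> c) \<Longrightarrow> max_norm M X \<le> c"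
  unfolding max_norm_def by (subst Max_le_iff) auto

lemma max_norm_nonneg: "M \<ge> 1 \<Longrightarrow> 0 \<le> max_norm M X"
  by (rule order_trans[OF spec_norm_nonneg max_norm_ge[of 1]]) simp

locale multi_lqr =
  fixes D :: "(real^'x::finite) measure" and M :: nat
    and T :: "nat \<Rightarrow> ('x, 'u::finite) lqr_task" and \<mu> :: real
    and \<gamma> :: "nat \<Rightarrow> real" and K0 :: "real^'x^'u"
  assumes M: "M \<ge> 1"
    and task: "\<And>i. i \<in> {1..M} \<Longrightarrow> lqr D (T i) \<mu>"
    and K0_mem: "K0 \<in> S_ML D M T \<gamma> K0"
begin

abbreviation "SS \<equiv> S_ML D M T \<gamma> K0"
abbreviation "J i \<equiv> cost D (T i)"
abbreviation "Jm \<equiv> J_max D M T"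
abbreviation "sQ \<equiv> sigma_Q M T"
abbreviation "bA \<equiv> max_norm M (\<lambda>i. Amat (T i))"
abbreviation "bB \<equiv> max_norm M (\<lambda>i. Bmat (T i))"
abbreviation "bQ \<equiv> max_norm M (\<lambda>i. Qmat (T i))"
abbreviation "bR \<equiv> max_norm M (\<lambda>i. Rmat (T i))"
abbreviation "bAcl K \<equiv> max_norm M (\<lambda>i. closed_loop (T i) K)"
abbreviation "bP K \<equiv> max_norm M (\<lambda>i. lyap (T i) K)"
abbreviation "gap i \<equiv> cost_gap D (T i)"
abbreviation "L \<equiv> sup_on SS (h_grad D M T \<mu>)"

lemma mu_pos: "0 < \<mu>"
  using task[of 1] M by (simp add: lqr_def)

lemma bounds_nonneg: "0 \<le> bA" "0 \<le> bB" "0 \<le> bQ" "0 \<le> bR"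
  by (simp_all add: max_norm_nonneg[OF M])

lemma bAcl_nonneg: "0 \<le> bAcl K" "0 \<le> bAcl K + 1"
  using max_norm_nonneg[OF M, of "\<lambda>i. closed_loop (T i) K"] by simp_all

lemma S_iff: "K \<in> SS \<longleftrightarrow> (\<forall>i\<in>{1..M}. K \<in> stabilizing (T i) \<and> gap i K \<le> \<gamma> i * gap i K0)"
  by (auto simp: S_ML_def sublevel_def)

lemma S_stabilizing: "K \<in> SS \<Longrightarrow> i \<in> {1..M} \<Longrightarrow> K \<in> stabilizing (T i)"
  by (simp add: S_iff)

lemma K0_stabilizing: "i \<in> {1..M} \<Longrightarrow> K0 \<in> stabilizing (T i)"
  using K0_mem by (rule S_stabilizing)

lemma closed_S: "closed SS"
proof -
  have "sublevel D (T i) c K0 = {K \<in> stabilizing (T i). J i K \<le> J i (opt_gain D (T i)) + c * gap i K0}" for i c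
    by (auto simp: sublevel_def cost_gap_def[of _ _ "_::real^'x^'u"])
  then show ?thesis
    unfolding S_ML_def using lqr.sublevel_closed[OF task] by (intro closed_INT ballI) simp
qed

section \<open>Single-task quantities against the constants common to all tasks\<close>

lemma sQ_le: "i \<in> {1..M} \<Longrightarrow> sQ \<le> sigma_min (Qmat (T i))"
  unfolding sigma_Q_def by (intro Min_le) auto

lemma sQ_pos: "0 < sQ"
  unfolding sigma_Q_def using M by (subst Min_gr_iff) (auto intro: lqr.q_pos[OF task])

lemma J_le_Jm: "i \<in> {1..M} \<Longrightarrow> J i K \<le> Jm K"
  unfolding J_max_def by (intro Max_ge) auto

lemma Jm_ge: "K \<in> SS \<Longrightarrow> sQ * \<mu> \<le> Jm K"
proof -
  assume K: "K \<in> SS"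
  have 1: "1 \<in> {1..M}" using M by simp
  have "sQ * \<mu> \<le> sigma_min (Qmat (T 1)) * \<mu>" using sQ_le[OF 1] mu_pos by (intro mult_right_mono) auto
  also have "\<dots> \<le> J 1 K" by (rule lqr.J_ge[OF task[OF 1] S_stabilizing[OF K 1]])
  finally show ?thesis using J_le_Jm[OF 1, of K] by simp
qed

lemma Jm_pos: "K \<in> SS \<Longrightarrow> 0 < Jm K"
  using Jm_ge sQ_pos mu_pos by (meson less_le_trans mult_pos_pos)

lemma J_div_le:
  assumes K: "K \<in> SS" and i: "i \<in> {1..M}"
  shows "J i K / sigma_min (Qmat (T i)) \<le> Jm K / sQ"
  using sQ_pos sQ_le[OF i] J_le_Jm[OF i, of K] lqr.J_pos[OF task[OF i] S_stabilizing[OF K i]]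
  by (intro frac_le) auto

lemma kap_le_nu:
  assumes K: "K \<in> SS" and i: "i \<in> {1..M}"
  shows "kap (closed_loop (T i) K) \<le> nu D M T \<mu> K"
proof -
  have "kap (closed_loop (T i) K) \<le> J i K / sigma_min (Qmat (T i)) / \<mu>"
    using lqr.kap_le[OF task[OF i] S_stabilizing[OF K i]] by simp
  also have "\<dots> \<le> Jm K / sQ / \<mu>" using J_div_le[OF K i] mu_pos by (intro divide_right_mono) auto
  finally show ?thesis by (simp add: nu_def)
qed

lemma norm_P_le:
  assumes K: "K \<in> SS" and i: "i \<in> {1..M}"
  shows "spec_norm (lyap (T i) K) \<le> Jm K / \<mu>"
  using lqr.spec_P[OF task[OF i] S_stabilizing[OF K i]] J_le_Jm[OF i, of K] mu_pos
  by (meson divide_right_mono less_imp_le order_trans)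

lemma norm_G_le:
  assumes K: "K \<in> SS" and i: "i \<in> {1..M}"
  shows "spec_norm (Rmat (T i) + transpose (Bmat (T i)) ** lyap (T i) K ** Bmat (T i)) \<le> bR + bB\<^sup>2 * (Jm K / \<mu>)"
proof -
  have "spec_norm (transpose (Bmat (T i)) ** lyap (T i) K ** Bmat (T i))
      \<le> (spec_norm (Bmat (T i)) * spec_norm (lyap (T i) K)) * spec_norm (Bmat (T i))"
    using spec_norm_mult[of "transpose (Bmat (T i))" "lyap (T i) K"]
    by (intro order_trans[OF spec_norm_mult] mult_right_mono) auto
  also have "\<dots> \<le> (bB * (Jm K / \<mu>)) * bB"
    using max_norm_ge[OF i, of "\<lambda>i. Bmat (T i)"] norm_P_le[OF K i] Jm_pos[OF K] mu_pos bounds_nonneg bAcl_nonneg[of K]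
    by (intro mult_mono) auto
  also have "\<dots> = bB\<^sup>2 * (Jm K / \<mu>)" by (simp add: power2_eq_square)
  finally show ?thesis
    using spec_norm_add[of "Rmat (T i)" "transpose (Bmat (T i)) ** lyap (T i) K ** Bmat (T i)"]
      max_norm_ge[OF i, of "\<lambda>i. Rmat (T i)"] by linarith
qed

lemma trace_cov_nonneg: "0 \<le> trace (init_cov D)"
proof -
  have "psd (init_cov D)" using lqr.S0_psd[OF task[of 1]] M by simp
  then show ?thesis using psd_norm_le_trace norm_ge_zero order_trans by blast
qed

lemma h_Delta_nonneg: "K \<in> SS \<Longrightarrow> 0 \<le> h_Delta D M T \<mu> K"
proof -
  assume K: "K \<in> SS"
  have "0 \<le> sigma_min (Qmat (T 1))" using lqr.q_pos[OF task[of 1]] M by simp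
  also have "\<dots> \<le> (MAX i\<in>{1..M}. sigma_min (Qmat (T i)))" using M by (intro Max_ge) auto
  finally show ?thesis
    unfolding h_Delta_def using mu_pos Jm_pos[OF K] bounds_nonneg bAcl_nonneg[of K]
    by (intro divide_nonneg_nonneg mult_nonneg_nonneg) (auto simp: less_imp_le)
qed

lemma nu_nonneg: "K \<in> SS \<Longrightarrow> 0 \<le> nu D M T \<mu> K"
  unfolding nu_def using Jm_pos sQ_pos mu_pos by (intro divide_nonneg_pos) (auto simp: less_imp_le)

lemma h_cost_nonneg: "K \<in> SS \<Longrightarrow> 0 \<le> h_cost D M T \<mu> K"
  unfolding h_cost_def
  using mu_pos Jm_pos[of K] bounds_nonneg bAcl_nonneg[of K] sQ_pos trace_cov_nonneg h_Delta_nonneg[of K] nu_nonneg[of K]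
  by (intro mult_nonneg_nonneg divide_nonneg_nonneg add_nonneg_nonneg) (auto simp: less_imp_le)

lemma norm_E_le_h_0:
  assumes K: "K \<in> SS" and i: "i \<in> {1..M}"
  shows "norm (lqr.E (T i) K) \<le> h_0 D M T \<mu> K"
proof -
  interpret l: lqr D "T i" \<mu> by (rule task[OF i])
  have st: "K \<in> stabilizing (T i)" by (rule S_stabilizing[OF K i])
  have "(norm (l.E K))\<^sup>2 \<le> spec_norm (l.G K) * (J i K - J i (opt_gain D (T i))) / \<mu>"
    by (rule l.norm_E_sq[OF st l.opt_gain_le[OF st]])
  also have "\<dots> \<le> max_norm M (\<lambda>i. Rmat (T i) + transpose (Bmat (T i)) ** lyap (T i) K ** Bmat (T i)) * (Jm K - J_min D M T) / \<mu>"
  proof (intro divide_right_mono mult_mono diff_mono J_le_Jm i)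
    show "spec_norm (l.G K) \<le> max_norm M (\<lambda>i. Rmat (T i) + transpose (Bmat (T i)) ** lyap (T i) K ** Bmat (T i))"
      unfolding l.G_def by (rule max_norm_ge[OF i])
    show "J_min D M T \<le> J i (opt_gain D (T i))"
      unfolding J_min_def using i by (intro Min_le) auto
  qed (use max_norm_nonneg[OF M] mu_pos l.cost_gap_nonneg[OF st] in \<open>auto simp: cost_gap_def\<close>)
  finally show ?thesis unfolding h_0_def by (rule real_le_rsqrt)
qed

lemma h_0_nonneg: "K \<in> SS \<Longrightarrow> 0 \<le> h_0 D M T \<mu> K"
  using order_trans[OF norm_ge_zero norm_E_le_h_0[of K 1]] M by simp

text \<open>Each factor of the single-task Hessian bound is replaced by its extremum over the tasks;
  all summands of \<open>h_grad\<close> are nonnegative, so a termwise comparison suffices.\<close>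

lemma norm_dgrad_le:
  assumes K: "K \<in> SS" and i: "i \<in> {1..M}"
  shows "norm (lqr.dgrad D (T i) K H) \<le> h_grad D M T \<mu> K * norm H"
proof -
  interpret l: lqr D "T i" \<mu> by (rule task[OF i])
  have st: "K \<in> stabilizing (T i)" by (rule S_stabilizing[OF K i])
  define s where "s = Jm K / sQ"
  have s: "0 \<le> s" using Jm_pos[OF K] sQ_pos by (simp add: s_def)
  have si: "J i K / l.q \<le> s" "0 \<le> J i K / l.q"
    using J_div_le[OF K i] l.J_pos[OF st] l.q_pos by (simp_all add: s_def)
  note nn = bounds_nonneg bAcl_nonneg[of K]
  have 1: "2 * spec_norm (l.G K) * (J i K / l.q) \<le> 2 * (bR + bB\<^sup>2 * (Jm K / \<mu>)) * s"
    using norm_G_le[OF K i] si nn Jm_pos[OF K] mu_pos unfolding l.G_def by (intro mult_mono) auto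
  have 2: "8 * (J i K / l.q)\<^sup>2 * (spec_norm (Bmat (T i)) * spec_norm (closed_loop (T i) K) / \<mu>) * norm (l.E K)
      \<le> 8 * s\<^sup>2 * (bB * (bAcl K + 1) / \<mu>) * h_0 D M T \<mu> K"
    using si s nn mu_pos max_norm_ge[OF i, of "\<lambda>i. Bmat (T i)"] max_norm_ge[OF i, of "\<lambda>i. closed_loop (T i) K"]
      h_0_nonneg[OF K]
    by (intro mult_mono divide_right_mono power_mono norm_E_le_h_0 K i) (auto intro: add_increasing2)
  have x: "0 \<le> bB * (bA + bB * (spec_norm K + h_Delta D M T \<mu> K)) * (h_cost D M T \<mu> K * Jm K / trace (init_cov D))"
    using nn h_Delta_nonneg[OF K] h_cost_nonneg[OF K] Jm_pos[OF K] trace_cov_nonneg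
    by (intro mult_nonneg_nonneg divide_nonneg_nonneg add_nonneg_nonneg) auto
  have "2 * (bR + bB\<^sup>2 * (Jm K / \<mu>)) * s
      \<le> 4 * s * (bR + bB * (bA + bB * (spec_norm K + h_Delta D M T \<mu> K)) * (h_cost D M T \<mu> K * Jm K / trace (init_cov D))
       + bB\<^sup>2 * (Jm K / \<mu>))"
  proof -
    have "0 \<le> bR + bB\<^sup>2 * (Jm K / \<mu>)" using nn Jm_pos[OF K] mu_pos by simp
    then have "2 * s * (bR + bB\<^sup>2 * (Jm K / \<mu>)) \<le> 4 * s * (bR + bB\<^sup>2 * (Jm K / \<mu>))"
      using s by (intro mult_right_mono) auto
    also have "\<dots> \<le> 4 * s * (bR + bB * (bA + bB * (spec_norm K + h_Delta D M T \<mu> K)) * (h_cost D M T \<mu> K * Jm K / trace (init_cov D))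
       + bB\<^sup>2 * (Jm K / \<mu>))"
      using s x by (intro mult_left_mono) auto
    finally show ?thesis by (simp add: ac_simps)
  qed
  with 1 2 have "2 * spec_norm (l.G K) * (J i K / l.q)
     + 8 * (J i K / l.q)\<^sup>2 * (spec_norm (Bmat (T i)) * spec_norm (closed_loop (T i) K) / \<mu>) * norm (l.E K) \<le> h_grad D M T \<mu> K"
    unfolding h_grad_def s_def by simp
  from mult_right_mono[OF this, of "norm H"] l.norm_dgrad[OF st, of H] show ?thesis by simp
qed

text \<open>Read off from the derivative bound in a direction of norm one, not from the
  formula.\<close>

lemma h_grad_nonneg: assumes K: "K \<in> SS" shows "0 \<le> h_grad D M T \<mu> K"
proof -
  obtain H :: "real^'x^'u" where H: "norm H = 1" using vector_choose_size[of 1] by auto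
  have "0 \<le> h_grad D M T \<mu> K * norm H"
    using norm_dgrad_le[OF K, of 1 H] M by (intro order_trans[OF norm_ge_zero]) auto
  then show ?thesis by (simp add: H)
qed

subsection \<open>Boundedness of the constants on the sublevel set\<close>

text \<open>A real supremum dominates the values only if they are bounded above. Two-sided bounds
  are used because they are closed under products and differences, so that boundedness of the
  constants follows their syntax.\<close>

definition bnd :: "(real^'x^'u \<Rightarrow> real) \<Rightarrow> bool" where
  "bnd f \<longleftrightarrow> (\<exists>C. \<forall>K\<in>SS. \<bar>f K\<bar> \<le> C)"

lemma bnd_mono: "bnd g \<Longrightarrow> (\<And>K. K \<in> SS \<Longrightarrow> \<bar>f K\<bar> \<le> g K) \<Longrightarrow> bnd f"
  unfolding bnd_def by (meson abs_le_iff order_trans)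

lemma bnd_const: "bnd (\<lambda>_. c)"
  unfolding bnd_def by blast

lemma bnd_add: "bnd f \<Longrightarrow> bnd g \<Longrightarrow> bnd (\<lambda>K. f K + g K)"
  unfolding bnd_def by (meson abs_triangle_ineq add_mono order_trans)

lemma bnd_diff: "bnd f \<Longrightarrow> bnd g \<Longrightarrow> bnd (\<lambda>K. f K - g K)"
  unfolding bnd_def by (meson abs_triangle_ineq4 add_mono order_trans)

lemma bnd_mult: "bnd f \<Longrightarrow> bnd g \<Longrightarrow> bnd (\<lambda>K. f K * g K)"
  unfolding bnd_def abs_mult by (meson abs_ge_zero mult_mono order_trans)

lemma bnd_divide: "bnd f \<Longrightarrow> bnd (\<lambda>K. f K / c)"
  unfolding divide_inverse by (intro bnd_mult bnd_const)

lemma bnd_power2: "bnd f \<Longrightarrow> bnd (\<lambda>K. (f K)\<^sup>2)"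
  unfolding power2_eq_square by (intro bnd_mult)

lemma bnd_sqrt: "bnd f \<Longrightarrow> bnd (\<lambda>K. sqrt (f K))"
  unfolding bnd_def by (metis real_sqrt_abs' real_sqrt_le_mono)

lemma bnd_Jm: "bnd Jm"
proof -
  define C where "C = (MAX i\<in>{1..M}. J i (opt_gain D (T i)) + \<gamma> i * gap i K0)"
  have "Jm K \<le> C" if K: "K \<in> SS" for K
  proof -
    have "J i K \<le> C" if i: "i \<in> {1..M}" for i
    proof -
      have "gap i K \<le> \<gamma> i * gap i K0" using K i by (simp add: S_iff)
      then have "J i K \<le> J i (opt_gain D (T i)) + \<gamma> i * gap i K0"
        by (simp add: cost_gap_def[of D "T i" K])
      also have "\<dots> \<le> C" unfolding C_def using i by (intro Max_ge) auto
      finally show ?thesis .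
    qed
    then show ?thesis unfolding J_max_def using M by (subst Max_le_iff) auto
  qed
  then show ?thesis
    using Jm_pos unfolding bnd_def by (metis abs_of_pos)
qed

lemma bnd_spec_norm: "bnd spec_norm"
proof -
  have 1: "1 \<in> {1..M}" using M by simp
  obtain c where c: "\<And>K. K \<in> SS \<Longrightarrow> \<bar>Jm K\<bar> \<le> c" using bnd_Jm by (auto simp: bnd_def)
  have "SS \<subseteq> {K \<in> stabilizing (T 1). J 1 K \<le> c}"
    using S_stabilizing[OF _ 1] J_le_Jm[OF 1] c by (force intro: order_trans)
  then have "bounded SS" using lqr.sublevel_bounded[OF task[OF 1]] bounded_subset by blast
  then obtain B where "\<And>K. K \<in> SS \<Longrightarrow> norm K \<le> B" by (auto simp: bounded_iff)
  then show ?thesis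
    unfolding bnd_def using spec_norm_le_norm order_trans by (metis abs_of_nonneg spec_norm_nonneg)
qed

lemma bnd_bAcl: "bnd bAcl"
proof (rule bnd_mono)
  show "bnd (\<lambda>K. bA + bB * spec_norm K)" by (intro bnd_add bnd_mult bnd_const bnd_spec_norm)
  fix K
  have "spec_norm (closed_loop (T i) K) \<le> bA + bB * spec_norm K" if i: "i \<in> {1..M}" for i
  proof -
    have "spec_norm (closed_loop (T i) K) \<le> spec_norm (Amat (T i)) + spec_norm (Bmat (T i)) * spec_norm K"
      unfolding closed_loop_def by (intro order_trans[OF spec_norm_diff] add_left_mono spec_norm_mult)
    also have "\<dots> \<le> bA + bB * spec_norm K"
      by (intro add_mono mult_right_mono max_norm_ge[OF i]) auto
    finally show ?thesis .
  qed
  then show "\<bar>bAcl K\<bar> \<le> bA + bB * spec_norm K"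
    unfolding abs_of_nonneg[OF bAcl_nonneg(1)] by (rule max_norm_leI[OF M])
qed

lemma bnd_bP: "bnd bP"
  by (rule bnd_mono[where g = "\<lambda>K. Jm K / \<mu>"])
    (auto intro!: bnd_divide bnd_Jm max_norm_leI[OF M] norm_P_le simp: max_norm_nonneg[OF M])

lemma bnd_bG: "bnd (\<lambda>K. max_norm M (\<lambda>i. Rmat (T i) + transpose (Bmat (T i)) ** lyap (T i) K ** Bmat (T i)))"
  by (rule bnd_mono[where g = "\<lambda>K. bR + bB\<^sup>2 * (Jm K / \<mu>)"])
    (auto intro!: bnd_add bnd_mult bnd_const bnd_divide bnd_Jm max_norm_leI[OF M] norm_G_le
      simp: max_norm_nonneg[OF M] simp del: times_divide_eq_right)

text \<open>Here the cost stands in the denominator, so the lower bound \<open>Jm_ge\<close> is what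
  counts. If \<open>bB\<close> is zero, division by zero makes the function vanish.\<close>

lemma bnd_h_Delta: "bnd (h_Delta D M T \<mu>)"
proof (cases "bB = 0")
  case True
  then show ?thesis by (auto simp: h_Delta_def bnd_def)
next
  case False
  then have b: "0 < bB" using bounds_nonneg(2) by (simp add: less_eq_real_def)
  define a where "a = (MAX i\<in>{1..M}. sigma_min (Qmat (T i))) * \<mu>"
  have "0 \<le> sigma_min (Qmat (T 1))" using lqr.q_pos[OF task[of 1]] M by simp
  also have "\<dots> \<le> (MAX i\<in>{1..M}. sigma_min (Qmat (T i)))" using M by (intro Max_ge) auto
  finally have a: "0 \<le> a" using mu_pos by (simp add: a_def)
  show ?thesis
  proof (rule bnd_mono[OF bnd_const[of "a / (4 * bB * (sQ * \<mu>) * 1)"]])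
    fix K assume K: "K \<in> SS"
    have "h_Delta D M T \<mu> K \<le> a / (4 * bB * (sQ * \<mu>) * 1)"
      unfolding h_Delta_def a_def[symmetric]
      using a b sQ_pos mu_pos Jm_ge[OF K] bAcl_nonneg(1)[of K]
      by (intro divide_left_mono mult_mono) (auto intro!: mult_pos_pos add_nonneg_pos mult_nonneg_nonneg simp: Jm_pos[OF K] less_imp_le)
    then show "\<bar>h_Delta D M T \<mu> K\<bar> \<le> a / (4 * bB * (sQ * \<mu>) * 1)" using h_Delta_nonneg[OF K] by simp
  qed
qed

lemmas bnd_intros = bnd_add bnd_diff bnd_mult bnd_const bnd_divide bnd_power2 bnd_sqrt bnd_Jm
  bnd_spec_norm bnd_bAcl bnd_bP bnd_bG bnd_h_Delta

lemma bnd_nu: "bnd (nu D M T \<mu>)"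
  unfolding nu_def by (intro bnd_intros)

lemma bnd_h_grad: "bnd (h_grad D M T \<mu>)"
  unfolding h_grad_def h_0_def h_cost_def by (intro bnd_intros bnd_nu)

lemma bnd_f_het: "bnd (f_het D M T \<mu> \<epsilon>)"
  unfolding f_het_def h_het1_def h_het2_def h_het3_def h_het4_def e_het_def q_het_def
  by (intro bnd_intros bnd_nu)

lemma le_sup_on: "bnd h \<Longrightarrow> K \<in> SS \<Longrightarrow> h K \<le> sup_on SS h"
  unfolding sup_on_def bnd_def by (intro cSUP_upper) (auto simp: bdd_above_def intro: abs_le_D1)

lemma h_grad_le: "K \<in> SS \<Longrightarrow> h_grad D M T \<mu> K \<le> L"
  by (rule le_sup_on[OF bnd_h_grad])

lemma L_nonneg: "0 \<le> L"
  using h_grad_le[OF K0_mem] h_grad_nonneg[OF K0_mem] by linarith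

end

subsection \<open>Heterogeneity\<close>

lemma spec_norm_mult_bound:
  fixes X :: "real^'n^'m" and Y :: "real^'p^'n"
  assumes "spec_norm X \<le> x" "spec_norm Y \<le> y"
  shows "spec_norm (X ** Y) \<le> x * y"
  using assms order_trans[OF spec_norm_nonneg[of X] assms(1)]
  by (intro order_trans[OF spec_norm_mult] mult_mono) auto

lemma spec_norm_sandwich_diff:
  fixes A A' Y :: "real^'n^'n"
  assumes A: "spec_norm A \<le> \<alpha>" and A': "spec_norm A' \<le> \<alpha>"
    and d: "spec_norm (A - A') \<le> a" and y: "spec_norm Y \<le> y"
  shows "spec_norm (transpose A ** Y ** A - transpose A' ** Y ** A') \<le> 2 * \<alpha> * y * a"
proof -
  have "transpose A ** Y ** A - transpose A' ** Y ** A'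
      = transpose (A - A') ** Y ** A + transpose A' ** Y ** (A - A')"
    by (simp add: mat_distribs)
  also have "spec_norm \<dots> \<le> a * y * \<alpha> + \<alpha> * y * a"
    using assms by (intro order_trans[OF spec_norm_add] add_mono spec_norm_mult_bound) simp_all
  finally show ?thesis by (simp add: ac_simps)
qed

context multi_lqr
begin

lemma f_het_nonneg:
  assumes K: "K \<in> SS" and \<epsilon>: "\<And>k. k \<in> {1..4} \<Longrightarrow> 0 \<le> \<epsilon> k"
  shows "0 \<le> f_het D M T \<mu> \<epsilon> K"
proof -
  have p: "0 \<le> Jm K / sQ" using Jm_pos[OF K] sQ_pos by simp
  have e: "0 \<le> e_het D M T \<mu> K"
    unfolding e_het_def using bounds_nonneg Jm_pos[OF K] mu_pos
    by (intro add_nonneg_nonneg divide_nonneg_nonneg mult_nonneg_nonneg) auto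
  have q: "0 \<le> q_het M T K" unfolding q_het_def using bounds_nonneg by simp
  note nn = p e q bounds_nonneg bAcl_nonneg(1)[of K] nu_nonneg[OF K] max_norm_nonneg[OF M, of "\<lambda>i. lyap (T i) K"]
  have "0 \<le> h_het1 D M T \<mu> K" unfolding h_het1_def using nn
    by (intro mult_nonneg_nonneg add_nonneg_nonneg) auto
  moreover have "0 \<le> h_het2 D M T \<mu> K" unfolding h_het2_def using nn
    by (intro mult_nonneg_nonneg add_nonneg_nonneg) auto
  moreover have "0 \<le> h_het3 D M T \<mu> K" unfolding h_het3_def using nn
    by (intro mult_nonneg_nonneg add_nonneg_nonneg) auto
  moreover have "0 \<le> h_het4 D M T \<mu> K" unfolding h_het4_def using nn
    by (intro mult_nonneg_nonneg add_nonneg_nonneg) auto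
  ultimately show ?thesis unfolding f_het_def using \<epsilon>[of 1] \<epsilon>[of 2] \<epsilon>[of 3] \<epsilon>[of 4]
    by (intro add_nonneg_nonneg mult_nonneg_nonneg) auto
qed

text \<open>With K fixed, \<open>lyap\<close> and the covariance of task j serve as trial solutions
  in the equations of task i, and their residuals are small. The difference of two products E
  \<open>Sg\<close> is then split so that the covariance of task i and the matrix E of task j remain
  undifferenced.\<close>

lemma gradient_heterogeneity:
  assumes K: "K \<in> SS" and i: "i \<in> {1..M}" and j: "j \<in> {1..M}"
    and dA: "spec_norm (Amat (T i) - Amat (T j)) \<le> \<epsilon> 1"
    and dB: "spec_norm (Bmat (T i) - Bmat (T j)) \<le> \<epsilon> 2"
    and dQ: "spec_norm (Qmat (T i) - Qmat (T j)) \<le> \<epsilon> 3"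
    and dR: "spec_norm (Rmat (T i) - Rmat (T j)) \<le> \<epsilon> 4"
  shows "spec_norm (gradient (J i) K - gradient (J j) K) \<le> f_het D M T \<mu> \<epsilon> K"
proof -
  interpret li: lqr D "T i" \<mu> by (rule task[OF i])
  interpret lj: lqr D "T j" \<mu> by (rule task[OF j])
  have sti: "K \<in> stabilizing (T i)" and stj: "K \<in> stabilizing (T j)"
    using S_stabilizing[OF K] i j by auto
  define k s \<nu> qq e s0 where "k = spec_norm K" and "s = Jm K / sQ" and "\<nu> = nu D M T \<mu> K"
    and "qq = q_het M T K" and "e = e_het D M T \<mu> K" and "s0 = spec_norm (init_cov D)"
  define \<beta> \<alpha> p where "\<beta> = bB" and "\<alpha> = bAcl K" and "p = bP K"
  \<comment> \<open>The difference of the two closed loops, through which the first two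
    heterogeneity parameters enter the Lyapunov residuals.\<close>
  define a where "a = \<epsilon> 1 + \<epsilon> 2 * k"
  have \<epsilon>: "0 \<le> \<epsilon> 1" "0 \<le> \<epsilon> 2" "0 \<le> \<epsilon> 3" "0 \<le> \<epsilon> 4"
    using dA dB dQ dR by (meson order_trans spec_norm_nonneg)+
  have nn: "0 \<le> k" "0 \<le> s" "0 \<le> \<nu>" "0 \<le> qq" "0 \<le> e" "0 \<le> s0" "0 \<le> \<beta>" "0 \<le> \<alpha>" "0 \<le> p" "0 \<le> a"
    using Jm_pos[OF K] sQ_pos nu_nonneg[OF K] bounds_nonneg bAcl_nonneg(1)[of K] mu_pos \<epsilon>
      max_norm_nonneg[OF M, of "\<lambda>i. lyap (T i) K"]
    by (auto simp: k_def s_def \<nu>_def qq_def q_het_def e_def e_het_def s0_def \<beta>_def \<alpha>_def p_def a_def)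
  have B: "spec_norm (Bmat (T n)) \<le> \<beta>" and Acl: "spec_norm (closed_loop (T n) K) \<le> \<alpha>"
    and P: "spec_norm (lyap (T n) K) \<le> p" if "n \<in> {1..M}" for n
    using max_norm_ge[OF that, of "\<lambda>i. Bmat (T i)"] max_norm_ge[OF that, of "\<lambda>i. closed_loop (T i) K"]
      max_norm_ge[OF that, of "\<lambda>i. lyap (T i) K"] by (simp_all add: \<beta>_def \<alpha>_def p_def)
  have sA: "stable (closed_loop (T i) K)" "stable (closed_loop (T j) K)"
    using sti stj by (simp_all add: stabilizing_iff)
  have kap: "kap (closed_loop (T i) K) \<le> \<nu>" "kap (closed_loop (T j) K) \<le> \<nu>"
    using kap_le_nu[OF K] i j by (simp_all add: \<nu>_def)
  have dlyap_i: "spec_norm (dlyap A X) \<le> \<nu> * x"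
    if "stable A" "kap A \<le> \<nu>" "spec_norm X \<le> x" for A X :: "real^'x^'x" and x
    using that spec_norm_nonneg[of X] kap_nonneg[of A]
    by (intro order_trans[OF dlyap_spec_norm] mult_mono) auto
  have k: "spec_norm K \<le> k" "spec_norm (transpose K) \<le> k" by (simp_all add: k_def)
  have dAcl: "spec_norm (closed_loop (T i) K - closed_loop (T j) K) \<le> a"
  proof -
    have "closed_loop (T i) K - closed_loop (T j) K
        = (Amat (T i) - Amat (T j)) - (Bmat (T i) - Bmat (T j)) ** K"
      by (simp add: closed_loop_def mat_distribs)
    then show ?thesis
      unfolding a_def using dA spec_norm_mult_bound[OF dB k(1)]
      by (simp add: order_trans[OF spec_norm_diff])
  qed
  have Wj: "spec_norm (stage_weight (T j) K) \<le> qq"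
  proof -
    have "spec_norm (stage_weight (T j) K) \<le> spec_norm (Qmat (T j)) + spec_norm (transpose K ** Rmat (T j) ** K)"
      unfolding stage_weight_def by (rule spec_norm_add)
    also have "\<dots> \<le> bQ + k * bR * k"
      by (intro add_mono spec_norm_mult_bound k max_norm_ge j)
    finally show ?thesis by (simp add: qq_def q_het_def k_def power2_eq_square ac_simps)
  qed
  have Pj: "spec_norm (lyap (T j) K) \<le> \<nu> * qq"
    unfolding lyap_eq[OF stj] by (intro dlyap_i sA kap Wj)
  have dP: "spec_norm (lyap (T i) K - lyap (T j) K) \<le> \<nu> * (\<epsilon> 3 + k * \<epsilon> 4 * k + 2 * \<alpha> * (\<nu> * qq) * a)"
  proof -
    let ?P = "lyap (T j) K"
    have Wd: "stage_weight (T i) K - stage_weight (T j) K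
        = (Qmat (T i) - Qmat (T j)) + transpose K ** (Rmat (T i) - Rmat (T j)) ** K"
      by (simp add: stage_weight_def mat_distribs)
    have "lyap (T i) K - ?P = dlyap (closed_loop (T i) K)
        (stage_weight (T i) K + transpose (closed_loop (T i) K) ** ?P ** closed_loop (T i) K - ?P)"
      unfolding lyap_eq[OF sti] by (rule dlyap_shift[OF sA(1)])
    also have "stage_weight (T i) K + transpose (closed_loop (T i) K) ** ?P ** closed_loop (T i) K - ?P
      = (stage_weight (T i) K - stage_weight (T j) K)
        + (transpose (closed_loop (T i) K) ** ?P ** closed_loop (T i) K
          - transpose (closed_loop (T j) K) ** ?P ** closed_loop (T j) K)"
      by (subst (2) lj.P_fix[OF stj]) (simp add: algebra_simps)
    finally show ?thesis
      unfolding Wd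
      by (auto intro!: dlyap_i sA kap order_trans[OF spec_norm_add] add_mono spec_norm_mult_bound
          dQ dR k spec_norm_sandwich_diff Acl i j dAcl Pj)
  qed
  have Sgj: "spec_norm (lj.Sg K) \<le> \<nu> * s0"
    unfolding lj.Sg_def by (intro dlyap_i) (use sA kap in \<open>simp_all add: s0_def\<close>)
  have Sgi: "spec_norm (li.Sg K) \<le> s"
    using spec_norm_le_norm[of "li.Sg K"] li.norm_Sg[OF sti] J_div_le[OF K i] by (simp add: s_def)
  have dSg: "spec_norm (li.Sg K - lj.Sg K) \<le> \<nu> * (2 * \<alpha> * (\<nu> * s0) * a)"
  proof -
    let ?A = "\<lambda>n. transpose (closed_loop (T n) K)" and ?S = "lj.Sg K"
    have "li.Sg K - ?S = dlyap (?A i) (init_cov D + transpose (?A i) ** ?S ** ?A i - ?S)"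
      unfolding li.Sg_def by (rule dlyap_shift) (simp add: sA)
    also have "init_cov D + transpose (?A i) ** ?S ** ?A i - ?S
        = transpose (?A i) ** ?S ** ?A i - transpose (?A j) ** ?S ** ?A j"
      using dlyap_fixpoint[of "?A j" "init_cov D"] sA by (simp add: lj.Sg_def[symmetric] algebra_simps)
    finally show ?thesis
      using dAcl Acl i j sA kap Sgj spec_norm_transpose[of "closed_loop (T i) K - closed_loop (T j) K"]
      by (simp only:) (intro dlyap_i spec_norm_sandwich_diff, simp_all add: transpose_diff)
  qed
  have dE: "spec_norm (li.E K - lj.E K) \<le> \<epsilon> 4 * k + (\<epsilon> 2 * p * \<alpha>
      + \<beta> * (\<nu> * (\<epsilon> 3 + k * \<epsilon> 4 * k + 2 * \<alpha> * (\<nu> * qq) * a)) * \<alpha> + \<beta> * p * a)"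
  proof -
    have "li.E K - lj.E K = (Rmat (T i) - Rmat (T j)) ** K
      - (transpose (Bmat (T i) - Bmat (T j)) ** lyap (T i) K ** closed_loop (T i) K
        + transpose (Bmat (T j)) ** (lyap (T i) K - lyap (T j) K) ** closed_loop (T i) K
        + transpose (Bmat (T j)) ** lyap (T j) K ** (closed_loop (T i) K - closed_loop (T j) K))"
      by (simp add: li.E_def lj.E_def mat_distribs)
    also have "spec_norm \<dots> \<le> \<epsilon> 4 * k + (\<epsilon> 2 * p * \<alpha>
      + \<beta> * (\<nu> * (\<epsilon> 3 + k * \<epsilon> 4 * k + 2 * \<alpha> * (\<nu> * qq) * a)) * \<alpha> + \<beta> * p * a)"
      using dB B[OF j]
      by (intro order_trans[OF spec_norm_diff] order_trans[OF spec_norm_add] add_mono spec_norm_mult_bound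
          dR k P Acl dP dAcl i j) simp_all
    finally show ?thesis .
  qed
  have Ej: "spec_norm (lj.E K) \<le> e"
  proof -
    have "lj.E K = Rmat (T j) ** K + (transpose (Bmat (T j)) ** lyap (T j) K ** Bmat (T j) ** K
        - transpose (Bmat (T j)) ** lyap (T j) K ** Amat (T j))"
      by (simp add: lj.E_def closed_loop_def mat_distribs)
    also have "spec_norm \<dots> \<le> bR * k + (\<beta> * (Jm K / \<mu>) * \<beta> * k + \<beta> * (Jm K / \<mu>) * bA)"
      using B[OF j] by (intro order_trans[OF spec_norm_add] order_trans[OF spec_norm_diff] add_mono
          spec_norm_mult_bound k max_norm_ge j norm_P_le K) simp_all
    also have "\<dots> = e"
      using mu_pos by (simp add: e_def e_het_def k_def \<beta>_def power2_eq_square field_simps)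
    finally show ?thesis .
  qed
  have "gradient (J i) K - gradient (J j) K = 2 *\<^sub>R ((li.E K - lj.E K) ** li.Sg K + lj.E K ** (li.Sg K - lj.Sg K))"
    unfolding li.gradient_cost[OF sti] lj.gradient_cost[OF stj]
    by (simp add: mat_distribs scaleR_right_diff_distrib)
  also have "spec_norm \<dots> \<le> 2 * ((\<epsilon> 4 * k + (\<epsilon> 2 * p * \<alpha>
      + \<beta> * (\<nu> * (\<epsilon> 3 + k * \<epsilon> 4 * k + 2 * \<alpha> * (\<nu> * qq) * a)) * \<alpha> + \<beta> * p * a)) * s
      + e * (\<nu> * (2 * \<alpha> * (\<nu> * s0) * a)))"
    unfolding spec_norm_scaleR
    by (intro mult_mono order_trans[OF spec_norm_add] add_mono spec_norm_mult_bound dE Ej Sgi dSg) simp_all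
  \<comment> \<open>The estimate has coefficient 4 on the terms in \<nu>^2 and \<open>f_het\<close>
    has 8; the added amount turns the next step into an identity.\<close>
  also have "\<dots> \<le> \<dots> + 4 * a * (s * \<beta> * \<alpha>\<^sup>2 * \<nu>\<^sup>2 * qq + e * \<alpha> * \<nu>\<^sup>2 * s0)"
    using nn by simp
  also have "\<dots> = f_het D M T \<mu> \<epsilon> K"
    unfolding f_het_def h_het1_def h_het2_def h_het3_def h_het4_def
      k_def[symmetric] s_def[symmetric] \<nu>_def[symmetric] qq_def[symmetric] e_def[symmetric]
      s0_def[symmetric] \<beta>_def[symmetric] \<alpha>_def[symmetric] p_def[symmetric] a_def
    by (simp add: power2_eq_square algebra_simps)
  finally show ?thesis .
qed

end

subsection \<open>Invariance of the sublevel set\<close>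

text \<open>Continuous induction on the supremum of the times up to which the path stays inside.
  Closedness admits the supremum itself, and \<open>step\<close> carries the path past it. The step
  may assume the whole past of the path, which the gradient estimate along a segment
  requires.\<close>

lemma segment_stays:
  fixes c :: "real \<Rightarrow> 'a::topological_space"
  assumes cont: "continuous_on {0..b} c" and S: "closed S" and "0 \<le> b" and start: "c 0 \<in> S"
    and step: "\<And>s. 0 \<le> s \<Longrightarrow> s < b \<Longrightarrow> (\<And>r. 0 \<le> r \<Longrightarrow> r \<le> s \<Longrightarrow> c r \<in> S)
      \<Longrightarrow> eventually (\<lambda>r. c r \<in> S) (at_right s)"
    and s: "0 \<le> s" "s \<le> b"
  shows "c s \<in> S"
proof -
  define X where "X = {s\<in>{0..b}. \<forall>r\<in>{0..s}. c r \<in> S}"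
  define m where "m = Sup X"
  have X: "0 \<in> X" "bdd_above X" using start \<open>0 \<le> b\<close> by (auto simp: X_def bdd_above_def)
  have m0: "0 \<le> m" unfolding m_def using X by (intro cSup_upper)
  have mb: "m \<le> b" unfolding m_def using X by (intro cSup_least) (auto simp: X_def)
  have below: "c r \<in> S" if r: "0 \<le> r" "r < m" for r
  proof -
    obtain s where "s \<in> X" "r < s" using less_cSupD[of X r] X r by (auto simp: m_def)
    with r show ?thesis by (auto simp: X_def)
  qed
  have cm: "c m \<in> S"
  proof (cases "m = 0")
    case False
    with m0 have "0 < m" by simp
    have "continuous_on {0..m} c" by (rule continuous_on_subset[OF cont]) (use mb in auto)
    then have "(c \<longlongrightarrow> c m) (at m within {0..m})"
      using \<open>0 < m\<close> by (simp add: continuous_on_def)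
    then have "(c \<longlongrightarrow> c m) (at_left m)"
      by (simp only: at_within_Icc_at_left[OF \<open>0 < m\<close>])
    moreover have "eventually (\<lambda>r. c r \<in> S) (at_left m)"
      using eventually_at_left_real[OF \<open>0 < m\<close>] by eventually_elim (use below in auto)
    ultimately show ?thesis using Lim_in_closed_set[OF S] trivial_limit_at_left_real by blast
  qed (use start in simp)
  have upto: "c r \<in> S" if "0 \<le> r" "r \<le> m" for r
    using that below cm by (cases "r = m") auto
  have "m = b"
  proof (rule ccontr)
    assume "m \<noteq> b"
    then have "m < b" using mb by simp
    from step[OF m0 this upto] obtain d where d: "d > m" "\<And>r. m < r \<Longrightarrow> r < d \<Longrightarrow> c r \<in> S"
      by (auto simp: eventually_at_right_field)
    define t where "t = min b ((m + d) / 2)"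
    have t: "m < t" "t < d" "t \<le> b" using d(1) \<open>m < b\<close> by (auto simp: t_def min_def)
    have "c r \<in> S" if "0 \<le> r" "r \<le> t" for r
      using upto[of r] d(2)[of r] that t by (cases "r \<le> m") auto
    then have "t \<in> X" using t m0 by (auto simp: X_def)
    then have "t \<le> m" unfolding m_def using X by (intro cSup_upper)
    with t show False by simp
  qed
  then show ?thesis using upto s by simp
qed

text \<open>Here \<open>g\<close> is the gradient of one task at the start of a segment with direction \<open>V\<close>, \<open>w\<close> the
  gradient of that task at a point of the segment where its cost gap is extremal, and \<open>\<delta>\<close>
  the heterogeneity.\<close>

lemma inner_pos_of_close:
  fixes g w V :: "'a::real_inner"
  assumes d: "0 \<le> \<delta>" and V: "norm (V - g) \<le> norm g / 4 + 2 * \<delta>"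
    and w: "norm (w - g) \<le> norm V / 4" and w0: "0 < norm w" and wd: "16 * \<delta> \<le> norm w"
  shows "0 < w \<bullet> V"
proof -
  define G where "G = norm g"
  define p q where "p = w - g" and "q = V - g"
  have nV: "norm V \<le> 5 / 4 * G + 2 * \<delta>"
    using norm_triangle_ineq[of g "V - g"] V by (simp add: G_def)
  have p: "norm p \<le> 5 / 16 * G + \<delta> / 2" using w nV by (simp add: p_def)
  have q: "norm q \<le> G / 4 + 2 * \<delta>" using V by (simp add: q_def G_def)
  have nw: "norm w \<le> 21 / 16 * G + \<delta> / 2"
    using norm_triangle_ineq[of g "w - g"] p by (simp add: G_def p_def)
  \<comment> \<open>From 16 \<delta> <= 21/16 G + \<delta>/2; thereafter all errors are fractions of
    G, namely 63/176 for p and 19/44 for q.\<close>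
  have Gd: "11 * \<delta> \<le> G" using nw wd d by linarith
  have G0: "0 < G" using nw w0 Gd d by linarith
  have p': "norm p \<le> 63 / 176 * G" and q': "norm q \<le> 19 / 44 * G" using p q Gd by simp_all
  \<comment> \<open>The three error terms consume 19/44 + 63/176 + (63/176)(19/44) of G^2, a
    fraction of about 0.94.\<close>
  have "w \<bullet> V = G\<^sup>2 + g \<bullet> q + p \<bullet> g + p \<bullet> q"
    by (simp add: p_def q_def G_def power2_norm_eq_inner inner_diff_left inner_diff_right inner_commute)
  moreover have "\<bar>g \<bullet> q\<bar> \<le> G * (19 / 44 * G)"
    using q' G0 by (intro order_trans[OF Cauchy_Schwarz_ineq2] mult_mono) (auto simp: G_def)
  moreover have "\<bar>p \<bullet> g\<bar> \<le> (63 / 176 * G) * G"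
    using p' G0 by (intro order_trans[OF Cauchy_Schwarz_ineq2] mult_mono) (auto simp: G_def)
  moreover have "\<bar>p \<bullet> q\<bar> \<le> (63 / 176 * G) * (19 / 44 * G)"
    using p' q' G0 by (intro order_trans[OF Cauchy_Schwarz_ineq2] mult_mono) auto
  moreover have "0 < G\<^sup>2" using G0 by simp
  ultimately show ?thesis by (simp add: power2_eq_square)
qed

context multi_lqr
begin

lemma gradient_segment:
  assumes i: "i \<in> {1..M}" and seg: "\<And>r. 0 \<le> r \<Longrightarrow> r \<le> s \<Longrightarrow> K - r *\<^sub>R V \<in> SS" and s: "0 \<le> s"
  shows "norm (gradient (J i) (K - s *\<^sub>R V) - gradient (J i) K) \<le> L * s * norm V"
proof -
  interpret l: lqr D "T i" \<mu> by (rule task[OF i])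
  let ?f = "\<lambda>r. gradient (J i) (K - r *\<^sub>R V)"
  have "norm (?f s - ?f 0) \<le> (L * norm V) * norm (s - 0)"
  proof (rule differentiable_bound[where S = "{0..s}" and f' = "\<lambda>r h. l.dgrad (K - r *\<^sub>R V) (- (h *\<^sub>R V))"])
    fix r assume r: "r \<in> {0..s}"
    then have K: "K - r *\<^sub>R V \<in> SS" using seg by simp
    have "((\<lambda>r. K - r *\<^sub>R V) has_derivative (\<lambda>h. - (h *\<^sub>R V))) (at r within {0..s})"
      by (auto intro!: derivative_eq_intros)
    from has_derivative_compose[OF this l.gradient_deriv[OF S_stabilizing[OF K i]]]
    show "(?f has_derivative (\<lambda>h. l.dgrad (K - r *\<^sub>R V) (- (h *\<^sub>R V)))) (at r within {0..s})" .
    show "onorm (\<lambda>h. l.dgrad (K - r *\<^sub>R V) (- (h *\<^sub>R V))) \<le> L * norm V"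
    proof (rule onorm_le)
      fix h :: real
      have "norm (l.dgrad (K - r *\<^sub>R V) (- (h *\<^sub>R V))) \<le> h_grad D M T \<mu> (K - r *\<^sub>R V) * norm (- (h *\<^sub>R V))"
        by (rule norm_dgrad_le[OF K i])
      also have "\<dots> \<le> L * norm (- (h *\<^sub>R V))" by (intro mult_right_mono h_grad_le K) simp
      finally show "norm (l.dgrad (K - r *\<^sub>R V) (- (h *\<^sub>R V))) \<le> L * norm V * norm h"
        by (simp add: ac_simps)
    qed
  qed (use s in auto)
  then show ?thesis using s by (simp add: ac_simps)
qed

text \<open>Serves both levels of the algorithm: inner direction with step \<open>\<eta>l\<close>,
  averaged outer direction with step \<open>\<eta>\<close>. The condition on b L keeps the gradient
  along the segment within a quarter of the norm of V from its initial value.\<close>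

lemma step_stays:
  assumes K: "K \<in> SS" and \<delta>: "0 \<le> \<delta>" and b: "0 \<le> b" "b * L \<le> 1 / 4"
    and gap0: "\<And>j. j \<in> {1..M} \<Longrightarrow> 0 < gap j K0"
    and het: "\<And>j. j \<in> {1..M} \<Longrightarrow> 288 * \<delta>\<^sup>2 \<le> lambda_task D \<mu> (T j) * gap j K0"
    and V: "\<And>j. j \<in> {1..M} \<Longrightarrow> norm (V - gradient (J j) K) \<le> norm (gradient (J j) K) / 4 + 2 * \<delta>"
    and s: "0 \<le> s" "s \<le> b"
  shows "K - s *\<^sub>R V \<in> SS"
proof (rule segment_stays[where b = b and c = "\<lambda>s. K - s *\<^sub>R V", OF _ closed_S b(1) _ _ s])
  show "continuous_on {0..b} (\<lambda>s. K - s *\<^sub>R V)" by (intro continuous_intros)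
  show "K - 0 *\<^sub>R V \<in> SS" using K by simp
  fix s assume s: "0 \<le> s" "s < b" and seg: "\<And>r. 0 \<le> r \<Longrightarrow> r \<le> s \<Longrightarrow> K - r *\<^sub>R V \<in> SS"
  let ?c = "\<lambda>r. K - r *\<^sub>R V"
  have cs: "?c s \<in> SS" using seg s by simp
  have "eventually (\<lambda>r. ?c r \<in> stabilizing (T j) \<and> gap j (?c r) \<le> \<gamma> j * gap j K0) (at_right s)"
    if j: "j \<in> {1..M}" for j
  proof -
    interpret l: lqr D "T j" \<mu> by (rule task[OF j])
    have st: "?c s \<in> stabilizing (T j)" by (rule S_stabilizing[OF cs j])
    have lim: "(?c \<longlongrightarrow> ?c s) (at_right s)" by (intro tendsto_intros)
    have ev: "eventually (\<lambda>r. ?c r \<in> stabilizing (T j)) (at_right s)"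
      by (rule topological_tendstoD[OF lim l.open_stabilizing st])
    have le: "gap j (?c s) \<le> \<gamma> j * gap j K0" using cs j by (simp add: S_iff)
    have "eventually (\<lambda>r. gap j (?c r) \<le> \<gamma> j * gap j K0) (at_right s)"
    proof (cases "gap j (?c s) = \<gamma> j * gap j K0")
      case False
      with le have lt: "gap j (?c s) < \<gamma> j * gap j K0" by simp
      have "((\<lambda>r. gap j (?c r)) \<longlongrightarrow> gap j (?c s)) (at_right s)"
        unfolding cost_gap_def by (intro tendsto_intros isCont_tendsto_compose[OF l.J_cont[OF st] lim])
      from order_tendstoD(2)[OF this lt] show ?thesis by eventually_elim simp
    next
      case True
      let ?w = "gradient (J j) (?c s)" and ?g = "gradient (J j) K"
      \<comment> \<open>The current gap equals its threshold, and membership of \<open>K0\<close> in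
        its own sublevel set says that the threshold is at least the initial gap.\<close>
      have "gap j K0 \<le> gap j (?c s)" using K0_mem j True by (simp add: S_iff)
      then have "lambda_task D \<mu> (T j) * gap j K0 \<le> lambda_task D \<mu> (T j) * gap j (?c s)"
        using l.lambda_pos[OF st] by (intro mult_left_mono) auto
      then have big: "lambda_task D \<mu> (T j) * gap j K0 \<le> (norm ?w)\<^sup>2"
        using l.gradient_dominance[OF st] by linarith
      have "0 < (norm ?w)\<^sup>2"
        using big l.lambda_pos[OF st] gap0[OF j] by (meson less_le_trans mult_pos_pos)
      then have w0: "0 < norm ?w" by simp
      have "(16 * \<delta>)\<^sup>2 = 256 * \<delta>\<^sup>2" by (simp add: power_mult_distrib)
      then have "(16 * \<delta>)\<^sup>2 \<le> (norm ?w)\<^sup>2"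
        using big het[OF j] zero_le_power2[of \<delta>] by linarith
      then have wd: "16 * \<delta> \<le> norm ?w" by (rule power2_le_imp_le) simp
      have "L * s * norm V \<le> L * b * norm V"
        using L_nonneg s by (intro mult_right_mono mult_left_mono) auto
      also have "\<dots> \<le> 1 / 4 * norm V" using b(2) by (intro mult_right_mono) (simp_all add: mult.commute)
      finally have "norm (?w - ?g) \<le> norm V / 4" using gradient_segment[OF j seg s(1)] by simp
      from inner_pos_of_close[OF \<delta> V[OF j] this w0 wd] have pos: "0 < ?w \<bullet> V" .
      have "(J j has_derivative (\<lambda>H. H \<bullet> ?w)) (at (?c s))"
        using l.GDERIV_cost[OF st] by (simp add: gderiv_def l.gradient_cost[OF st])
      moreover have "(?c has_derivative (\<lambda>h. - (h *\<^sub>R V))) (at s)"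
        by (auto intro!: derivative_eq_intros)
      ultimately have "((\<lambda>r. J j (?c r)) has_derivative (\<lambda>h. - (h *\<^sub>R V) \<bullet> ?w)) (at s)"
        by (rule has_derivative_compose[rotated])
      then have "((\<lambda>r. J j (?c r)) has_real_derivative - (?w \<bullet> V)) (at s)"
        unfolding has_field_derivative_def
        by (rule has_derivative_eq_rhs) (simp add: fun_eq_iff inner_commute)
      from DERIV_neg_dec_right[OF this] pos obtain d where d: "d > 0" "\<And>h. 0 < h \<Longrightarrow> h < d \<Longrightarrow> J j (?c (s + h)) < J j (?c s)"
        by auto
      have "J j (?c r) \<le> J j (?c s)" if "s < r" "r < s + d" for r
        using d(2)[of "r - s"] that by simp
      then have "eventually (\<lambda>r. J j (?c r) \<le> J j (?c s)) (at_right s)"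
        unfolding eventually_at_right_field using d(1) by (intro exI[of _ "s + d"]) auto
      then show ?thesis
      proof eventually_elim
        case (elim r)
        then have "gap j (?c r) \<le> gap j (?c s)" by (simp add: cost_gap_def)
        then show ?case using le by linarith
      qed
    qed
    with ev show ?thesis by eventually_elim simp
  qed
  then show "eventually (\<lambda>r. ?c r \<in> SS) (at_right s)"
    unfolding S_iff by (intro eventually_ball_finite) auto
qed

end

theorem theorem1:
  fixes D :: "(real^'x::finite) measure"
    and M :: nat
    and T :: "nat \<Rightarrow> ('x, 'u::finite) lqr_task"
    and \<mu> \<eta>l \<eta> :: real
    and \<gamma> \<epsilon> :: "nat \<Rightarrow> real"
    and K0 :: "real^'x^'u"
    and z :: nat
  defines "S \<equiv> S_ML D M T \<gamma> K0"
  assumes "M \<ge> 1"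
    and "CARD('u) \<le> CARD('x)"
    and "\<And>i. i \<in> {1..M} \<Longrightarrow> posdef (Qmat (T i))"
    and "\<And>i. i \<in> {1..M} \<Longrightarrow> posdef (Rmat (T i))"
    and "prob_space D" and "sets D = sets borel"
    and "integrable D (\<lambda>x. (norm x)\<^sup>2)"
    and "(\<integral>x. x \<partial>D) = 0"
    and "\<mu> > 0" and "posdef (init_cov D - \<mu> *\<^sub>R mat 1)"
    and "\<And>i. i \<in> {1..M} \<Longrightarrow> \<gamma> i > 0"
    and "\<And>k. k \<in> {1..4} \<Longrightarrow> \<epsilon> k \<ge> 0"
    and "\<And>i j. \<lbrakk>i \<in> {1..M}; j \<in> {1..M}; i \<noteq> j\<rbrakk> \<Longrightarrow> spec_norm (Amat (T i) - Amat (T j)) \<le> \<epsilon> 1"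
    and "\<And>i j. \<lbrakk>i \<in> {1..M}; j \<in> {1..M}; i \<noteq> j\<rbrakk> \<Longrightarrow> spec_norm (Bmat (T i) - Bmat (T j)) \<le> \<epsilon> 2"
    and "\<And>i j. \<lbrakk>i \<in> {1..M}; j \<in> {1..M}; i \<noteq> j\<rbrakk> \<Longrightarrow> spec_norm (Qmat (T i) - Qmat (T j)) \<le> \<epsilon> 3"
    and "\<And>i j. \<lbrakk>i \<in> {1..M}; j \<in> {1..M}; i \<noteq> j\<rbrakk> \<Longrightarrow> spec_norm (Rmat (T i) - Rmat (T j)) \<le> \<epsilon> 4"
    and "z \<in> {1, 2, 3}"
    and "z = 1 \<Longrightarrow> \<epsilon> 3 = 0 \<and> \<epsilon> 4 = 0"
    and "z = 2 \<Longrightarrow> \<epsilon> 1 = 0 \<and> \<epsilon> 2 = 0"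
    and "K0 \<in> S"
    and "\<eta>l > 0" and "\<eta> > 0"
    and "\<eta>l \<le> Min {real CARD('u) / (sqrt 2 * sup_on S (h_H D M T \<mu>)),
                   1 / (sqrt 2 * sup_on S (h_grad D M T \<mu>)),
                   1 / sqrt (12 * (12 * (sup_on S (h_grad D M T \<mu>))\<^sup>2 * (real CARD('u))\<^sup>2
                                   + (sup_on S (h_H D M T \<mu>))\<^sup>2))}"
    and "\<eta> \<le> 1 / (4 * sup_on S (h_grad D M T \<mu>))"
    and "sup_on S (f_het D M T \<mu> \<epsilon>)
         \<le> sqrt (MIN i\<in>{1..M}. lambda_task D \<mu> (T i) * cost_gap D (T i) K0 / (288 * real CARD('u) ^ 3))"
  shows "\<forall>n. (\<forall>i\<in>{1..M}. inner_step D T \<eta>l i (maml D M T \<eta>l \<eta> K0 n) \<in> S)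
              \<and> maml D M T \<eta>l \<eta> K0 n \<in> S"
proof -
  have S: "S = S_ML D M T \<gamma> K0" by (simp add: assms(1))
  have "lqr D (T i) \<mu>" if "i \<in> {1..M}" for i
    using assms that by (intro lqr.intro) auto
  then interpret multi_lqr D M T \<mu> \<gamma> K0
    using assms by (intro multi_lqr.intro) (auto simp: S)
  let ?n = "real CARD('u)"
  define F where "F = sup_on SS (f_het D M T \<mu> \<epsilon>)"
  \<comment> \<open>F bounds gradient differences in the spectral norm; the root of n_u makes
    \<delta> a bound in the Frobenius norm.\<close>
  define \<delta> where "\<delta> = sqrt ?n * F"
  have n1: "1 \<le> ?n" by (simp add: Suc_leI)
  have F0: "0 \<le> F"
    unfolding F_def using f_het_nonneg[OF K0_mem, of \<epsilon>] le_sup_on[OF bnd_f_het K0_mem] assms(13)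
    by (meson order_trans)
  then have \<delta>0: "0 \<le> \<delta>" by (simp add: \<delta>_def)
  have lam: "0 \<le> lambda_task D \<mu> (T i) * gap i K0" if "i \<in> {1..M}" for i
    using lqr.lambda_pos[OF task[OF that] K0_stabilizing[OF that]]
      lqr.cost_gap_nonneg[OF task[OF that] K0_stabilizing[OF that]] by simp
  have het: "288 * \<delta>\<^sup>2 \<le> lambda_task D \<mu> (T i) * gap i K0" if i: "i \<in> {1..M}" for i
  proof -
    let ?m = "MIN i\<in>{1..M}. lambda_task D \<mu> (T i) * gap i K0 / (288 * ?n ^ 3)"
    have "F \<le> sqrt ?m" using assms(26) by (simp add: F_def S)
    also have "\<dots> \<le> sqrt (lambda_task D \<mu> (T i) * gap i K0 / (288 * ?n ^ 3))"
      using i by (intro real_sqrt_le_mono Min_le) auto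
    finally have "F\<^sup>2 \<le> lambda_task D \<mu> (T i) * gap i K0 / (288 * ?n ^ 3)"
      using F0 lam[OF i] n1 by (metis power_mono real_sqrt_pow2 divide_nonneg_nonneg mult_nonneg_nonneg of_nat_0_le_iff zero_le_numeral zero_le_power)
    then have "288 * ?n * F\<^sup>2 * ?n\<^sup>2 \<le> lambda_task D \<mu> (T i) * gap i K0"
      using n1 by (simp add: field_simps power2_eq_square power3_eq_cube)
    moreover have "288 * ?n * F\<^sup>2 * 1 \<le> 288 * ?n * F\<^sup>2 * ?n\<^sup>2"
      using n1 by (intro mult_left_mono) (auto simp: one_le_power)
    moreover have "288 * \<delta>\<^sup>2 = 288 * ?n * F\<^sup>2 * 1" by (simp add: \<delta>_def power_mult_distrib)
    ultimately show ?thesis by linarith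
  qed
  have grad_diff: "norm (gradient (J i) K - gradient (J j) K) \<le> \<delta>"
    if K: "K \<in> SS" and i: "i \<in> {1..M}" and j: "j \<in> {1..M}" for K i j
  proof (cases "i = j")
    case False
    have "spec_norm (gradient (J i) K - gradient (J j) K) \<le> F"
      unfolding F_def using gradient_heterogeneity[OF K i j] assms(14-17)[OF i j False]
        le_sup_on[OF bnd_f_het K] by (meson order_trans)
    then show ?thesis
      unfolding \<delta>_def by (intro order_trans[OF norm_le_sqrt_card_spec] mult_left_mono) auto
  qed (simp add: \<delta>0)
  \<comment> \<open>From the third bound on the inner step: its root is at least 12 L n_u, hence at
    least 12 L. Division by L needs L nonzero, and the claim is trivial otherwise.\<close>
  have \<eta>l: "\<eta>l * L \<le> 1 / 12"
  proof (cases "L = 0")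
    case False
    let ?h = "sup_on SS (h_H D M T \<mu>)"
    have L: "0 < L" using False L_nonneg by simp
    have "12 * L \<le> 12 * L * ?n" using L n1 by simp
    also have "\<dots> = sqrt ((12 * L * ?n)\<^sup>2)" using L by simp
    also have "\<dots> \<le> sqrt (12 * (12 * L\<^sup>2 * ?n\<^sup>2 + ?h\<^sup>2))"
      by (intro real_sqrt_le_mono) (simp add: power_mult_distrib)
    finally have le: "12 * L \<le> sqrt (12 * (12 * L\<^sup>2 * ?n\<^sup>2 + ?h\<^sup>2))" .
    then have "1 / sqrt (12 * (12 * L\<^sup>2 * ?n\<^sup>2 + ?h\<^sup>2)) \<le> 1 / (12 * L)"
      by (intro divide_left_mono mult_pos_pos) (use le L in linarith)+
    moreover have "\<eta>l \<le> 1 / sqrt (12 * (12 * L\<^sup>2 * ?n\<^sup>2 + ?h\<^sup>2))"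
      using assms(24) by (simp add: S)
    ultimately have "\<eta>l \<le> 1 / (12 * L)" by linarith
    then show ?thesis using L by (simp add: field_simps)
  qed simp
  have \<eta>: "\<eta> * L \<le> 1 / 4"
  proof (cases "L = 0")
    case False
    then have "0 < L" using L_nonneg by simp
    then show ?thesis using assms(25) by (simp add: S field_simps)
  qed simp
  let ?V = "\<lambda>K. (1 / real M) *\<^sub>R (\<Sum>i\<in>{1..M}. H_op D T \<eta>l i K (gradient (J i) (inner_step D T \<eta>l i K)))"
  have main: "(\<forall>i\<in>{1..M}. inner_step D T \<eta>l i K \<in> SS) \<and> K - \<eta> *\<^sub>R ?V K \<in> SS" if K: "K \<in> SS" for K
  proof (cases "\<exists>j\<in>{1..M}. gap j K0 \<le> 0")
    case True
    then obtain j where j: "j \<in> {1..M}" "gap j K0 \<le> 0" by blast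
    have "gap j K0 = 0" using lqr.cost_gap_nonneg[OF task[OF j(1)] K0_stabilizing[OF j(1)]] j(2) by simp
    then have "\<delta> = 0" using het[OF j(1)] by simp
    have "gap j K \<le> \<gamma> j * gap j K0" using K j(1) unfolding S_iff by blast
    then have "gap j K \<le> 0" using \<open>gap j K0 = 0\<close> by simp
    then have "gradient (J j) K = 0"
      by (rule lqr.gradient_zero[OF task[OF j(1)] S_stabilizing[OF K j(1)]])
    then have g0: "gradient (J i) K = 0" if "i \<in> {1..M}" for i
      using grad_diff[OF K that j(1)] \<open>\<delta> = 0\<close> by simp
    have inner: "inner_step D T \<eta>l i K = K" if "i \<in> {1..M}" for i
      using g0[OF that] by (simp add: inner_step_def)
    have "H_op D T \<eta>l i K 0 = 0" if i: "i \<in> {1..M}" for i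
      using lqr.norm_dgrad[OF task[OF i] S_stabilizing[OF K i], of 0]
      by (simp add: H_op_def lqr.hessian_cost[OF task[OF i] S_stabilizing[OF K i]])
    then have V0: "?V K = 0" using inner g0 by simp
    have "K - \<eta> *\<^sub>R ?V K = K" unfolding V0 by simp
    then have "K - \<eta> *\<^sub>R ?V K \<in> SS" using K by (simp only:)
    then show ?thesis using inner K by auto
  next
    case False
    then have gap0: "\<And>j. j \<in> {1..M} \<Longrightarrow> 0 < gap j K0" by force
    have seg: "K - r *\<^sub>R gradient (J i) K \<in> SS" if i: "i \<in> {1..M}" and r: "0 \<le> r" "r \<le> \<eta>l" for i r
    proof (rule step_stays[OF K \<delta>0 _ _ gap0 het _ r])
      show "0 \<le> \<eta>l" "\<eta>l * L \<le> 1 / 4" using assms(22) \<eta>l by simp_all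
      show "norm (gradient (J i) K - gradient (J j) K) \<le> norm (gradient (J j) K) / 4 + 2 * \<delta>"
        if "j \<in> {1..M}" for j
        using grad_diff[OF K i that] \<delta>0 norm_ge_zero[of "gradient (J j) K"] by linarith
    qed
    \<comment> \<open>The inner gradient step contributes 1/12 and the Hessian term 1/12 times
      13/12; together this is 25/144, below 3/16.\<close>
    have Vi: "norm (H_op D T \<eta>l i K (gradient (J i) (inner_step D T \<eta>l i K)) - gradient (J i) K)
        \<le> 3 / 16 * norm (gradient (J i) K)" if i: "i \<in> {1..M}" for i
    proof -
      let ?g = "gradient (J i) K" and ?b = "gradient (J i) (inner_step D T \<eta>l i K)"
      have "norm (?b - ?g) \<le> L * \<eta>l * norm ?g"
        unfolding inner_step_def using assms(22) by (intro gradient_segment[OF i] seg[OF i]) auto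
      also have "\<dots> \<le> 1 / 12 * norm ?g" using \<eta>l by (intro mult_right_mono) (simp_all add: mult.commute)
      finally have bg: "norm (?b - ?g) \<le> 1 / 12 * norm ?g" .
      then have nb: "norm ?b \<le> 13 / 12 * norm ?g" using norm_triangle_ineq[of ?g "?b - ?g"] by simp
      have "norm (\<eta>l *\<^sub>R hessian (J i) K ?b) \<le> \<eta>l * (h_grad D M T \<mu> K * norm ?b)"
        using norm_dgrad_le[OF K i, of ?b] assms(22)
        by (simp add: lqr.hessian_cost[OF task[OF i] S_stabilizing[OF K i]])
      also have "\<dots> \<le> \<eta>l * (L * norm ?b)"
        using assms(22) by (intro mult_left_mono mult_right_mono h_grad_le K) auto
      also have "\<dots> \<le> 1 / 12 * norm ?b"
        unfolding mult.assoc[symmetric] by (intro mult_right_mono \<eta>l) simp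
      also have "\<dots> \<le> 1 / 12 * (13 / 12 * norm ?g)" using nb by simp
      finally have hb: "norm (\<eta>l *\<^sub>R hessian (J i) K ?b) \<le> 1 / 12 * (13 / 12 * norm ?g)" .
      have "H_op D T \<eta>l i K ?b - ?g = (?b - ?g) - \<eta>l *\<^sub>R hessian (J i) K ?b" by (simp add: H_op_def)
      then have "norm (H_op D T \<eta>l i K ?b - ?g) \<le> norm (?b - ?g) + norm (\<eta>l *\<^sub>R hessian (J i) K ?b)"
        by (metis norm_triangle_ineq4)
      then show ?thesis using bg hb norm_ge_zero[of ?g] by linarith
    qed
    have "K - \<eta> *\<^sub>R ?V K \<in> SS"
    proof (rule step_stays[OF K \<delta>0 _ \<eta> gap0 het])
      fix j assume j: "j \<in> {1..M}"
      let ?g = "gradient (J j) K"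
      let ?U = "\<lambda>i. H_op D T \<eta>l i K (gradient (J i) (inner_step D T \<eta>l i K))"
      \<comment> \<open>Changing the reference task from i to j costs \<delta> twice, once with
        factor 3/16 inside the norm of \<open>?gi\<close>, so 19/16 \<delta> in total.\<close>
      have "norm (?U i - ?g) \<le> norm ?g / 4 + 2 * \<delta>" if i: "i \<in> {1..M}" for i
      proof -
        let ?gi = "gradient (J i) K"
        have "norm ?gi \<le> norm ?g + \<delta>"
          using norm_triangle_ineq[of ?g "?gi - ?g"] grad_diff[OF K i j] by simp
        moreover have "norm (?U i - ?g) \<le> norm (?U i - ?gi) + norm (?gi - ?g)"
          using norm_triangle_ineq[of "?U i - ?gi" "?gi - ?g"] by simp
        ultimately show ?thesis using Vi[OF i] grad_diff[OF K i j] \<delta>0 norm_ge_zero[of ?g] by linarith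
      qed
      then have "norm (\<Sum>i\<in>{1..M}. ?U i - ?g) \<le> real (card {1..M}) * (norm ?g / 4 + 2 * \<delta>)"
        by (rule sum_norm_bound)
      moreover have "?V K - ?g = (1 / real M) *\<^sub>R (\<Sum>i\<in>{1..M}. ?U i - ?g)"
        using M by (simp add: sum_subtractf scaleR_right_diff_distrib sum_constant_scaleR del: sum_constant)
      ultimately show "norm (?V K - ?g) \<le> norm ?g / 4 + 2 * \<delta>"
        using M by (simp add: field_simps)
    qed (use assms(23) in auto)
    moreover have "inner_step D T \<eta>l i K \<in> SS" if "i \<in> {1..M}" for i
      unfolding inner_step_def using assms(22) by (intro seg that) auto
    ultimately show ?thesis by blast
  qed
  have "maml D M T \<eta>l \<eta> K0 n \<in> SS" for n
  proof (induction n)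
    case 0
    then show ?case using K0_mem by simp
  next
    case (Suc n)
    from main[OF this] show ?case by (simp add: divide_inverse)
  qed
  then show ?thesis using main by (simp add: S)
qed

end
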